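(* Let $p,d\in\{1,2,\dots\}$, $j\in\{1,\dots,p\}$, and let $(\mathbf X,\mathbf Y)$, $\mathcal Z_n$, $k$, $\mathcal H$, $\mu$, the forests $\mu_n(\mathbf x)$ and $\mu_n(\mathbf x^{(-j)})$, the theoretical index $\mathrm I^{(j)}$ and its estimator $\mathrm I_n^{(j)}$ be as in the context. Assume that: (i) the forest construction satisfies the properties (F1)-(F5) listed in the context; (ii) the kernel $k$ is bounded and $(\mathbf x,\mathbf y)\mapsto k(\mathbf x,\mathbf y)$ is (jointly) continuous; (iii) the observations $\mathbf X_1,\dots,\mathbf X_n$ are independent and identically distributed on $[0,1]^p$, with a density bounded from below and above by strictly positive constants; (iv) the map $\mathbf x\mapsto \mu(\mathbf x)=\mathbb E[k(\mathbf Y,\cdot)\mid \mathbf X=\mathbf x]\in\mathcal H$ is Lipschitz; (v) the map $\mathbf x^{(-j)}\mapsto \mathbb E[k(\mathbf Y,\cdot)\mid \mathbf X^{(-j)}=\mathbf x^{(-j)}]\in\mathcal H$ is Lipschitz. Then $\mathrm I_n^{(j)}\to \mathrm I^{(j)}$ in probability as $n\to\infty$.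
   Context: Data and kernel. $k:\mathbb R^d\times\mathbb R^d\to\mathbb R$ is a positive definite, bounded, continuous kernel with reproducing kernel Hilbert space $\mathcal H$. $\mathbf X=(X^{(1)},\dots,X^{(p)})$ is a random input vector, $\mathbf Y\in\mathbb R^d$ a random output vector, and $(\mathbf X_i,\mathbf Y_i)$, $i\ge 1$, are i.i.d. copies of $(\mathbf X,\mathbf Y)$; $\mathbf Z_i=(\mathbf X_i,k(\mathbf Y_i,\cdot))\in\mathbb R^p\times\mathcal H$ and $\mathcal Z_n=\{\mathbf Z_i\}_{i=1}^n$. For a vector $\mathbf x\in\mathbb R^p$, $\mathbf x^{(-j)}$ is $\mathbf x$ with the $j$-th coordinate removed. Write $\mu(\mathbf x)=\mathbb E[k(\mathbf Y,\cdot)\mid\mathbf X=\mathbf x]\in\mathcal H$. Theoretical index. For an $\mathcal H$-valued random element $\xi$, $\mathbb V_{\mathcal H}[\xi]=\mathbb E\|\xi-\mathbb E\xi\|_{\mathcal H}^2$ and $\mathbb V_{\mathcal H}[\xi\mid\mathbf W]=\mathbb E[\|\xi-\mathbb E[\xi\mid\mathbf W]\|_{\mathcal H}^2\mid\mathbf W]$. Define $$\mathrm I^{(j)}=\frac{\mathbb E\big[\mathbb V_{\mathcal H}[\mu(\mathbf X)\mid\mathbf X^{(-j)}]\big]}{\mathbb V_{\mathcal H}[\mu(\mathbf X)]}.$$ Trees and forest (Distributional Random Forest, DRF). A tree is grown from a subsample of size $s_n$ of $\mathcal Z_n$ and a random element $\varepsilon$ (the tree randomization, e.g. the choice of splitting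 candidates), by recursive binary splits of the input space, each along one coordinate (the feature of the split); $\mathcal L(\mathbf x)$ denotes the terminal cell (leaf) containing $\mathbf x$. The tree output is $$T_n(\mathbf x;\varepsilon,\{\mathbf Z_{i_1},\dots,\mathbf Z_{i_{s_n}}\})=\sum_{m=1}^{s_n}\frac{\mathbf 1(\mathbf X_{i_m}\in\mathcal L(\mathbf x))}{|\mathcal L(\mathbf x)|}\,k(\mathbf Y_{i_m},\cdot)\in\mathcal H,$$ i.e. the average of $k(\mathbf Y_i,\cdot)$ over the data points in the leaf of $\mathbf x$, where only the points used for populating the leaves (see (F1)) are counted. The (infinite) forest is $$\mu_n(\mathbf x)=\binom{n}{s_n}^{-1}\sum_{i_1<\dots<i_{s_n}}\mathbb E\big[T_n(\mathbf x;\varepsilon,\{\mathbf Z_{i_1},\dots,\mathbf Z_{i_{s_n}}\})\mid\mathcal Z_n\big].$$ $\mu_n(\mathbf x^{(-j)})$ denotes the forest estimate constructed in the same way, but retrained on the data with the $j$-th input variable removed, evaluated at $\mathbf x^{(-j)}$. Forest properties. (F1) Honesty: the data used for constructing each tree is split into two halves; the first is used for determining the splits and the second for populating the leaves and thus for estimating the response. The covariates in the second sample may be used for the splits, to enforce the subsequent properties, but not the response. (F2) Random-split: at every split point and for all features $l=1,\dots,p$, the probability that the split occurs along feature $l$ is bounded from below by $\pi/p$, for some $\pi>0$. (F3) Symmetry: the (randomized) output of a tree does not depend on the ordering of the training samples. (F4) $\alpha$-regularity: after splitting a parent node, each child node contains at least a fraction $\alpha\le 0.2$ of the parent's training samples.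 Moreover, the trees are grown until every leaf contains between $\kappa$ and $2\kappa-1$ observations, for some fixed tuning parameter $\kappa\in\mathbb N$. (F5) Data sampling: to grow a tree, a subsample of size $s_n$ out of the $n$ training data points is sampled, with $s_n=n^\beta$, $0<\beta<1$. Estimator. Let $\mathbf X'_1,\dots,\mathbf X'_n$ be an independent sample (i.i.d. copies of $\mathbf X$, independent of $\mathcal Z_n$). Then $$\mathrm I_n^{(j)}=\frac{\sum_{i=1}^n\|\mu_n(\mathbf X'_i)-\mu_n(\mathbf X_i'^{(-j)})\|_{\mathcal H}^2}{\sum_{i=1}^n\big\|\mu_n(\mathbf X'_i)-\frac1n\sum_{i'=1}^n\mu_n(\mathbf X'_{i'})\big\|_{\mathcal H}^2}-\mathrm I_n^{(0)},$$ where $\mathrm I_n^{(0)}$ is the same ratio with $\mu_n(\mathbf X_i'^{(-j)})$ replaced by the forest retrained with all inputs and new independent tree randomizations; for infinite forests this retrained forest coincides with $\mu_n$, so that $\mathrm I_n^{(0)}=0$. *)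

theory Defs
  imports "HOL-Probability.Probability"
begin

section \<open>Reproducing kernel Hilbert spaces\<close>

definition positive_definite_kernel :: "('y \<Rightarrow> 'y \<Rightarrow> real) \<Rightarrow> bool" where
  "positive_definite_kernel k \<longleftrightarrow>
     (\<forall>y y'. k y y' = k y' y) \<and>
     (\<forall>A c. finite A \<longrightarrow> (\<Sum>y\<in>A. \<Sum>y'\<in>A. c y * c y' * k y y') \<ge> 0)"

text \<open>
  The Hilbert space is a type, and \<open>val\<close> realises its elements as functions: \<open>val f y\<close> is
  the value of \<open>f\<close> at \<open>y\<close>. The separability sort constraint is what Bochner integration
  needs; the RKHS of a continuous kernel on a Euclidean space always satisfies it.
\<close>

definition rkhs_of ::
  "('y \<Rightarrow> 'y \<Rightarrow> real) \<Rightarrow> ('h::{real_inner, banach, second_countable_topology} \<Rightarrow> 'y \<Rightarrow> real) \<Rightarrow> bool"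
where
  "rkhs_of k val \<longleftrightarrow>
     inj val \<and> (\<forall>y. linear (\<lambda>f. val f y)) \<and>
     (\<forall>y. \<exists>h. val h = k y \<and> (\<forall>f. val f y = inner f h))"

definition kernel_section :: "('y \<Rightarrow> 'y \<Rightarrow> real) \<Rightarrow> ('h \<Rightarrow> 'y \<Rightarrow> real) \<Rightarrow> 'y \<Rightarrow> 'h" where
  "kernel_section k val y = (THE h. val h = k y)"


section \<open>Hilbert-space-valued conditional expectation and variance\<close>

definition has_cond_exp ::
  "'w measure \<Rightarrow> 'w measure \<Rightarrow> ('w \<Rightarrow> 'h::{banach, second_countable_topology}) \<Rightarrow> ('w \<Rightarrow> 'h) \<Rightarrow> bool"
where
  "has_cond_exp M G f g \<longleftrightarrow>
     subalgebra M G \<and> integrable M f \<and> integrable M g \<and> g \<in> borel_measurable G \<and>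
     (\<forall>A\<in>sets G. (\<integral>w\<in>A. f w \<partial>M) = (\<integral>w\<in>A. g w \<partial>M))"

definition cond_expectation ::
  "'w measure \<Rightarrow> 'w measure \<Rightarrow> ('w \<Rightarrow> 'h::{banach, second_countable_topology}) \<Rightarrow> 'w \<Rightarrow> 'h"
where
  "cond_expectation M G f =
     (if \<exists>g. has_cond_exp M G f g then SOME g. has_cond_exp M G f g else (\<lambda>_. 0))"

definition sigma_of :: "'w measure \<Rightarrow> ('w \<Rightarrow> 'a) \<Rightarrow> 'a measure \<Rightarrow> 'w measure" where
  "sigma_of M W N = vimage_algebra (space M) W N"

text \<open>\<open>m\<close> is a version of \<open>w \<mapsto> E[f | W = w]\<close>.\<close>

definition regression_function ::
  "'w measure \<Rightarrow> 'a measure \<Rightarrow> ('w \<Rightarrow> 'a) \<Rightarrow> ('w \<Rightarrow> 'h::{banach, second_countable_topology})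
     \<Rightarrow> ('a \<Rightarrow> 'h) \<Rightarrow> bool"
where
  "regression_function M N W f m \<longleftrightarrow>
     W \<in> measurable M N \<and> m \<in> borel_measurable N \<and>
     has_cond_exp M (sigma_of M W N) f (\<lambda>w. m (W w))"

definition hvariance :: "'w measure \<Rightarrow> ('w \<Rightarrow> 'h::{banach, second_countable_topology}) \<Rightarrow> real" where
  "hvariance M \<xi> = (\<integral>w. (norm (\<xi> w - (\<integral>v. \<xi> v \<partial>M)))\<^sup>2 \<partial>M)"

definition cond_hvariance ::
  "'w measure \<Rightarrow> 'w measure \<Rightarrow> ('w \<Rightarrow> 'h::{banach, second_countable_topology}) \<Rightarrow> 'w \<Rightarrow> real"
where
  "cond_hvariance M G \<xi> =
     real_cond_exp M G (\<lambda>w. (norm (\<xi> w - cond_expectation M G \<xi> w))\<^sup>2)"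


section \<open>Input spaces\<close>

text \<open>
  Inputs with feature set \<open>F\<close> are functions in \<open>extensional F\<close>; removing features is
  restriction to a smaller set.
\<close>

type_synonym input = "nat \<Rightarrow> real"

abbreviation input_space :: "nat set \<Rightarrow> input measure" where
  "input_space F \<equiv> PiM F (\<lambda>_. borel)"

definition unit_cube :: "nat set \<Rightarrow> input set" where
  "unit_cube F = PiE F (\<lambda>_. {0..1})"

definition lipschitz_on_cube :: "nat set \<Rightarrow> (input \<Rightarrow> 'h::real_normed_vector) \<Rightarrow> bool" where
  "lipschitz_on_cube F m \<longleftrightarrow>
     (\<exists>L. \<forall>x\<in>unit_cube F. \<forall>x'\<in>unit_cube F.
        norm (m x - m x') \<le> L * L2_set (\<lambda>i. x i - x' i) F)"

definition has_bounded_cube_density :: "'w measure \<Rightarrow> nat set \<Rightarrow> ('w \<Rightarrow> input) \<Rightarrow> bool" where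
  "has_bounded_cube_density M F X \<longleftrightarrow>
     (\<exists>f :: input \<Rightarrow> real. \<exists>c C. 0 < c \<and>
        distributed M (PiM F (\<lambda>_. lborel)) X (\<lambda>x. ennreal (f x)) \<and>
        (\<forall>x\<in>unit_cube F. c \<le> f x \<and> f x \<le> C) \<and>
        (\<forall>x. x \<notin> unit_cube F \<longrightarrow> f x = 0))"


section \<open>Binary splitting trees\<close>

text \<open>
  \<open>Split l t L R\<close> sends \<open>x\<close> to \<open>L\<close> if \<open>x l \<le> t\<close> and to \<open>R\<close> otherwise. A node is addressed
  by the list of turns leading to it from the root (\<open>True\<close> meaning left).
\<close>

datatype tree = Leaf | Split nat real tree tree

fun tree_features :: "tree \<Rightarrow> nat set" where
  "tree_features Leaf = {}"
| "tree_features (Split l t L R) = insert l (tree_features L \<union> tree_features R)"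

fun leaf_cell :: "tree \<Rightarrow> input \<Rightarrow> input set" where
  "leaf_cell Leaf x = UNIV"
| "leaf_cell (Split l t L R) x =
     (if x l \<le> t then {u. u l \<le> t} \<inter> leaf_cell L x else {u. u l > t} \<inter> leaf_cell R x)"

text \<open>All nodes of a tree, each given by its cell and the subtree hanging below it.\<close>

fun nodes :: "input set \<Rightarrow> tree \<Rightarrow> (input set \<times> tree) set" where
  "nodes A Leaf = {(A, Leaf)}"
| "nodes A (Split l t L R) =
     insert (A, Split l t L R) (nodes (A \<inter> {u. u l \<le> t}) L \<union> nodes (A \<inter> {u. u l > t}) R)"

text \<open>\<open>None\<close> if the address is a leaf or does not belong to the tree.\<close>

fun split_at :: "tree \<Rightarrow> bool list \<Rightarrow> (nat \<times> real) option" where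
  "split_at Leaf a = None"
| "split_at (Split l t L R) [] = Some (l, t)"
| "split_at (Split l t L R) (b # a) = split_at (if b then L else R) a"

definition split_space :: "(nat \<times> real) option measure" where
  "split_space = sigma UNIV {Some ` A | A. A \<in> sets (count_space UNIV \<Otimes>\<^sub>M borel)}"

definition tree_space :: "tree measure" where
  "tree_space = vimage_algebra UNIV split_at (PiM UNIV (\<lambda>_. split_space))"

definition split_history :: "tree \<Rightarrow> bool list \<Rightarrow> nat \<Rightarrow> (nat \<times> real) option" where
  "split_history T a = (\<lambda>i\<in>{..<length a}. split_at T (take i a))"


section \<open>Randomized honest trees and forests\<close>

type_synonym 'h sample = "nat \<Rightarrow> input \<times> 'h"

definition sample_space :: "nat set \<Rightarrow> nat \<Rightarrow> 'h::topological_space sample measure" where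
  "sample_space F s = PiM {..<s} (\<lambda>_. input_space F \<Otimes>\<^sub>M borel)"

text \<open>
  \<open>rand\<close> is the law of the tree randomization, \<open>split_half\<close> gives the positions in the subsample
  of the points used for determining the splits, and \<open>grow\<close> returns the tree.
\<close>

record ('e, 'h) tree_procedure =
  rand :: "'e measure"
  split_half :: "'e \<Rightarrow> nat set"
  grow :: "'e \<Rightarrow> 'h sample \<Rightarrow> tree"

definition leaf_half :: "('e, 'h) tree_procedure \<Rightarrow> nat \<Rightarrow> 'e \<Rightarrow> nat set" where
  "leaf_half P s e = {..<s} - split_half P e"

definition cell_count :: "('e, 'h) tree_procedure \<Rightarrow> nat \<Rightarrow> 'e \<Rightarrow> 'h sample \<Rightarrow> input set \<Rightarrow> nat" where
  "cell_count P s e z A = card {m \<in> leaf_half P s e. fst (z m) \<in> A}"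

definition tree_output ::
  "('e, 'h::real_vector) tree_procedure \<Rightarrow> nat \<Rightarrow> input \<Rightarrow> 'e \<Rightarrow> 'h sample \<Rightarrow> 'h"
where
  "tree_output P s x e z =
     (let A = leaf_cell (grow P e z) x in
      \<Sum>m\<in>leaf_half P s e. (indicator A (fst (z m)) / real (cell_count P s e z A)) *\<^sub>R snd (z m))"

definition subsample :: "'h sample \<Rightarrow> nat set \<Rightarrow> 'h sample" where
  "subsample D I = (\<lambda>m\<in>{..<card I}. D (sorted_list_of_set I ! m))"

text \<open>
  The randomization is independent of the data, so the conditional expectation of the tree output
  given the data is the integral over the law of the randomization, for every \<open>x\<close> at once.
\<close>

definition infinite_forest ::
  "('e, 'h::{banach, second_countable_topology}) tree_procedure \<Rightarrow> nat \<Rightarrow> nat \<Rightarrow> 'h sample \<Rightarrow> input \<Rightarrow> 'h"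
where
  "infinite_forest P s n D x =
     (1 / real (n choose s)) *\<^sub>R
       (\<Sum>I | I \<subseteq> {1..n} \<and> card I = s. \<integral>e. tree_output P s x e (subsample D I) \<partial>rand P)"

definition well_formed_procedure ::
  "nat set \<Rightarrow> nat \<Rightarrow> ('e, 'h::{banach, second_countable_topology}) tree_procedure \<Rightarrow> bool"
where
  "well_formed_procedure F s P \<longleftrightarrow>
     prob_space (rand P) \<and>
     split_half P \<in> measurable (rand P) (count_space UNIV) \<and>
     (\<lambda>(e, z). grow P e z) \<in> measurable (rand P \<Otimes>\<^sub>M sample_space F s) tree_space \<and>
     (\<forall>e\<in>space (rand P). \<forall>z\<in>space (sample_space F s). tree_features (grow P e z) \<subseteq> F)"

text \<open>
  Samples with ties in some coordinate, on which regular splitting can be impossible, are excluded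
  below; they have probability zero when the inputs have a density.
\<close>

definition tie_free :: "nat set \<Rightarrow> nat \<Rightarrow> 'h sample \<Rightarrow> bool" where
  "tie_free F s z \<longleftrightarrow> (\<forall>l\<in>F. inj_on (\<lambda>m. fst (z m) l) {..<s})"

definition tie_free_samples :: "nat set \<Rightarrow> nat \<Rightarrow> 'h::topological_space sample set" where
  "tie_free_samples F s = {z \<in> space (sample_space F s). tie_free F s z}"

definition honest ::
  "nat set \<Rightarrow> nat \<Rightarrow> ('e, 'h::{banach, second_countable_topology}) tree_procedure \<Rightarrow> bool"
where
  "honest F s P \<longleftrightarrow>
     (\<forall>e\<in>space (rand P). split_half P e \<subseteq> {..<s} \<and> card (split_half P e) \<in> {s div 2, s - s div 2} \<and>
       (\<forall>z\<in>space (sample_space F s). \<forall>z'\<in>space (sample_space F s).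
          (\<forall>m<s. fst (z m) = fst (z' m)) \<and> (\<forall>m\<in>split_half P e. snd (z m) = snd (z' m))
            \<longrightarrow> grow P e z = grow P e z'))"

text \<open>
  The bound holds for a fixed sample, conditionally on the splits made at the ancestors of the
  node, which is addressed by \<open>a\<close>.
\<close>

definition random_split ::
  "real \<Rightarrow> nat set \<Rightarrow> nat \<Rightarrow> ('e, 'h::{banach, second_countable_topology}) tree_procedure \<Rightarrow> bool"
where
  "random_split \<pi> F s P \<longleftrightarrow>
     (\<forall>z\<in>tie_free_samples F s. \<forall>a. \<forall>l\<in>F. \<forall>B\<in>sets (PiM {..<length a} (\<lambda>_. split_space)).
        \<P>(e in rand P. split_at (grow P e z) a \<noteq> None \<and> split_history (grow P e z) a \<in> B) > 0 \<longrightarrow>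
        \<P>(e in rand P. (\<exists>t. split_at (grow P e z) a = Some (l, t)) \<bar>
             split_at (grow P e z) a \<noteq> None \<and> split_history (grow P e z) a \<in> B) \<ge> \<pi> / real (card F))"

definition symmetric_output ::
  "nat set \<Rightarrow> nat \<Rightarrow> ('e, 'h::{banach, second_countable_topology}) tree_procedure \<Rightarrow> bool"
where
  "symmetric_output F s P \<longleftrightarrow>
     (\<forall>z\<in>tie_free_samples F s. \<forall>x\<in>space (input_space F). \<forall>\<sigma>. \<sigma> permutes {..<s} \<longrightarrow>
        distr (rand P) borel (\<lambda>e. tree_output P s x e (z \<circ> \<sigma>)) =
        distr (rand P) borel (\<lambda>e. tree_output P s x e z))"

text \<open>
  Observations are counted in the half populating the leaves. The leaf sizes are unconstrained in
  the two cases where they cannot be attained: if this half has fewer than \<open>\<kappa>\<close> points, and if there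
  is no feature to split on.
\<close>

definition regular ::
  "real \<Rightarrow> nat \<Rightarrow> nat set \<Rightarrow> nat \<Rightarrow> ('e, 'h::{banach, second_countable_topology}) tree_procedure \<Rightarrow> bool"
where
  "regular \<alpha> \<kappa> F s P \<longleftrightarrow>
     (\<forall>e\<in>space (rand P). \<forall>z\<in>tie_free_samples F s.
        (\<forall>A l t L R. (A, Split l t L R) \<in> nodes UNIV (grow P e z) \<longrightarrow>
           real (cell_count P s e z (A \<inter> {u. u l \<le> t})) \<ge> \<alpha> * real (cell_count P s e z A) \<and>
           real (cell_count P s e z (A \<inter> {u. u l > t})) \<ge> \<alpha> * real (cell_count P s e z A)) \<and>
        (F \<noteq> {} \<and> \<kappa> \<le> card (leaf_half P s e) \<longrightarrow>
           (\<forall>A. (A, Leaf) \<in> nodes UNIV (grow P e z) \<longrightarrow>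
              \<kappa> \<le> cell_count P s e z A \<and> cell_count P s e z A \<le> 2 * \<kappa> - 1)))"

definition subsample_size :: "real \<Rightarrow> nat \<Rightarrow> nat" where
  "subsample_size \<beta> n = nat \<lfloor>real n powr \<beta>\<rfloor>"

text \<open>
  A forest construction gives a tree procedure for each feature set and each \<open>n\<close>; the constants
  do not depend on \<open>n\<close>.
\<close>

type_synonym ('e, 'h) forest_construction = "nat set \<Rightarrow> nat \<Rightarrow> ('e, 'h) tree_procedure"

definition forest_properties ::
  "real \<Rightarrow> real \<Rightarrow> nat \<Rightarrow> real \<Rightarrow> nat set
     \<Rightarrow> ('e, 'h::{banach, second_countable_topology}) forest_construction \<Rightarrow> bool"
where
  "forest_properties \<pi> \<alpha> \<kappa> \<beta> F C \<longleftrightarrow>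
     0 < \<pi> \<and> 0 < \<alpha> \<and> \<alpha> \<le> 0.2 \<and> 1 \<le> \<kappa> \<and> 0 < \<beta> \<and> \<beta> < 1 \<and>
     (\<forall>n. well_formed_procedure F (subsample_size \<beta> n) (C F n) \<and>
          honest F (subsample_size \<beta> n) (C F n) \<and>
          random_split \<pi> F (subsample_size \<beta> n) (C F n) \<and>
          symmetric_output F (subsample_size \<beta> n) (C F n) \<and>
          regular \<alpha> \<kappa> F (subsample_size \<beta> n) (C F n))"

text \<open>The forest trained on, and evaluated with, the features in \<open>F\<close> only.\<close>

definition forest_estimate ::
  "('e, 'h::{banach, second_countable_topology}) forest_construction \<Rightarrow> real \<Rightarrow> nat set \<Rightarrow> nat
     \<Rightarrow> 'h sample \<Rightarrow> input \<Rightarrow> 'h"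
where
  "forest_estimate C \<beta> F n D x =
     infinite_forest (C F n) (subsample_size \<beta> n) n
       (\<lambda>i. (restrict (fst (D i)) F, snd (D i))) (restrict x F)"


section \<open>Variable importance\<close>

definition theoretical_index ::
  "'w measure \<Rightarrow> nat \<Rightarrow> nat \<Rightarrow> ('w \<Rightarrow> input) \<Rightarrow> (input \<Rightarrow> 'h::{banach, second_countable_topology}) \<Rightarrow> real"
where
  "theoretical_index M p j X \<mu> =
     (\<integral>w. cond_hvariance M
             (sigma_of M (\<lambda>w. restrict (X w) ({1..p} - {j})) (input_space ({1..p} - {j})))
             (\<lambda>w. \<mu> (X w)) w \<partial>M)
     / hvariance M (\<lambda>w. \<mu> (X w))"

definition importance_ratio :: "nat \<Rightarrow> (nat \<Rightarrow> 'h::real_normed_vector) \<Rightarrow> (nat \<Rightarrow> 'h) \<Rightarrow> real" where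
  "importance_ratio n u v =
     (\<Sum>i=1..n. (norm (u i - v i))\<^sup>2)
     / (\<Sum>i=1..n. (norm (u i - (1 / real n) *\<^sub>R (\<Sum>i'=1..n. u i')))\<^sup>2)"

text \<open>
  The subtracted ratio compares the forest with the one retrained on all inputs. The infinite forest
  integrates out the tree randomizations, so the two forests are the same function of the data.
\<close>

definition index_estimator ::
  "('e, 'h::{banach, second_countable_topology}) forest_construction \<Rightarrow> real \<Rightarrow> nat \<Rightarrow> nat \<Rightarrow> nat
     \<Rightarrow> 'h sample \<Rightarrow> (nat \<Rightarrow> input) \<Rightarrow> real"
where
  "index_estimator C \<beta> p j n D x' =
     importance_ratio n (\<lambda>i. forest_estimate C \<beta> {1..p} n D (x' i))
                        (\<lambda>i. forest_estimate C \<beta> ({1..p} - {j}) n D (x' i))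
     - importance_ratio n (\<lambda>i. forest_estimate C \<beta> {1..p} n D (x' i))
                          (\<lambda>i. forest_estimate C \<beta> {1..p} n D (x' i))"

definition converges_in_probability :: "'w measure \<Rightarrow> (nat \<Rightarrow> 'w \<Rightarrow> real) \<Rightarrow> real \<Rightarrow> bool" where
  "converges_in_probability M U c \<longleftrightarrow>
     (\<forall>n. U n \<in> borel_measurable M) \<and>
     (\<forall>\<delta>>0. (\<lambda>n. \<P>(w in M. \<bar>U n w - c\<bar> > \<delta>)) \<longlonglongrightarrow> 0)"

end

theory Submission
  imports Defs "HOL-Real_Asymp.Real_Asymp"
begin

text \<open>
  The mean square error of the forest at a point splits into variance and squared bias. The forest
  averages over all subsamples, hence it is an average, over permutations of the data, of averages
  over \<open>n div s\<close> disjoint, thus independent, subsamples; this makes the variance of order \<open>s / n\<close>.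
  By honesty, the responses in a leaf may be replaced by the values of the Lipschitz regression
  function, so the bias is at most a multiple of the expected side lengths of the leaf. Only the
  first \<open>K\<close> splits are used to bound these: for \<open>K\<close> fixed and \<open>n\<close> large, all cells involved are boxes
  of non-negligible mass, on which the empirical frequencies are uniformly close to the law of the
  inputs. There a regular split on feature \<open>l\<close> shortens side \<open>l\<close> by a fixed factor, because the density
  is bounded above and below, and such a split happens with probability bounded below. So side \<open>l\<close>
  is at most \<open>\<rho> ^ K\<close> in expectation, with \<open>\<rho> < 1\<close>, and \<open>K\<close> is arbitrary.

  The estimator then differs by a quantity vanishing in mean from the same ratio with the two
  forests replaced by the regression functions, to which the law of large numbers applies.
\<close>

section \<open>Addresses in a tree\<close>

text \<open>The splits may depend on the covariates of the very points that populate the leaves, so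
  the cells are random sets tied to the counted data, and no law of large numbers applies to a
  single one of them. Hence closeness has to hold for all boxes at once; it is obtained from
  finitely many grid boxes by Chebyshev and a union bound. It helps only for cells whose mass
  exceeds the error: regularity leaves a cell at depth \<open>K\<close> at least the fraction
  \<open>\<alpha> ^ K\<close> of the leaf half, and no leaf can occur before depth \<open>K\<close>
  once this fraction amounts to more than \<open>2 * \<kappa> - 1\<close> points. So depth,
  tolerance, grid and sample size are chosen in this order. Honesty and random splitting freeze
  different sources of randomness: honesty acts for a fixed tree randomization, with the data
  integrated out, the random split bound for fixed data, with the randomization integrated out.
  Fubini reconciles them and forces joint measurability of everything built from a tree. As the
  \<sigma>-algebra on trees is generated by \<open>split_at\<close>, cells are described by
  addresses.\<close>

fun reaches :: "tree \<Rightarrow> bool list \<Rightarrow> input \<Rightarrow> bool" where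
  "reaches T [] x = True"
| "reaches Leaf (b # a) x = False"
| "reaches (Split l t L R) (b # a) x = ((x l \<le> t) = b \<and> reaches (if b then L else R) a x)"

definition splits_on :: "nat \<Rightarrow> (nat \<times> real) option \<Rightarrow> bool" where
  "splits_on l v \<longleftrightarrow> (\<exists>t. v = Some (l, t))"

text \<open>The feature is quantified instead of being extracted from the pair: this makes
  \<open>turns v b x\<close> a countable union of the events \<open>splits_on l v\<close>, each
  combined with a comparison of reals, and thus measurable in \<open>v\<close> and \<open>x\<close>
  together.\<close>

definition turns :: "(nat \<times> real) option \<Rightarrow> bool \<Rightarrow> input \<Rightarrow> bool" where
  "turns v b x \<longleftrightarrow> (\<exists>l. splits_on l v \<and> (x l \<le> snd (the v)) = b)"

definition nsplits :: "nat \<Rightarrow> tree \<Rightarrow> bool list \<Rightarrow> nat" where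
  "nsplits l T a = (\<Sum>i<length a. of_bool (splits_on l (split_at T (take i a))))"

lemma turns_simps [simp]: "\<not> turns None b x" "turns (Some (l, t)) b x \<longleftrightarrow> (x l \<le> t) = b"
  by (auto simp: turns_def splits_on_def)

lemma splits_on_simps [simp]: "\<not> splits_on l None" "splits_on l (Some (l', t)) \<longleftrightarrow> l = l'"
  by (auto simp: splits_on_def)

lemma nsplits_Nil [simp]: "nsplits l T [] = 0"
  by (simp add: nsplits_def)

lemma nsplits_Cons [simp]:
  "nsplits l (Split l' t L R) (b # a) = of_bool (l = l') + nsplits l (if b then L else R) a"
  by (simp add: nsplits_def sum.lessThan_Suc_shift del: sum.lessThan_Suc)

lemma nsplits_snoc:
  "nsplits l T (a @ [b]) = nsplits l T a + of_bool (splits_on l (split_at T a))"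
  by (simp add: nsplits_def)

lemma nsplits_le: "nsplits l T a \<le> length a"
proof -
  have "nsplits l T a \<le> (\<Sum>i<length a. 1)"
    unfolding nsplits_def by (intro sum_mono) auto
  then show ?thesis by simp
qed

text \<open>The \<sigma>-algebra \<open>tree_space\<close> sees a tree only through
  \<open>split_at\<close>, so the recursion is traded for finitely many conditions on the splits at
  the proper prefixes of the address.\<close>

lemma reaches_iff: "reaches T a x \<longleftrightarrow> (\<forall>i<length a. turns (split_at T (take i a)) (a ! i) x)"
proof (induction T a x rule: reaches.induct)
  case (2 b a x)
  then show ?case by (auto intro!: exI[of _ 0])
next
  case (3 l t L R b a x)
  have *: "(\<forall>i<Suc (length a). Q i) \<longleftrightarrow> Q 0 \<and> (\<forall>i<length a. Q (Suc i))" for Q :: "nat \<Rightarrow> bool"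
    using less_Suc_eq_0_disj by force
  show ?case using 3 by (simp add: * )
qed simp

lemma reaches_snoc: "reaches T (a @ [b]) x \<longleftrightarrow> reaches T a x \<and> turns (split_at T a) b x"
  unfolding reaches_iff by (auto simp: less_Suc_eq nth_append)

text \<open>A point at a split turns to exactly one side, so following every address that
  \<open>x\<close> reaches already puts \<open>u\<close> into the same leaf; an implication does the
  work of an equivalence. As there are countably many addresses, membership in a leaf becomes
  measurable jointly in the tree and both points.\<close>

lemma leaf_cell_iff: "u \<in> leaf_cell T x \<longleftrightarrow> (\<forall>a. reaches T a x \<longrightarrow> reaches T a u)"
proof (induction T)
  case Leaf
  have "reaches Leaf a x = reaches Leaf a u" for a by (cases a) auto
  then show ?case by simp
next
  case (Split l t L R)
  let ?C = "\<lambda>b. if b then L else R"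
  have all: "(\<forall>a. Q a) \<longleftrightarrow> Q [] \<and> (\<forall>b a. Q (b # a))" for Q :: "bool list \<Rightarrow> bool"
    by (metis list.exhaust)
  have eq: "(\<forall>a. reaches (Split l t L R) a x \<longrightarrow> reaches (Split l t L R) a u) \<longleftrightarrow>
      (\<forall>a. reaches (?C (x l \<le> t)) a x \<longrightarrow> (u l \<le> t) = (x l \<le> t) \<and> reaches (?C (x l \<le> t)) a u)"
    by (subst all) auto
  also have "\<dots> \<longleftrightarrow> (u l \<le> t) = (x l \<le> t) \<and> u \<in> leaf_cell (?C (x l \<le> t)) x"
    using Split reaches.simps(1) by (cases "x l \<le> t") fastforce+
  finally show ?case by auto
qed

lemma leaf_cell_in_nodes: "(A \<inter> leaf_cell T x, Leaf) \<in> nodes A T"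
  by (induction T arbitrary: A) (auto simp: Int_assoc[symmetric])

section \<open>Measurability of the tree output\<close>

text \<open>The generators of \<open>split_space\<close> are images under \<open>Some\<close> only.
  The singleton of \<open>None\<close> is still measurable, as the complement of
  \<open>range Some\<close>, so measurability on pairs is all that has to be checked and the value
  at \<open>None\<close> is arbitrary.\<close>

lemma measurable_from_split_space:
  assumes "f None \<in> space N" "(\<lambda>v. f (Some v)) \<in> measurable (count_space UNIV \<Otimes>\<^sub>M borel) N"
  shows "f \<in> measurable split_space N"
proof (rule measurableI)
  have sp: "space split_space = UNIV" by (simp add: split_space_def)
  show "f x \<in> space N" for x
    using assms(1) measurable_space[OF assms(2)] by (cases x) (auto simp: space_pair_measure)
  fix A assume A: "A \<in> sets N"
  let ?G = "{Some ` A | A. A \<in> sets (count_space UNIV \<Otimes>\<^sub>M (borel :: real measure))}"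
  have sets: "sets split_space = sigma_sets UNIV ?G" by (simp add: split_space_def)
  have "UNIV \<in> sets (count_space (UNIV::nat set) \<Otimes>\<^sub>M (borel :: real measure))"
    by (metis sets.top space_pair_measure space_borel space_count_space UNIV_Times_UNIV)
  then have "Some ` (UNIV :: (nat \<times> real) set) \<in> sigma_sets UNIV ?G"
    by (intro sigma_sets.Basic) auto
  then have "UNIV - Some ` (UNIV :: (nat \<times> real) set) \<in> sigma_sets UNIV ?G"
    by (rule sigma_sets.Compl)
  moreover have "UNIV - range Some = {None :: (nat \<times> real) option}"
    by (auto, metis not_None_eq rangeI)
  ultimately have none: "{None} \<in> sets split_space" by (simp add: sets)
  have "(\<lambda>v. f (Some v)) -` A \<in> sets (count_space UNIV \<Otimes>\<^sub>M borel)"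
    using measurable_sets[OF assms(2) A] by (simp add: space_pair_measure)
  then have some: "Some ` ((\<lambda>v. f (Some v)) -` A) \<in> sets split_space"
    unfolding sets by (intro sigma_sets.Basic) auto
  have "f -` A \<inter> space split_space =
      Some ` ((\<lambda>v. f (Some v)) -` A) \<union> (if f None \<in> A then {None} else {})"
    (is "_ = ?R")
  proof (rule set_eqI)
    show "v \<in> f -` A \<inter> space split_space \<longleftrightarrow> v \<in> ?R" for v
      unfolding sp by (cases v) auto
  qed
  then show "f -` A \<inter> space split_space \<in> sets split_space"
    using none some by (cases "f None \<in> A") (simp_all add: sets.insert_in_sets)
qed

lemma pred_splits_on [measurable]: "Measurable.pred split_space (splits_on l)"
proof (rule measurable_from_split_space)
  have "(\<lambda>v. splits_on l (Some v)) = (\<lambda>v. fst v = l)"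
    by (auto simp: splits_on_def)
  then show "Measurable.pred (count_space UNIV \<Otimes>\<^sub>M borel) (\<lambda>v. splits_on l (Some v))"
    by simp
qed auto

lemma pred_is_None [measurable]: "Measurable.pred split_space (\<lambda>v. v = None)"
  by (rule measurable_from_split_space) auto

lemma measurable_threshold [measurable]: "(\<lambda>v. snd (the v)) \<in> borel_measurable split_space"
  by (rule measurable_from_split_space) auto

text \<open>Covers also a feature outside \<open>F\<close>, on which the elements of the product
  space constantly take the value \<open>undefined\<close>. Hence predicates that range over all
  features, such as \<open>turns\<close>, need no side condition on the tree.\<close>

lemma measurable_input_component:
  assumes "g \<in> measurable N (input_space F)"
  shows "(\<lambda>w. g w l) \<in> borel_measurable N"
proof (cases "l \<in> F")
  case True
  then show ?thesis using assms by measurable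
next
  case False
  then have "g w l = undefined" if "w \<in> space N" for w
    using measurable_space[OF assms that] by (auto simp: space_PiM PiE_def extensional_def)
  then show ?thesis by (subst measurable_cong[of N _ "\<lambda>_. undefined"]) auto
qed

lemma pred_turns [measurable (raw)]:
  assumes "f \<in> measurable N split_space" "g \<in> measurable N (input_space F)"
  shows "Measurable.pred N (\<lambda>w. turns (f w) b (g w))"
proof -
  have [measurable]: "(\<lambda>w. g w l) \<in> borel_measurable N" for l
    by (rule measurable_input_component[OF assms(2)])
  show ?thesis using assms(1) unfolding turns_def by measurable
qed

lemma space_tree_space [simp]: "space tree_space = UNIV"
  by (simp add: tree_space_def)

lemma space_split_space [simp]: "space split_space = UNIV"
  by (simp add: split_space_def)

lemma measurable_split_at [measurable (raw)]:
  assumes "f \<in> measurable N tree_space"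
  shows "(\<lambda>w. split_at (f w) a) \<in> measurable N split_space"
proof -
  have "split_at \<in> measurable tree_space (PiM UNIV (\<lambda>_. split_space))"
    unfolding tree_space_def by (intro measurable_vimage_algebra1) (auto simp: space_PiM)
  then have "(\<lambda>T. split_at T a) \<in> measurable tree_space split_space"
    by (rule measurable_compose[OF _ measurable_component_singleton]) simp
  then show ?thesis by (rule measurable_compose[OF assms])
qed

lemma pred_reaches [measurable (raw)]:
  assumes [measurable]: "f \<in> measurable N tree_space" "g \<in> measurable N (input_space F)"
  shows "Measurable.pred N (\<lambda>w. reaches (f w) a (g w))"
  unfolding reaches_iff by measurable

lemma pred_leaf_cell [measurable (raw)]:
  assumes [measurable]: "f \<in> measurable N tree_space" "g \<in> measurable N (input_space F)"
    "h \<in> measurable N (input_space F)"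
  shows "Measurable.pred N (\<lambda>w. h w \<in> leaf_cell (f w) (g w))"
  unfolding leaf_cell_iff by measurable

lemma pred_nsplits_eq [measurable (raw)]:
  assumes [measurable]: "f \<in> measurable N tree_space"
  shows "Measurable.pred N (\<lambda>w. nsplits l (f w) a = m)"
proof -
  have "(\<lambda>w. \<Sum>i<length a. of_bool (splits_on l (split_at (f w) (take i a))) :: real) \<in> borel_measurable N"
    by measurable
  then have "Measurable.pred N (\<lambda>w. (\<Sum>i<length a. of_bool (splits_on l (split_at (f w) (take i a)))) = real m)"
    by measurable
  also have "(\<lambda>w. (\<Sum>i<length a. of_bool (splits_on l (split_at (f w) (take i a)))) = real m) =
      (\<lambda>w. nsplits l (f w) a = m)"
    unfolding nsplits_def of_nat_eq_iff[where 'a = real, symmetric] of_nat_sum by simp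
  finally show ?thesis .
qed

lemma measurable_grow [measurable (raw)]:
  assumes "well_formed_procedure F s P" "f \<in> measurable N (rand P)" "g \<in> measurable N (sample_space F s)"
  shows "(\<lambda>w. grow P (f w) (g w)) \<in> measurable N tree_space"
proof -
  have "(\<lambda>(e, z). grow P e z) \<in> measurable (rand P \<Otimes>\<^sub>M sample_space F s) tree_space"
    using assms(1) by (simp add: well_formed_procedure_def)
  from measurable_compose[OF measurable_Pair[OF assms(2,3)] this] show ?thesis by simp
qed

lemma pred_split_half [measurable (raw)]:
  assumes "well_formed_procedure F s P" "f \<in> measurable N (rand P)"
  shows "Measurable.pred N (\<lambda>w. m \<in> split_half P (f w))"
proof -
  have "split_half P \<in> measurable (rand P) (count_space UNIV)"
    using assms(1) unfolding well_formed_procedure_def by blast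
  then have 1: "(\<lambda>w. split_half P (f w)) \<in> measurable N (count_space UNIV)"
    using measurable_compose[OF assms(2)] by blast
  have "(\<lambda>S. m \<in> S) \<in> measurable (count_space UNIV) (count_space UNIV)"
    by (rule measurable_count_space)
  from measurable_compose[OF 1 this] show ?thesis .
qed

lemma measurable_sample:
  assumes "g \<in> measurable N (sample_space F s)" "m < s"
  shows "(\<lambda>w. g w m) \<in> measurable N (input_space F \<Otimes>\<^sub>M borel)"
proof -
  have "(\<lambda>z. z m) \<in> measurable (PiM {..<s} (\<lambda>_. input_space F \<Otimes>\<^sub>M borel)) (input_space F \<Otimes>\<^sub>M borel)"
    using assms(2) by (intro measurable_component_singleton) auto
  from measurable_compose[OF assms(1)[unfolded sample_space_def] this] show ?thesis .
qed

text \<open>The weights involve the responses only through the tree, which is the form on which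
  honesty can act. On a cell without leaf points the division by zero makes all of them 0; so they
  sum to 1 or to 0, and a leaf average never exceeds the bound on what is averaged.\<close>

definition leaf_weight ::
  "('e, 'h) tree_procedure \<Rightarrow> nat \<Rightarrow> input \<Rightarrow> 'e \<Rightarrow> 'h sample \<Rightarrow> nat \<Rightarrow> real" where
  "leaf_weight P s x e z m =
     of_bool (m \<in> leaf_half P s e \<and> fst (z m) \<in> leaf_cell (grow P e z) x)
       / real (cell_count P s e z (leaf_cell (grow P e z) x))"

lemma tree_output_eq: "tree_output P s x e z = (\<Sum>m<s. leaf_weight P s x e z m *\<^sub>R snd (z m))"
  unfolding tree_output_def Let_def leaf_weight_def
  by (rule sum.mono_neutral_cong_left) (auto simp: leaf_half_def indicator_def)

lemma finite_leaf_half [simp]: "finite (leaf_half P s e)"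
  by (simp add: leaf_half_def)

lemma sum_leaf_weight_aux:
  "(\<Sum>m<s. leaf_weight P s x e z m) =
     (let c = real (cell_count P s e z (leaf_cell (grow P e z) x)) in c / c)"
proof -
  let ?A = "leaf_cell (grow P e z) x"
  have "(\<Sum>m<s. of_bool (m \<in> leaf_half P s e \<and> fst (z m) \<in> ?A)) = real (cell_count P s e z ?A)"
    by (subst sum.mono_neutral_cong_right[where S = "{m \<in> leaf_half P s e. fst (z m) \<in> ?A}" and h = "\<lambda>_. 1"])
      (auto simp: cell_count_def leaf_half_def)
  then show ?thesis
    unfolding leaf_weight_def by (simp add: sum_divide_distrib[symmetric] Let_def)
qed

lemma leaf_weight_nonneg [simp]: "0 \<le> leaf_weight P s x e z m"
  by (simp add: leaf_weight_def)

lemma sum_leaf_weight_le: "(\<Sum>m<s. leaf_weight P s x e z m) \<le> 1"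
  by (simp add: sum_leaf_weight_aux Let_def)

lemma norm_leaf_average_le:
  fixes v :: "nat \<Rightarrow> 'v::real_normed_vector"
  assumes "\<And>i. i < s \<Longrightarrow> norm (v i) \<le> b" "0 \<le> b"
  shows "norm (\<Sum>i<s. leaf_weight P s x e z i *\<^sub>R v i) \<le> b"
proof -
  have "norm (\<Sum>i<s. leaf_weight P s x e z i *\<^sub>R v i) \<le> (\<Sum>i<s. leaf_weight P s x e z i * b)"
    using assms by (intro sum_norm_le) (auto intro!: mult_left_mono)
  also have "\<dots> = (\<Sum>i<s. leaf_weight P s x e z i) * b" by (simp add: sum_distrib_right)
  also have "\<dots> \<le> 1 * b" using sum_leaf_weight_le assms(2) by (intro mult_right_mono) auto
  finally show ?thesis by simp
qed

lemma leaf_weight_le: "leaf_weight P s x e z m \<le> 1"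
proof (cases "m < s")
  case True
  then show ?thesis
    using sum_leaf_weight_le[of P s x e z] member_le_sum[of m "{..<s}" "leaf_weight P s x e z"] by simp
qed (simp add: leaf_weight_def leaf_half_def)

lemma sum_leaf_weight_eq_1:
  "cell_count P s e z (leaf_cell (grow P e z) x) > 0 \<Longrightarrow> (\<Sum>m<s. leaf_weight P s x e z m) = 1"
  by (simp add: sum_leaf_weight_aux Let_def)

lemma cell_count_eq_sum:
  "cell_count P s e z A = (\<Sum>m<s. of_bool (m \<notin> split_half P e \<and> fst (z m) \<in> A))"
  unfolding cell_count_def
  by (subst sum.mono_neutral_cong_right[where S = "{m \<in> leaf_half P s e. fst (z m) \<in> A}" and h = "\<lambda>_. 1"])
      (auto simp: leaf_half_def)

lemma measurable_leaf_weight: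
  assumes wf: "well_formed_procedure F s P"
    and x: "x \<in> measurable N (input_space F)" and f: "f \<in> measurable N (rand P)"
    and g: "g \<in> measurable N (sample_space F s)"
  shows "(\<lambda>w. leaf_weight P s (x w) (f w) (g w) m) \<in> borel_measurable N"
proof -
  have [measurable]: "Measurable.pred N (\<lambda>w. m \<in> split_half P (f w))" for m
    by (rule pred_split_half[OF wf f])
  have [measurable]: "Measurable.pred N (\<lambda>w. fst (g w m) \<in> leaf_cell (grow P (f w) (g w)) (x w))"
    if "m < s" for m
    by (rule pred_leaf_cell[OF measurable_grow[OF wf f g] x])
      (rule measurable_compose[OF measurable_sample[OF g that] measurable_fst])
  have 1 [measurable]: "(\<lambda>w. of_bool (m \<in> leaf_half P s (f w) \<and>
      fst (g w m) \<in> leaf_cell (grow P (f w) (g w)) (x w)) :: real) \<in> borel_measurable N" for m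
  proof (cases "m < s")
    case [measurable]: True
    show ?thesis unfolding leaf_half_def by measurable
  qed (simp add: leaf_half_def)
  have 2: "real (cell_count P s e z A) =
    (\<Sum>m<s. of_bool (m \<in> leaf_half P s e \<and> fst (z m) \<in> A))" for e z A
    unfolding cell_count_eq_sum of_nat_sum by (intro sum.cong) (auto simp: leaf_half_def)
  show ?thesis
    unfolding leaf_weight_def 2 by (intro borel_measurable_divide borel_measurable_sum 1)
qed

lemma measurable_tree_output:
  fixes P :: "('e, 'h::{banach, second_countable_topology}) tree_procedure"
  assumes "well_formed_procedure F s P"
    and "x \<in> measurable N (input_space F)" "f \<in> measurable N (rand P)" 
    "g \<in> measurable N (sample_space F s)"
  shows "(\<lambda>w. tree_output P s (x w) (f w) (g w)) \<in> borel_measurable N"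
proof -
  have "(\<lambda>w. leaf_weight P s (x w) (f w) (g w) m *\<^sub>R snd (g w m)) \<in> borel_measurable N" if "m < s" for m
    using that measurable_leaf_weight[OF assms, of m] measurable_sample[OF assms(4) that] by measurable
  then show ?thesis
    unfolding tree_output_eq by (intro borel_measurable_sum) auto
qed

section \<open>Random splits\<close>

text \<open>
  At most one address of length \<open>K\<close> is reached by \<open>x\<close>; there is none if \<open>x\<close> lies in a shallower leaf,
  and then the value is \<open>0\<close>.
\<close>

definition path_shrinkage :: "real \<Rightarrow> nat \<Rightarrow> nat \<Rightarrow> tree \<Rightarrow> input \<Rightarrow> real" where
  "path_shrinkage r K l T x = (\<Sum>a | length a = K. of_bool (reaches T a x) * r ^ nsplits l T a)"

lemma well_formed_prob_space: "well_formed_procedure F s P \<Longrightarrow> prob_space (rand P)"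
  unfolding well_formed_procedure_def by blast

lemma finite_addresses [simp]: "finite {a :: bool list. length a = K}"
  using finite_lists_length_eq[of "UNIV :: bool set" K] by simp

text \<open>Sorts a random power by the value of its exponent: with \<open>n\<close> the number of
  earlier splits on a feature, the expectation of \<open>r ^ n\<close> becomes a finite sum of
  probabilities of events to which the bound on random splits applies.\<close>

lemma sum_atMost_select:
  fixes g :: "nat \<Rightarrow> real"
  assumes "n \<le> K"
  shows "(\<Sum>m\<le>K. of_bool (n = m) * g m) = g n"
proof -
  have "(\<Sum>m\<le>K. of_bool (n = m) * g m) = (\<Sum>m\<le>K. if n = m then g m else 0)"
    by (intro sum.cong) auto
  then show ?thesis using assms by simp
qed

lemma path_shrinkage_ge:
  assumes "0 \<le> r" "reaches T a x"
  shows "r ^ nsplits l T a \<le> path_shrinkage r (length a) l T x"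
proof -
  have "of_bool (reaches T a x) * r ^ nsplits l T a \<le> path_shrinkage r (length a) l T x"
    unfolding path_shrinkage_def using assms(1)
    by (intro member_le_sum[where f = "\<lambda>a. of_bool (reaches T a x) * r ^ nsplits l T a"]) auto
  then show ?thesis using assms(2) by simp
qed

lemma path_shrinkage_0 [simp]: "path_shrinkage r 0 l T x = 1"
proof -
  have "{a :: bool list. length a = 0} = {[]}" by auto
  then show ?thesis by (simp add: path_shrinkage_def)
qed

text \<open>A node with a split passes \<open>x\<close> on to exactly one child, multiplying the
  factor by \<open>1 - \<gamma>\<close> if the split is on \<open>l\<close>; a leaf has no child and
  drops out. Written as a difference, the last factor is linear in two indicators, so that
  expectations can be taken term by term.\<close>

lemma path_shrinkage_Suc:
  "path_shrinkage (1 - \<gamma>) (Suc K) l T x =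
     (\<Sum>a | length a = K. of_bool (reaches T a x) * (1 - \<gamma>) ^ nsplits l T a *
        (of_bool (split_at T a \<noteq> None) - \<gamma> * of_bool (splits_on l (split_at T a))))"
proof -
  have set: "{a :: bool list. length a = Suc K} = (\<lambda>(a, b). a @ [b]) ` ({a. length a = K} \<times> UNIV)"
    by (auto simp: image_iff length_Suc_conv_rev)
  have turn: "(\<Sum>b\<in>UNIV. of_bool (turns v b x)) = (of_bool (v \<noteq> None) :: real)" for v
    by (cases v) (auto simp: UNIV_bool)
  have "path_shrinkage (1 - \<gamma>) (Suc K) l T x =
      (\<Sum>a | length a = K. \<Sum>b\<in>UNIV. of_bool (reaches T (a @ [b]) x) * (1 - \<gamma>) ^ nsplits l T (a @ [b]))"
    unfolding path_shrinkage_def set sum.cartesian_product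
    by (subst sum.reindex) (auto simp only: inj_on_def case_prod_unfold o_def append1_eq_conv prod_eq_iff)
  also have "\<dots> = (\<Sum>a | length a = K. of_bool (reaches T a x) * (1 - \<gamma>) ^ nsplits l T a *
      (1 - \<gamma>) ^ of_bool (splits_on l (split_at T a)) * (\<Sum>b\<in>UNIV. of_bool (turns (split_at T a) b x)))"
    by (intro sum.cong refl) (auto simp: reaches_snoc nsplits_snoc power_add sum_distrib_left of_bool_conj intro!: sum.cong)
  also have "\<dots> = (\<Sum>a | length a = K. of_bool (reaches T a x) * (1 - \<gamma>) ^ nsplits l T a *
        (of_bool (split_at T a \<noteq> None) - \<gamma> * of_bool (splits_on l (split_at T a))))"
    unfolding turn
    by (intro sum.cong refl) (auto simp: algebra_simps splits_on_def)
  finally show ?thesis .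
qed

lemma measurable_path_shrinkage:
  assumes [measurable]: "f \<in> measurable N tree_space" "g \<in> measurable N (input_space F)"
  shows "(\<lambda>w. path_shrinkage r K l (f w) (g w)) \<in> borel_measurable N"
proof -
  have *: "path_shrinkage r K l T x =
    (\<Sum>a | length a = K. \<Sum>m\<le>K. of_bool (reaches T a x) * of_bool (nsplits l T a = m) * r ^ m)" for T x
    unfolding path_shrinkage_def
  proof (intro sum.cong refl)
    fix a :: "bool list" assume "a \<in> {a. length a = K}"
    then have "nsplits l T a \<le> K" using nsplits_le[of l T a] by simp
    from sum_atMost_select[OF this, of "\<lambda>m. of_bool (reaches T a x) * r ^ m"]
    show "of_bool (reaches T a x) * r ^ nsplits l T a =
        (\<Sum>m\<le>K. of_bool (reaches T a x) * of_bool (nsplits l T a = m) * r ^ m)"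
      by (simp only: mult_ac)
  qed
  show ?thesis unfolding * by measurable
qed

text \<open>\<open>random_split\<close> conditions on events expressed by the splits at the
  ancestors. That these lead \<open>x\<close> to the node and that \<open>m\<close> of them are on
  \<open>l\<close> is such an event; this is the set of sequences of splits describing it.\<close>

definition histories :: "nat \<Rightarrow> input \<Rightarrow> bool list \<Rightarrow> nat \<Rightarrow> (nat \<Rightarrow> (nat \<times> real) option) set" where
  "histories l x a m =
     {h \<in> space (PiM {..<length a} (\<lambda>_. split_space)).
        (\<forall>i<length a. turns (h i) (a ! i) x) \<and> (\<Sum>i<length a. of_bool (splits_on l (h i))) = real m}"

lemma histories_sets: 
  assumes "x \<in> space (input_space F)"
  shows "histories l x a m \<in> sets (PiM {..<length a} (\<lambda>_. split_space))"
proof -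
  let ?M = "PiM {..<length a} (\<lambda>_. split_space)"
  have [measurable]: "(\<lambda>h. h i) \<in> measurable ?M split_space" if "i < length a" for i
    using that by (intro measurable_component_singleton) auto
  have [measurable]: "(\<lambda>_. x) \<in> measurable ?M (input_space F)"
    using assms by simp
  have "Measurable.pred ?M (\<lambda>h. \<forall>i\<in>{..<length a}. turns (h i) (a ! i) x)"
    by (intro pred_intros_finite(3) pred_turns[where F = F]) auto
  moreover have "Measurable.pred ?M (\<lambda>h. (\<Sum>i<length a. of_bool (splits_on l (h i))) = real m)"
    by measurable
  ultimately show ?thesis
    unfolding histories_def by (auto simp: Ball_def intro!: pred_intros_logic)
qed

lemma split_history_in_histories:
  "split_history T a \<in> histories l x a m \<longleftrightarrow> reaches T a x \<and> nsplits l T a = m"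
proof -
  have "(\<Sum>i<length a. of_bool (splits_on l (split_history T a i))) = real (nsplits l T a)"
    unfolding nsplits_def of_nat_sum by (intro sum.cong) (auto simp: split_history_def)
  moreover have "split_history T a \<in> space (PiM {..<length a} (\<lambda>_. split_space))"
    by (auto simp: split_history_def space_PiM)
  moreover have "(\<forall>i<length a. turns (split_history T a i) (a ! i) x) \<longleftrightarrow> reaches T a x"
    by (simp add: reaches_iff split_history_def)
  ultimately show ?thesis
    unfolding histories_def by (simp only: mem_Collect_eq of_nat_eq_iff simp_thms)
qed

text \<open>The conditional bound multiplied out. A conditioning event of probability zero, about
  which \<open>random_split\<close> says nothing, then needs no exclusion, since the left side
  vanishes.\<close>

lemma random_split_prob:
  assumes wf: "well_formed_procedure F s P" and rs: "random_split \<pi> F s P"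
    and z: "z \<in> tie_free_samples F s" and l: "l \<in> F" and x: "x \<in> space (input_space F)"
  defines "T \<equiv> \<lambda>e. grow P e z"
  shows "\<pi> / real (card F) * \<P>(e in rand P. split_at (T e) a \<noteq> None \<and> reaches (T e) a x \<and> nsplits l (T e) a = m)
    \<le> \<P>(e in rand P. splits_on l (split_at (T e) a) \<and> reaches (T e) a x \<and> nsplits l (T e) a = m)"
proof -
  interpret R: prob_space "rand P" by (rule well_formed_prob_space[OF wf])
  let ?A = "\<lambda>e. split_at (T e) a \<noteq> None \<and> reaches (T e) a x \<and> nsplits l (T e) a = m"
  show ?thesis
  proof (cases "\<P>(e in rand P. ?A e) > 0")
    case True
    have "\<P>(e in rand P. (\<exists>t. split_at (T e) a = Some (l, t)) \<bar> ?A e) \<ge> \<pi> / real (card F)"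
      using rs[unfolded random_split_def, rule_format, OF z l histories_sets[OF x, of l a m]] True
      by (simp only: split_history_in_histories T_def)
    then have "\<pi> / real (card F) * \<P>(e in rand P. ?A e) \<le> \<P>(e in rand P. (\<exists>t. split_at (T e) a = Some (l, t)) \<and> ?A e)"
      using True by (simp add: cond_prob_def pos_le_divide_eq)
    also have "\<dots> = \<P>(e in rand P. splits_on l (split_at (T e) a) \<and> reaches (T e) a x \<and> nsplits l (T e) a = m)"
      by (intro arg_cong[where f = "measure _"]) (auto simp: splits_on_def)
    finally show ?thesis .
  next
    case False
    then have "\<P>(e in rand P. ?A e) = 0"
      using measure_nonneg[of "rand P" "{e \<in> space (rand P). ?A e}"] by linarith
    then show ?thesis by (simp only: mult_zero_right measure_nonneg)
  qed
qed

text \<open>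
  Given the splits at the ancestors, the next split on the path of \<open>x\<close> uses feature \<open>l\<close> with
  probability at least \<open>q\<close>; it then multiplies the shrinkage by \<open>1 - \<gamma>\<close>.
\<close>

lemma path_shrinkage_decay:
  assumes wf: "well_formed_procedure F s P" and rs: "random_split \<pi> F s P"
    and z: "z \<in> tie_free_samples F s" and l: "l \<in> F" and x: "x \<in> space (input_space F)"
    and \<gamma>: "0 \<le> \<gamma>" "\<gamma> \<le> 1" and q: "q \<le> \<pi> / real (card F)" "0 \<le> q" "q \<le> 1"
  shows "(\<integral>e. path_shrinkage (1 - \<gamma>) K l (grow P e z) x \<partial>rand P) \<le> (1 - \<gamma> * q) ^ K"
proof (induction K)
  interpret R: prob_space "rand P" by (rule well_formed_prob_space[OF wf])
  case 0
  then show ?case by (simp add: R.prob_space)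
next
  interpret R: prob_space "rand P" by (rule well_formed_prob_space[OF wf])
  case (Suc K)
  define T where "T = (\<lambda>e. grow P e z)"
  have T [measurable]: "T \<in> measurable (rand P) tree_space"
    unfolding T_def using z measurable_grow[OF wf, of "\<lambda>e. e" "rand P" "\<lambda>_. z"]
    by (auto simp: tie_free_samples_def)
  have [measurable]: "(\<lambda>_. x) \<in> measurable (rand P) (input_space F)" using x by simp
  let ?p = "\<lambda>Q. \<P>(e in rand P. Q e)"
  let ?E = "\<lambda>a m e. reaches (T e) a x \<and> nsplits l (T e) a = m"
  have meas [measurable]: "Measurable.pred (rand P) (?E a m)" for a m
    by (intro pred_intros_logic pred_reaches[where F = F] pred_nsplits_eq) measurable
  have dec: "of_bool (reaches (T e) a x) * r ^ nsplits l (T e) a * c =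
      (\<Sum>m\<le>K. r ^ m * (of_bool (?E a m e) * c))" if "length a = K" for a e and r c :: real
    using sum_atMost_select[of "nsplits l (T e) a" K "\<lambda>m. r ^ m * (of_bool (reaches (T e) a x) * c)"]
      nsplits_le[of l "T e" a] that
    by (simp only: of_bool_conj mult_ac)
  have dec1: "of_bool (reaches (T e) a x) * r ^ nsplits l (T e) a =
      (\<Sum>m\<le>K. r ^ m * of_bool (?E a m e))" if "length a = K" for a e and r :: real
    using dec[OF that, of e r 1] by (simp only: mult_1_right)
  have hb: "has_bochner_integral (rand P) (\<lambda>e. of_bool (Q e)) (?p Q)"
    if Q: "Measurable.pred (rand P) Q" for Q
  proof -
    have "has_bochner_integral (rand P) (indicator {e\<in>space (rand P). Q e}) (?p Q)"
      using Q R.emeasure_finite by (intro has_bochner_integral_real_indicator) (auto simp: less_top[symmetric])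
    then show ?thesis
      by (rule has_bochner_integral_cong[THEN iffD1, rotated 3]) (auto simp: indicator_def)
  qed
  have meas': "Measurable.pred (rand P) (\<lambda>e. split_at (T e) a \<noteq> None \<and> ?E a m e)"
    "Measurable.pred (rand P) (\<lambda>e. splits_on l (split_at (T e) a) \<and> ?E a m e)" for a m
    by (intro pred_intros_logic(3)[OF _ meas], measurable)+
  \<comment> \<open>Grouped by the number \<open>m\<close> of earlier splits on \<open>l\<close>,
    the integrand is a linear combination of indicators with deterministic coefficients.\<close>
  have "(\<integral>e. path_shrinkage (1 - \<gamma>) (Suc K) l (T e) x \<partial>rand P) =
    (\<integral>e. (\<Sum>a | length a = K. \<Sum>m\<le>K. (1 - \<gamma>) ^ m * (of_bool (split_at (T e) a \<noteq> None \<and> ?E a m e)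
         - \<gamma> * of_bool (splits_on l (split_at (T e) a) \<and> ?E a m e))) \<partial>rand P)"
    unfolding path_shrinkage_Suc
    by (intro Bochner_Integration.integral_cong sum.cong refl)
      (subst dec, simp, simp only: of_bool_conj algebra_simps)
  also have "\<dots> = (\<Sum>a | length a = K. \<Sum>m\<le>K. (1 - \<gamma>) ^ m * (?p (\<lambda>e. split_at (T e) a \<noteq> None \<and> ?E a m e)
         - \<gamma> * ?p (\<lambda>e. splits_on l (split_at (T e) a) \<and> ?E a m e)))"
    by (intro has_bochner_integral_integral_eq has_bochner_integral_sum has_bochner_integral_mult_right
        has_bochner_integral_diff hb meas')
  also have "\<dots> \<le> (\<Sum>a | length a = K. \<Sum>m\<le>K. (1 - \<gamma>) ^ m * ((1 - \<gamma> * q) * ?p (?E a m)))"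
  proof (intro sum_mono mult_left_mono)
    fix a m
    let ?N = "?p (\<lambda>e. split_at (T e) a \<noteq> None \<and> ?E a m e)"
    let ?S = "?p (\<lambda>e. splits_on l (split_at (T e) a) \<and> ?E a m e)"
    have "q * ?N \<le> \<pi> / real (card F) * ?N"
      using q(1) by (intro mult_right_mono) auto
    also have "\<dots> \<le> ?S"
      using random_split_prob[OF wf rs z l x] by (simp add: T_def conj_ac)
    finally have "?N - \<gamma> * ?S \<le> ?N - \<gamma> * (q * ?N)"
      using \<gamma> by (intro diff_left_mono mult_left_mono) auto
    also have "\<dots> = (1 - \<gamma> * q) * ?N" by (simp add: algebra_simps)
    \<comment> \<open>Paths that have already ended in a leaf are added back; this only increases
      the bound because the factor is nonnegative.\<close>
    also have "\<dots> \<le> (1 - \<gamma> * q) * ?p (?E a m)"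
      using \<gamma> q mult_le_one[of \<gamma> q] by (intro mult_left_mono R.finite_measure_mono) auto
    finally show "?N - \<gamma> * ?S \<le> (1 - \<gamma> * q) * ?p (?E a m)" .
  qed (use \<gamma> in auto)
  also have "\<dots> = (1 - \<gamma> * q) * (\<integral>e. path_shrinkage (1 - \<gamma>) K l (T e) x \<partial>rand P)"
  proof -
    have "(\<integral>e. path_shrinkage (1 - \<gamma>) K l (T e) x \<partial>rand P) =
       (\<integral>e. (\<Sum>a | length a = K. \<Sum>m\<le>K. (1 - \<gamma>) ^ m * of_bool (?E a m e)) \<partial>rand P)"
      unfolding path_shrinkage_def
      by (intro Bochner_Integration.integral_cong sum.cong refl)
        (simp only: dec1 mem_Collect_eq)
    also have "\<dots> = (\<Sum>a | length a = K. \<Sum>m\<le>K. (1 - \<gamma>) ^ m * ?p (?E a m))"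
      by (intro has_bochner_integral_integral_eq has_bochner_integral_sum has_bochner_integral_mult_right
        hb meas)
    finally show ?thesis by (simp add: sum_distrib_left algebra_simps)
  qed
  also have "\<dots> \<le> (1 - \<gamma> * q) * (1 - \<gamma> * q) ^ K"
    using Suc \<gamma> q mult_le_one[of \<gamma> q] unfolding T_def by (intro mult_left_mono) auto
  finally show ?case by (simp add: T_def)
qed

section \<open>Boxes\<close>

text \<open>
  Half-open, to match the cuts \<open>u l \<le> t\<close> and \<open>u l > t\<close>. The cube used below therefore misses the points
  with a coordinate \<open>0\<close>, which have probability zero.
\<close>

definition hbox :: "nat set \<Rightarrow> (nat \<Rightarrow> real) \<Rightarrow> (nat \<Rightarrow> real) \<Rightarrow> input set" where
  "hbox F lo hi = PiE F (\<lambda>l. {lo l<..hi l})"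

definition valid_box :: "nat set \<Rightarrow> (nat \<Rightarrow> real) \<Rightarrow> (nat \<Rightarrow> real) \<Rightarrow> bool" where
  "valid_box F lo hi \<longleftrightarrow> (\<forall>l\<in>F. 0 \<le> lo l \<and> lo l \<le> hi l \<and> hi l \<le> 1)"

definition box_vol :: "nat set \<Rightarrow> (nat \<Rightarrow> real) \<Rightarrow> (nat \<Rightarrow> real) \<Rightarrow> real" where
  "box_vol F lo hi = (\<Prod>l\<in>F. hi l - lo l)"

abbreviation cube :: "nat set \<Rightarrow> input set" where
  "cube F \<equiv> hbox F (\<lambda>_. 0) (\<lambda>_. 1)"

lemma valid_cube [simp]: "valid_box F (\<lambda>_. 0) (\<lambda>_. 1)"
  by (simp add: valid_box_def)

lemma hbox_iff: "u \<in> hbox F lo hi \<longleftrightarrow> u \<in> extensional F \<and> (\<forall>l\<in>F. lo l < u l \<and> u l \<le> hi l)"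
  by (auto simp: hbox_def PiE_iff)

lemma hbox_sets [measurable]: "finite F \<Longrightarrow> hbox F lo hi \<in> sets (input_space F)"
  unfolding hbox_def by (intro sets_PiM_I_finite) auto

lemma cube_subset_unit_cube: "cube F \<subseteq> unit_cube F"
  unfolding hbox_def unit_cube_def by (intro PiE_mono) auto

lemma ball_remove: "l \<in> F \<Longrightarrow> (\<forall>i\<in>F. P i) \<longleftrightarrow> P l \<and> (\<forall>i\<in>F - {l}. P i)"
  by blast

lemma hbox_le_cut: "l \<in> F \<Longrightarrow> t \<le> hi l \<Longrightarrow> hbox F lo hi \<inter> {u. u l \<le> t} = hbox F lo (hi(l := t))"
  by (rule set_eqI) (auto simp: hbox_iff ball_remove[of l F])

lemma hbox_gt_cut: "l \<in> F \<Longrightarrow> lo l \<le> t \<Longrightarrow> hbox F lo hi \<inter> {u. u l > t} = hbox F (lo(l := t)) hi"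
  by (rule set_eqI) (auto simp: hbox_iff ball_remove[of l F])

text \<open>Applied to boxes that differ in side \<open>l\<close> only: the common factor is the
  volume of the remaining sides, which cancels when a cell is compared with its parent.\<close>

lemma box_vol_remove:
  assumes "finite F" "l \<in> F" "\<And>i. i \<in> F \<Longrightarrow> i \<noteq> l \<Longrightarrow> lo' i = lo i \<and> hi' i = hi i"
  shows "box_vol F lo' hi' = (hi' l - lo' l) * box_vol (F - {l}) lo hi"
proof -
  have "box_vol F lo' hi' = (hi' l - lo' l) * box_vol (F - {l}) lo' hi'"
    unfolding box_vol_def by (rule prod.remove[OF assms(1,2)])
  also have "box_vol (F - {l}) lo' hi' = box_vol (F - {l}) lo hi"
    unfolding box_vol_def using assms(3) by (intro prod.cong) auto
  finally show ?thesis .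
qed

text \<open>Here \<open>\<nu>\<close> is the frequency of the parent cell, \<open>w\<close> and
  \<open>w2\<close> are the lengths of the cut side before and after, and \<open>V\<close> is the
  volume of the other sides. The child has mass at least \<open>a * \<nu> - \<delta>\<close> and at
  most \<open>C\<close> times its volume, the parent at least \<open>c\<close> times its volume. The
  assumption on \<open>\<delta>\<close> lets the two empirical errors together cost a factor 2; this
  is the origin of the constant \<open>\<gamma>\<close> used below.\<close>

lemma ratio_bound:
  fixes a c C w w2 V \<nu> \<delta> :: real
  assumes "0 < a" "a \<le> 1" "0 < c" "0 < C" "0 < V"
    "a * \<nu> - \<delta> \<le> C * (w2 * V)" "c * (w * V) \<le> \<nu> + \<delta>" "4 * \<delta> \<le> a * \<nu>" "0 \<le> \<delta>"
  shows "a * c / (2 * C) * w \<le> w2"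
proof -
  have "a / 2 * (c * (w * V)) \<le> a / 2 * (\<nu> + \<delta>)"
    using assms by (intro mult_left_mono) auto
  also have "\<dots> = a * \<nu> / 2 + a * \<delta> / 2" by (simp add: field_simps)
  also have "a * \<delta> \<le> 1 * \<delta>" using assms by (intro mult_right_mono) auto
  finally have "a / 2 * (c * (w * V)) \<le> a * \<nu> - \<delta>" using assms by linarith
  also have "\<dots> \<le> C * (w2 * V)" by fact
  finally have "(a / 2 * c * w) * V \<le> (C * w2) * V" by (simp add: mult_ac)
  then have "a / 2 * c * w \<le> C * w2" using assms by simp
  then show ?thesis using assms by (simp add: field_simps)
qed

section \<open>Empirical frequencies and the contraction of cells along a path\<close>

definition freq :: "nat set \<Rightarrow> (nat \<Rightarrow> input) \<Rightarrow> input set \<Rightarrow> real" where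
  "freq J \<xi> A = real (card {m \<in> J. \<xi> m \<in> A}) / real (card J)"

lemma freq_mono: "finite J \<Longrightarrow> A \<subseteq> B \<Longrightarrow> freq J \<xi> A \<le> freq J \<xi> B"
  unfolding freq_def by (intro divide_right_mono of_nat_mono card_mono) auto

lemma freq_pos_obtain:
  assumes "0 < freq J \<xi> A" obtains u where "u \<in> A"
proof -
  have "{m \<in> J. \<xi> m \<in> A} \<noteq> {}"
  proof
    assume "{m \<in> J. \<xi> m \<in> A} = {}"
    then show False using assms by (simp only: freq_def card.empty)
  qed
  then show ?thesis using that by auto
qed

text \<open>
  If the empirical measure of the points populating the leaves is uniformly close to their law, a
  regular split cuts a fixed fraction off the side of a box that still has a large frequency.
\<close>

lemma regular_split_path:
  fixes pr :: "input set \<Rightarrow> real"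
  assumes F: "finite F" and J: "finite J" and data: "\<And>m. m \<in> J \<Longrightarrow> \<xi> m \<in> cube F"
    and const: "0 < \<alpha>" "\<alpha> \<le> 1" "0 < c" "0 < C"
    and vol: "\<And>lo hi. valid_box F lo hi \<Longrightarrow>
        c * box_vol F lo hi \<le> pr (hbox F lo hi) \<and> pr (hbox F lo hi) \<le> C * box_vol F lo hi"
    and close: "\<And>lo hi. valid_box F lo hi \<Longrightarrow> \<bar>freq J \<xi> (hbox F lo hi) - pr (hbox F lo hi)\<bar> \<le> \<delta>"
    and \<delta>: "4 * \<delta> \<le> \<alpha> * \<alpha> ^ K" and B: "B < \<alpha> ^ K"
    and \<gamma>: "\<gamma> = \<alpha> * c / (2 * C)"
  shows "\<lbrakk>k \<le> K; tree_features T \<subseteq> F;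
     \<And>A' l t L R. (A', Split l t L R) \<in> nodes A T \<Longrightarrow>
        \<alpha> * freq J \<xi> A' \<le> freq J \<xi> (A' \<inter> {u. u l \<le> t}) \<and> \<alpha> * freq J \<xi> A' \<le> freq J \<xi> (A' \<inter> {u. u l > t});
     \<And>A'. (A', Leaf) \<in> nodes A T \<Longrightarrow> freq J \<xi> A' \<le> B;
     \<alpha> ^ (K - k) \<le> freq J \<xi> A; A \<inter> cube F = hbox F lo hi; valid_box F lo hi; x \<in> hbox F lo hi\<rbrakk> \<Longrightarrow>
     \<exists>a. length a = k \<and> reaches T a x \<and>
       (\<forall>l\<in>F. \<forall>u\<in>hbox F lo hi \<inter> leaf_cell T x. \<bar>u l - x l\<bar> \<le> (1 - \<gamma>) ^ nsplits l T a * (hi l - lo l))"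
proof (induction k arbitrary: T A lo hi)
  case 0
  have "\<forall>l\<in>F. \<forall>u\<in>hbox F lo hi. \<bar>u l - x l\<bar> \<le> hi l - lo l"
    using 0 by (fastforce simp: hbox_iff abs_if)
  then show ?case by (intro exI[of _ "[]"]) auto
next
  case (Suc k)
  note reg = Suc.prems(3) and leaves = Suc.prems(4) and fA = Suc.prems(5) and box = Suc.prems(6)
    and valid = Suc.prems(7) and x = Suc.prems(8)
  \<comment> \<open>Cells of the tree are unbounded, but all data lie in the cube, so a cell may be
    counted as the box it cuts out there.\<close>
  have freq_cube: "freq J \<xi> A' = freq J \<xi> (A' \<inter> cube F)" for A'
    unfolding freq_def using data by (intro arg_cong[where f = "\<lambda>A. real (card A) / _"]) auto
  have powK: "\<alpha> ^ K \<le> \<alpha> ^ (K - Suc k)" using const by (intro power_decreasing) auto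
  show ?case
  proof (cases T)
    case Leaf
    \<comment> \<open>The path cannot end here: a leaf has frequency at most \<open>B\<close>,
      whereas fewer than \<open>K\<close> splits leave a frequency of at least
      \<open>\<alpha> ^ K\<close>.\<close>
    then have "freq J \<xi> A \<le> B" using leaves by simp
    then show ?thesis using B fA powK by linarith
  next
    case (Split l t L R)
    have l: "l \<in> F" using Suc.prems(2) Split by simp
    have regA: "\<alpha> * freq J \<xi> A \<le> freq J \<xi> (A \<inter> {u. u l \<le> t})" "\<alpha> * freq J \<xi> A \<le> freq J \<xi> (A \<inter> {u. u l > t})"
      using reg[of A l t L R] Split by auto
    have fA0: "\<alpha> ^ K \<le> freq J \<xi> A" using fA powK by linarith
    have fApos: "0 < \<alpha> * freq J \<xi> A" using less_le_trans[OF zero_less_power[of \<alpha> K] fA0] const by (intro mult_pos_pos) auto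
    \<comment> \<open>\<open>k\<close> counts the splits still to be followed, so the exponent
      \<open>K - k\<close> counts those made so far; each costs at most one factor
      \<open>\<alpha>\<close>.\<close>
    have child: "\<alpha> ^ (K - k) \<le> \<alpha> * freq J \<xi> A"
    proof -
      have "K - k = Suc (K - Suc k)" using Suc.prems(1) by simp
      then show ?thesis using fA const by simp
    qed
    have boxL: "A \<inter> {u. u l \<le> t} \<inter> cube F = hbox F lo hi \<inter> {u. u l \<le> t}" using box by auto
    have boxR: "A \<inter> {u. u l > t} \<inter> cube F = hbox F lo hi \<inter> {u. u l > t}" using box by auto
    \<comment> \<open>Both children contain points of the box, so the threshold lies strictly inside
      the side and the two parts are valid boxes.\<close>
    obtain u where u: "u \<in> hbox F lo hi" "u l \<le> t"
      using freq_pos_obtain[of J \<xi> "A \<inter> {u. u l \<le> t} \<inter> cube F"] regA(1) fApos freq_cube[of "A \<inter> {u. u l \<le> t}"] boxL by auto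
    obtain v where v: "v \<in> hbox F lo hi" "v l > t"
      using freq_pos_obtain[of J \<xi> "A \<inter> {u. u l > t} \<inter> cube F"] regA(2) fApos freq_cube[of "A \<inter> {u. u l > t}"] boxR by auto
    have t: "lo l < t" "t < hi l" using u v l by (auto simp: hbox_iff intro: less_le_trans)
    have eqL: "A \<inter> {u. u l \<le> t} \<inter> cube F = hbox F lo (hi(l := t))"
      and eqR: "A \<inter> {u. u l > t} \<inter> cube F = hbox F (lo(l := t)) hi"
      using hbox_le_cut[OF l, of t hi lo] hbox_gt_cut[OF l, of lo t hi] t boxL boxR by auto
    have validL: "valid_box F lo (hi(l := t))" and validR: "valid_box F (lo(l := t)) hi"
      using valid t l by (auto simp: valid_box_def)
    let ?V = "box_vol (F - {l}) lo hi"
    have V: "0 < ?V"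
      unfolding box_vol_def using x by (intro prod_pos) (fastforce simp: hbox_iff)
    have d0: "0 \<le> \<delta>" using close[OF valid] by linarith
    have d4: "4 * \<delta> \<le> \<alpha> * freq J \<xi> A"
      using \<delta> mult_left_mono[OF fA0, of \<alpha>] const by linarith
    have whole: "c * ((hi l - lo l) * ?V) \<le> freq J \<xi> A + \<delta>"
      using vol[OF valid] close[OF valid] box freq_cube[of A] box_vol_remove[OF F l, of lo lo hi hi]
      by (auto simp: abs_le_iff)
    have left: "\<alpha> * freq J \<xi> A - \<delta> \<le> C * ((t - lo l) * ?V)"
      using vol[OF validL] close[OF validL] regA(1) eqL freq_cube[of "A \<inter> {u. u l \<le> t}"]
        box_vol_remove[OF F l, of lo lo "hi(l := t)" hi]
      by (auto simp: abs_le_iff)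
    have right: "\<alpha> * freq J \<xi> A - \<delta> \<le> C * ((hi l - t) * ?V)"
      using vol[OF validR] close[OF validR] regA(2) eqR freq_cube[of "A \<inter> {u. u l > t}"]
        box_vol_remove[OF F l, of "lo(l := t)" lo hi hi]
      by (auto simp: abs_le_iff)
    \<comment> \<open>Neither child can be too thin, and it is the sibling that profits: the left
      part is at most \<open>1 - \<gamma>\<close> times the side because of \<open>cutR\<close>, the
      right part because of \<open>cutL\<close>.\<close>
    have cutL: "\<gamma> * (hi l - lo l) \<le> t - lo l" and cutR: "\<gamma> * (hi l - lo l) \<le> hi l - t"
      unfolding \<gamma> using ratio_bound[OF const V left whole d4 d0] ratio_bound[OF const V right whole d4 d0] by auto
    have \<gamma>01: "0 \<le> 1 - \<gamma>"
    proof -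
      have "\<gamma> * (hi l - lo l) \<le> 1 * (hi l - lo l)" using order_trans[OF cutL, of "hi l - lo l"] t by simp
      then show ?thesis using t by (simp only: mult_le_cancel_right) auto
    qed
    have side: "(1 - \<gamma>) ^ n * s \<le> (1 - \<gamma>) ^ (of_bool (i = l) + n) * (hi i - lo i)"
      if "s \<le> (1 - \<gamma>) ^ of_bool (i = l) * (hi i - lo i)" for s n i
      using mult_left_mono[OF that, of "(1 - \<gamma>) ^ n"] \<gamma>01 by (simp add: power_add mult_ac)
    show ?thesis
    proof (cases "x l \<le> t")
      case True
      have "x \<in> hbox F lo (hi(l := t))" using x True by (auto simp: hbox_iff)
      have "\<exists>a. length a = k \<and> reaches L a x \<and> (\<forall>i\<in>F. \<forall>u\<in>hbox F lo (hi(l := t)) \<inter> leaf_cell L x.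
           \<bar>u i - x i\<bar> \<le> (1 - \<gamma>) ^ nsplits i L a * ((hi(l := t)) i - lo i))"
      proof (rule Suc.IH)
        show "k \<le> K" "tree_features L \<subseteq> F" using Suc.prems(1,2) Split by auto
        show "\<alpha> * freq J \<xi> A' \<le> freq J \<xi> (A' \<inter> {u. u l' \<le> t'}) \<and>
            \<alpha> * freq J \<xi> A' \<le> freq J \<xi> (A' \<inter> {u. u l' > t'})"
          if "(A', Split l' t' L' R') \<in> nodes (A \<inter> {u. u l \<le> t}) L" for A' l' t' L' R'
          using reg[of A' l' t' L' R'] that Split by simp
        show "freq J \<xi> A' \<le> B" if "(A', Leaf) \<in> nodes (A \<inter> {u. u l \<le> t}) L" for A'
          using leaves[of A'] that Split by simp
        show "\<alpha> ^ (K - k) \<le> freq J \<xi> (A \<inter> {u. u l \<le> t})" using child regA(1) by linarith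
        show "A \<inter> {u. u l \<le> t} \<inter> cube F = hbox F lo (hi(l := t))" by (rule eqL)
        show "valid_box F lo (hi(l := t))" by (rule validL)
      qed fact
      then obtain a where a: "length a = k" "reaches L a x"
        "\<forall>i\<in>F. \<forall>u\<in>hbox F lo (hi(l := t)) \<inter> leaf_cell L x.
           \<bar>u i - x i\<bar> \<le> (1 - \<gamma>) ^ nsplits i L a * ((hi(l := t)) i - lo i)"
        by blast
      have "\<bar>u i - x i\<bar> \<le> (1 - \<gamma>) ^ nsplits i T (True # a) * (hi i - lo i)"
        if "i \<in> F" "u \<in> hbox F lo hi \<inter> leaf_cell T x" for i u
      proof -
        have "u \<in> hbox F lo (hi(l := t)) \<inter> leaf_cell L x"
          using that Split True by (auto simp: hbox_iff)
        then have "\<bar>u i - x i\<bar> \<le> (1 - \<gamma>) ^ nsplits i L a * ((hi(l := t)) i - lo i)"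
          using a(3) that by blast
        also have "\<dots> \<le> (1 - \<gamma>) ^ (of_bool (i = l) + nsplits i L a) * (hi i - lo i)"
          using cutR by (intro side) (auto simp: algebra_simps)
        finally show ?thesis using Split by simp
      qed
      then show ?thesis using a(1,2) Split True by (intro exI[of _ "True # a"]) auto
    next
      case False
      have "x \<in> hbox F (lo(l := t)) hi" using x False by (auto simp: hbox_iff)
      have "\<exists>a. length a = k \<and> reaches R a x \<and> (\<forall>i\<in>F. \<forall>u\<in>hbox F (lo(l := t)) hi \<inter> leaf_cell R x.
           \<bar>u i - x i\<bar> \<le> (1 - \<gamma>) ^ nsplits i R a * (hi i - (lo(l := t)) i))"
      proof (rule Suc.IH)
        show "k \<le> K" "tree_features R \<subseteq> F" using Suc.prems(1,2) Split by auto
        show "\<alpha> * freq J \<xi> A' \<le> freq J \<xi> (A' \<inter> {u. u l' \<le> t'}) \<and>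
            \<alpha> * freq J \<xi> A' \<le> freq J \<xi> (A' \<inter> {u. u l' > t'})"
          if "(A', Split l' t' L' R') \<in> nodes (A \<inter> {u. u l > t}) R" for A' l' t' L' R'
          using reg[of A' l' t' L' R'] that Split by simp
        show "freq J \<xi> A' \<le> B" if "(A', Leaf) \<in> nodes (A \<inter> {u. u l > t}) R" for A'
          using leaves[of A'] that Split by simp
        show "\<alpha> ^ (K - k) \<le> freq J \<xi> (A \<inter> {u. u l > t})" using child regA(2) by linarith
        show "A \<inter> {u. u l > t} \<inter> cube F = hbox F (lo(l := t)) hi" by (rule eqR)
        show "valid_box F (lo(l := t)) hi" by (rule validR)
      qed fact
      then obtain a where a: "length a = k" "reaches R a x"
        "\<forall>i\<in>F. \<forall>u\<in>hbox F (lo(l := t)) hi \<inter> leaf_cell R x.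
           \<bar>u i - x i\<bar> \<le> (1 - \<gamma>) ^ nsplits i R a * (hi i - (lo(l := t)) i)"
        by blast
      have "\<bar>u i - x i\<bar> \<le> (1 - \<gamma>) ^ nsplits i T (False # a) * (hi i - lo i)"
        if "i \<in> F" "u \<in> hbox F lo hi \<inter> leaf_cell T x" for i u
      proof -
        have "u \<in> hbox F (lo(l := t)) hi \<inter> leaf_cell R x"
          using that Split False by (auto simp: hbox_iff)
        then have "\<bar>u i - x i\<bar> \<le> (1 - \<gamma>) ^ nsplits i R a * (hi i - (lo(l := t)) i)"
          using a(3) that by blast
        also have "\<dots> \<le> (1 - \<gamma>) ^ (of_bool (i = l) + nsplits i R a) * (hi i - lo i)"
          using cutL by (intro side) (auto simp: algebra_simps)
        finally show ?thesis using Split by simp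
      qed
      then show ?thesis using a(1,2) Split False by (intro exI[of _ "False # a"]) auto
    qed
  qed
qed

section \<open>Uniform closeness on boxes from closeness on a grid\<close>

definition grid :: "nat set \<Rightarrow> nat \<Rightarrow> (nat \<Rightarrow> real) set" where
  "grid F N = PiE F (\<lambda>_. (\<lambda>i. real i / real N) ` {0..N})"

lemma finite_grid: "finite F \<Longrightarrow> finite (grid F N)"
  unfolding grid_def by (intro finite_PiE) auto

text \<open>Rounding the corners outwards and inwards to the grid encloses the box between two grid
  boxes, on which \<open>\<nu>\<close> and \<open>pr\<close> are close. The outer one exceeds the
  inner one by at most two slabs per feature, each of thickness at most \<open>1 / N\<close> and so
  of \<open>pr\<close>-mass at most \<open>C / N\<close>. Off the grid nothing but monotonicity of
  \<open>\<nu>\<close> enters; the inner box may well be empty.\<close>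

lemma grid_close:
  fixes \<nu> pr :: "input set \<Rightarrow> real"
  assumes F: "finite F" and N: "0 < N" and C: "0 \<le> C"
    and mono: "\<And>lo hi lo' hi'. hbox F lo hi \<subseteq> hbox F lo' hi' \<Longrightarrow> \<nu> (hbox F lo hi) \<le> \<nu> (hbox F lo' hi')"
    and pr_mono: "\<And>lo hi lo' hi'. hbox F lo hi \<subseteq> hbox F lo' hi' \<Longrightarrow> pr (hbox F lo hi) \<le> pr (hbox F lo' hi')"
    and subadd: "\<And>lo hi lo' hi' l1 h1. \<And>I :: (nat \<times> bool) set. finite I \<Longrightarrow> hbox F lo' hi' \<subseteq> hbox F lo hi \<union> (\<Union>i\<in>I. hbox F (l1 i) (h1 i)) \<Longrightarrow>
       pr (hbox F lo' hi') \<le> pr (hbox F lo hi) + (\<Sum>i\<in>I. pr (hbox F (l1 i) (h1 i)))"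
    and vol: "\<And>lo hi. valid_box F lo hi \<Longrightarrow> pr (hbox F lo hi) \<le> C * box_vol F lo hi"
    and grid: "\<And>lo hi. lo \<in> grid F N \<Longrightarrow> hi \<in> grid F N \<Longrightarrow> \<bar>\<nu> (hbox F lo hi) - pr (hbox F lo hi)\<bar> \<le> \<delta>"
    and valid: "valid_box F lo hi"
  shows "\<bar>\<nu> (hbox F lo hi) - pr (hbox F lo hi)\<bar> \<le> \<delta> + 2 * real (card F) * C / real N"
proof -
  define fl where "fl = (\<lambda>t :: real. real (nat \<lfloor>t * N\<rfloor>) / N)"
  define ce where "ce = (\<lambda>t :: real. real (nat \<lceil>t * N\<rceil>) / N)"
  have fl: "fl t \<le> t" "0 \<le> fl t" "fl t \<in> (\<lambda>i. real i / real N) ` {0..N}"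
    and ce: "t \<le> ce t" "ce t \<le> 1" "ce t \<in> (\<lambda>i. real i / real N) ` {0..N}"
    and gap: "ce t - fl t \<le> 1 / N" if t: "0 \<le> t" "t \<le> 1" for t
  proof -
    have tN: "0 \<le> t * N" "t * N \<le> N" using t N by (auto simp: mult_le_cancel_right1)
    have a: "real (nat \<lfloor>t * N\<rfloor>) \<le> t * N" using tN(1) by (simp add: of_nat_nat)
    have b: "t * N \<le> real (nat \<lceil>t * N\<rceil>)" by (rule real_nat_ceiling_ge)
    show "fl t \<le> t" using a N by (simp add: fl_def divide_le_eq)
    show "t \<le> ce t" using b N by (simp add: ce_def le_divide_eq)
    show "0 \<le> fl t" by (simp add: fl_def)
    have c: "nat \<lceil>t * N\<rceil> \<le> N" using tN(2) by (simp add: nat_le_iff ceiling_le_iff)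
    then show "ce t \<le> 1" using N by (simp add: ce_def divide_le_eq)
    show "ce t \<in> (\<lambda>i. real i / real N) ` {0..N}" using c by (auto simp: ce_def)
    have "nat \<lfloor>t * N\<rfloor> \<le> N" using c by (meson floor_le_ceiling nat_mono order_trans)
    then show "fl t \<in> (\<lambda>i. real i / real N) ` {0..N}" by (auto simp: fl_def)
    have "real (nat \<lceil>t * N\<rceil>) - real (nat \<lfloor>t * N\<rfloor>) \<le> 1"
      using tN(1) ceiling_diff_floor_le_1[of "t * N"] by (simp add: of_nat_nat)
    then show "ce t - fl t \<le> 1 / N"
      by (simp add: ce_def fl_def diff_divide_distrib[symmetric] divide_right_mono)
  qed
  have v: "0 \<le> lo l" "lo l \<le> 1" "0 \<le> hi l" "hi l \<le> 1" if "l \<in> F" for l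
    using valid that by (fastforce simp: valid_box_def)+
  let ?fl = "\<lambda>f. restrict (\<lambda>l. fl (f l)) F" and ?ce = "\<lambda>f. restrict (\<lambda>l. ce (f l)) F"
  let ?out = "hbox F (?fl lo) (?ce hi)" and ?in = "hbox F (?ce lo) (?fl hi)"
  have in_grid: "?fl lo \<in> grid F N" "?ce lo \<in> grid F N" "?fl hi \<in> grid F N" "?ce hi \<in> grid F N"
    unfolding grid_def using v by (auto intro!: fl ce)
  have sub1: "hbox F lo hi \<subseteq> ?out"
  proof
    fix u assume u: "u \<in> hbox F lo hi"
    have "fl (lo l) < u l \<and> u l \<le> ce (hi l)" if "l \<in> F" for l
      using u fl(1)[OF v(1,2)[OF that]] ce(1)[OF v(3,4)[OF that]] that by (force simp: hbox_iff)
    then show "u \<in> ?out" using u by (simp add: hbox_iff)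
  qed
  have sub2: "?in \<subseteq> hbox F lo hi"
  proof
    fix u assume u: "u \<in> ?in"
    have "lo l < u l \<and> u l \<le> hi l" if "l \<in> F" for l
      using u fl(1)[OF v(3,4)[OF that]] ce(1)[OF v(1,2)[OF that]] that by (force simp: hbox_iff)
    then show "u \<in> hbox F lo hi" using u by (simp add: hbox_iff)
  qed
  \<comment> \<open>The slab \<open>(l, True)\<close> lies around the lower face in direction
    \<open>l\<close> and \<open>(l, False)\<close> around the upper one; all other sides are the
    full unit interval.\<close>
  define l1 :: "nat \<times> bool \<Rightarrow> nat \<Rightarrow> real" where
    "l1 = (\<lambda>(l, b). (\<lambda>_. 0)(l := if b then fl (lo l) else fl (hi l)))"
  define h1 :: "nat \<times> bool \<Rightarrow> nat \<Rightarrow> real" where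
    "h1 = (\<lambda>(l, b). (\<lambda>_. 1)(l := if b then ce (lo l) else ce (hi l)))"
  have valid1: "valid_box F (l1 i) (h1 i)" and vol1: "box_vol F (l1 i) (h1 i) \<le> 1 / N" if i0: "i \<in> F \<times> UNIV" for i
  proof -
    obtain l b where i: "i = (l, b)" "l \<in> F" using i0 by auto
    have *: "fl t \<le> ce t" if "0 \<le> t" "t \<le> 1" for t using fl(1) ce(1) that order_trans by blast
    have **: "fl t \<le> 1" "0 \<le> ce t" if "0 \<le> t" "t \<le> 1" for t
      using fl(1)[OF that] ce(1)[OF that] that by linarith+
    show "valid_box F (l1 i) (h1 i)"
      using v[OF i(2)] fl(2) ce(2) * ** by (auto simp: valid_box_def l1_def h1_def i(1))
    have "box_vol F (l1 i) (h1 i) = (h1 i l - l1 i l) * box_vol (F - {l}) (\<lambda>_. 0) (\<lambda>_. 1)"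
      by (rule box_vol_remove[OF F i(2)]) (auto simp: l1_def h1_def i(1))
    also have "\<dots> = h1 i l - l1 i l" by (simp add: box_vol_def)
    also have "\<dots> \<le> 1 / N" using gap v[OF i(2)] by (auto simp: l1_def h1_def i(1))
    finally show "box_vol F (l1 i) (h1 i) \<le> 1 / N" .
  qed
  have cover: "?out \<subseteq> ?in \<union> (\<Union>i\<in>F \<times> UNIV. hbox F (l1 i) (h1 i))"
  proof
    fix u assume u: "u \<in> ?out"
    show "u \<in> ?in \<union> (\<Union>i\<in>F \<times> UNIV. hbox F (l1 i) (h1 i))"
    proof (cases "u \<in> ?in")
      case False
      then obtain l where l: "l \<in> F" "u l \<le> ce (lo l) \<or> fl (hi l) < u l"
        using u by (auto simp: hbox_iff not_less not_le)
      have u01: "0 < u i" "u i \<le> 1" if "i \<in> F" for i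
        using u that fl(2)[OF v(1,2)[OF that]] ce(2)[OF v(3,4)[OF that]]
        by (fastforce simp: hbox_iff)+
      have "u \<in> hbox F (l1 (l, u l \<le> ce (lo l))) (h1 (l, u l \<le> ce (lo l)))"
        using u l u01 by (auto simp: hbox_iff l1_def h1_def)
      then show ?thesis using l(1) by blast
    qed auto
  qed
  have "pr ?out \<le> pr ?in + (\<Sum>i\<in>F \<times> UNIV. pr (hbox F (l1 i) (h1 i)))"
    using F cover by (intro subadd) auto
  also have "(\<Sum>i\<in>F \<times> UNIV. pr (hbox F (l1 i) (h1 i))) \<le> (\<Sum>i\<in>F \<times> (UNIV :: bool set). C * (1 / N))"
    using vol[OF valid1] vol1 C by (intro sum_mono) (meson mult_left_mono order_trans)
  also have "\<dots> = 2 * real (card F) * C / N" by (simp add: card_cartesian_product)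
  finally have out_in: "pr ?out \<le> pr ?in + 2 * real (card F) * C / N" by (simp only: add_left_mono)
  show ?thesis
    using grid[OF in_grid(1,4)] grid[OF in_grid(2,3)] out_in
      mono[OF sub1] mono[OF sub2] pr_mono[OF sub1] pr_mono[OF sub2] by linarith
qed

section \<open>Averages of independent random elements of a Hilbert space\<close>

text \<open>By independence the joint law is a product, and Fubini lets the inner product, which is
  linear in each argument, pass through both integrals. The common bound provides
  integrability.\<close>

lemma (in prob_space) expectation_inner_indep:
  fixes f g :: "'a \<Rightarrow> 'h::{real_inner, banach, second_countable_topology}"
  assumes ind: "indep_var borel f borel g"
    and b: "AE w in M. norm (f w) \<le> b" "AE w in M. norm (g w) \<le> b"
  shows "expectation (\<lambda>w. inner (f w) (g w)) = inner (expectation f) (expectation g)"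
proof -
  have f [measurable]: "f \<in> borel_measurable M" and g [measurable]: "g \<in> borel_measurable M"
    using indep_var_rv1[OF ind] indep_var_rv2[OF ind] by auto
  let ?D1 = "distr M borel f" and ?D2 = "distr M borel g"
  interpret D1: prob_space ?D1 by (rule prob_space_distr) simp
  interpret D2: prob_space ?D2 by (rule prob_space_distr) simp
  interpret pair: pair_prob_space ?D1 ?D2 ..
  have eq: "?D1 \<Otimes>\<^sub>M ?D2 = distr M (borel \<Otimes>\<^sub>M borel) (\<lambda>w. (f w, g w))"
    using ind unfolding indep_var_distribution_eq by auto
  have m: "(\<lambda>p. inner (fst p) (snd p) :: real) \<in> borel_measurable (borel \<Otimes>\<^sub>M (borel :: 'h measure))"
    by measurable
  have int_fg: "integrable M f" "integrable M g"
    using b by (auto intro!: integrable_const_bound[where B = b])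
  have "integrable M (\<lambda>w. inner (f w) (g w))"
  proof (rule integrable_const_bound[where B = "b * b"])
    show "AE w in M. norm (inner (f w) (g w)) \<le> b * b"
      using b
    proof eventually_elim
      case (elim w)
      have "norm (inner (f w) (g w)) \<le> norm (f w) * norm (g w)"
        by (simp add: Cauchy_Schwarz_ineq2)
      also have "\<dots> \<le> b * b" using elim order_trans[OF norm_ge_zero elim(1)] by (intro mult_mono) auto
      finally show ?case .
    qed
  qed simp
  then have int: "integrable (?D1 \<Otimes>\<^sub>M ?D2) (\<lambda>p. inner (fst p) (snd p))"
    unfolding eq using m by (subst integrable_distr_eq) auto
  have "expectation (\<lambda>w. inner (f w) (g w)) = (\<integral>p. inner (fst p) (snd p) \<partial>(?D1 \<Otimes>\<^sub>M ?D2))"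
    unfolding eq using m by (subst integral_distr) auto
  also have "\<dots> = (\<integral>x. (\<integral>y. inner x y \<partial>?D2) \<partial>?D1)"
    using pair.integral_fst'[OF int] by simp
  also have "\<dots> = (\<integral>x. inner x (expectation g) \<partial>?D1)"
    using int_fg by (intro Bochner_Integration.integral_cong refl)
      (subst integral_inner_right, auto simp: integrable_distr_eq integral_distr)
  also have "\<dots> = inner (expectation f) (expectation g)"
    using int_fg by (subst integral_inner_left) (auto simp: integrable_distr_eq integral_distr)
  finally show ?thesis .
qed

text \<open>After centring, the square is a double sum of inner products: off the diagonal they have
  mean zero by pairwise independence, on the diagonal their mean is at most
  \<open>(2 * b)\<^sup>2\<close>, whence the 4.\<close>

lemma (in prob_space) mean_square_average:
  fixes f :: "'i \<Rightarrow> 'a \<Rightarrow> 'h::{real_inner, banach, second_countable_topology}"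
  assumes J: "finite J" "J \<noteq> {}"
    and ind: "\<And>i j. i \<in> J \<Longrightarrow> j \<in> J \<Longrightarrow> i \<noteq> j \<Longrightarrow> indep_var borel (f i) borel (f j)"
    and meas: "\<And>i. i \<in> J \<Longrightarrow> f i \<in> borel_measurable M"
    and b: "\<And>i. i \<in> J \<Longrightarrow> AE w in M. norm (f i w) \<le> b"
    and e: "\<And>i. i \<in> J \<Longrightarrow> expectation (f i) = e"
  shows "expectation (\<lambda>w. (norm ((1 / real (card J)) *\<^sub>R (\<Sum>i\<in>J. f i w) - e))\<^sup>2) \<le> 4 * b\<^sup>2 / real (card J)"
    "integrable M (\<lambda>w. (norm ((1 / real (card J)) *\<^sub>R (\<Sum>i\<in>J. f i w) - e))\<^sup>2)"
proof -
  let ?n = "real (card J)"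
  have n: "?n > 0" using J by (simp add: card_gt_0_iff)
  define g where "g i w = f i w - e" for i w
  have int_f: "integrable M (f i)" if "i \<in> J" for i
    using b[OF that] meas[OF that] by (rule integrable_const_bound)
  \<comment> \<open>The mean inherits the bound of any summand, so the centred variables are bounded
    by \<open>2 * b\<close>.\<close>
  have ne: "norm e \<le> b"
  proof -
    obtain i where i: "i \<in> J" using J by auto
    have "norm (expectation (f i)) \<le> expectation (\<lambda>w. norm (f i w))" by (rule integral_norm_bound)
    also have "\<dots> \<le> expectation (\<lambda>_. b)"
      using b[OF i] int_f[OF i] by (intro integral_mono_AE) auto
    finally show ?thesis using e[OF i] by (simp add: prob_space)
  qed
  have b0: "0 \<le> b" using ne norm_ge_zero order_trans by blast
  have gm: "g i \<in> borel_measurable M" if "i \<in> J" for i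
    using meas[OF that] by (simp add: g_def[abs_def])
  have gb: "AE w in M. norm (g i w) \<le> 2 * b" if "i \<in> J" for i
    using b[OF that] by eventually_elim (use ne norm_triangle_ineq4 in \<open>simp add: g_def; smt (verit)\<close>)
  have ge: "expectation (g i) = 0" if "i \<in> J" for i
    using int_f[OF that] e[OF that] by (simp add: g_def[abs_def] prob_space)
  have gi: "indep_var borel (g i) borel (g j)" if "i \<in> J" "j \<in> J" "i \<noteq> j" for i j
  proof -
    have "indep_var borel ((\<lambda>y. y - e) \<circ> f i) borel ((\<lambda>y. y - e) \<circ> f j)"
      by (rule indep_var_compose[OF ind[OF that]]) auto
    then show ?thesis by (simp add: o_def g_def[abs_def])
  qed
  have int: "integrable M (\<lambda>w. inner (g i w) (g j w))"
    and le: "expectation (\<lambda>w. inner (g i w) (g j w)) \<le> (2 * b)\<^sup>2" if "i \<in> J" "j \<in> J" for i j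
  proof -
    have AE: "AE w in M. norm (inner (g i w) (g j w)) \<le> (2 * b)\<^sup>2"
      using gb[OF that(1)] gb[OF that(2)]
    proof eventually_elim
      case (elim w)
      have "norm (inner (g i w) (g j w)) \<le> norm (g i w) * norm (g j w)"
        by (simp add: Cauchy_Schwarz_ineq2)
      also have "\<dots> \<le> (2 * b) * (2 * b)" using elim b0 by (intro mult_mono) auto
      finally show ?case by (simp add: power2_eq_square)
    qed
    show int: "integrable M (\<lambda>w. inner (g i w) (g j w))"
      using gm[OF that(1)] gm[OF that(2)] by (intro integrable_const_bound[OF AE]) measurable
    have "expectation (\<lambda>w. inner (g i w) (g j w)) \<le> expectation (\<lambda>_. (2 * b)\<^sup>2)"
      using AE int by (intro integral_mono_AE) auto
    then show "expectation (\<lambda>w. inner (g i w) (g j w)) \<le> (2 * b)\<^sup>2" by (simp add: prob_space)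
  qed
  have sq: "(norm ((1 / ?n) *\<^sub>R (\<Sum>i\<in>J. f i w) - e))\<^sup>2 = (\<Sum>i\<in>J. \<Sum>j\<in>J. inner (g i w) (g j w)) / ?n\<^sup>2" for w
  proof -
    have "(\<Sum>i\<in>J. g i w) = (\<Sum>i\<in>J. f i w) - ?n *\<^sub>R e"
      by (simp only: g_def sum_subtractf sum_constant_scaleR)
    then have "(1 / ?n) *\<^sub>R (\<Sum>i\<in>J. f i w) - e = (1 / ?n) *\<^sub>R (\<Sum>i\<in>J. g i w)"
      using n by (simp add: scaleR_diff_right)
    then have "(norm ((1 / ?n) *\<^sub>R (\<Sum>i\<in>J. f i w) - e))\<^sup>2 = (norm (\<Sum>i\<in>J. g i w))\<^sup>2 / ?n\<^sup>2"
      by (simp add: power_divide)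
    also have "(norm (\<Sum>i\<in>J. g i w))\<^sup>2 = (\<Sum>i\<in>J. \<Sum>j\<in>J. inner (g i w) (g j w))"
      by (simp add: power2_norm_eq_inner inner_sum_left inner_sum_right) (rule sum.swap)
    finally show ?thesis .
  qed
  show "integrable M (\<lambda>w. (norm ((1 / ?n) *\<^sub>R (\<Sum>i\<in>J. f i w) - e))\<^sup>2)"
    unfolding sq using int by (intro integrable_divide Bochner_Integration.integrable_sum) auto
  have "expectation (\<lambda>w. (norm ((1 / ?n) *\<^sub>R (\<Sum>i\<in>J. f i w) - e))\<^sup>2) =
     (\<Sum>i\<in>J. \<Sum>j\<in>J. expectation (\<lambda>w. inner (g i w) (g j w))) / ?n\<^sup>2"
    unfolding sq using int by (simp add: Bochner_Integration.integral_sum Bochner_Integration.integrable_sum)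
  also have "(\<Sum>i\<in>J. \<Sum>j\<in>J. expectation (\<lambda>w. inner (g i w) (g j w))) \<le> (\<Sum>i\<in>J. \<Sum>j\<in>J. if i = j then (2 * b)\<^sup>2 else 0)"
    using le ge expectation_inner_indep[OF gi gb gb] by (intro sum_mono) auto
  also have "\<dots> = ?n * (2 * b)\<^sup>2" using J by simp
  finally show "expectation (\<lambda>w. (norm ((1 / ?n) *\<^sub>R (\<Sum>i\<in>J. f i w) - e))\<^sup>2) \<le> 4 * b\<^sup>2 / ?n"
    using n by (simp add: divide_right_mono power2_eq_square field_simps)
qed

section \<open>Product measures\<close>

lemma AE_pair_snd:
  assumes "sigma_finite_measure N" "AE y in N. P y"
  shows "AE p in M \<Otimes>\<^sub>M N. P (snd p)"
proof -
  interpret N: sigma_finite_measure N by fact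
  obtain A where A: "{y \<in> space N. \<not> P y} \<subseteq> A" "A \<in> null_sets N"
    using assms(2) by (auto simp: eventually_ae_filter)
  have "emeasure (M \<Otimes>\<^sub>M N) (space M \<times> A) = emeasure M (space M) * emeasure N A"
    using A(2) by (intro N.emeasure_pair_measure_Times) auto
  then have "space M \<times> A \<in> null_sets (M \<Otimes>\<^sub>M N)" using A(2) by (auto simp: null_sets_def)
  then show ?thesis
    by (rule AE_I') (use A(1) in \<open>auto simp: space_pair_measure\<close>)
qed

lemma indep_vars_coordinates:
  assumes Q: "prob_space Q" and I: "I \<noteq> {}"
  shows "prob_space.indep_vars (PiM I (\<lambda>_. Q)) (\<lambda>_. Q) (\<lambda>i z. z i) I"
proof -
  interpret P: prob_space "PiM I (\<lambda>_. Q)" using Q by (intro prob_space_PiM) auto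
  have "distr (PiM I (\<lambda>_. Q)) (PiM I (\<lambda>_. Q)) (\<lambda>z. \<lambda>i\<in>I. z i) = PiM I (\<lambda>_. Q)"
  proof -
    have "distr (PiM I (\<lambda>_. Q)) (PiM I (\<lambda>_. Q)) (\<lambda>z. \<lambda>i\<in>I. z i) =
        distr (PiM I (\<lambda>_. Q)) (PiM I (\<lambda>_. Q)) (\<lambda>z. z)"
      by (intro distr_cong) (auto simp: space_PiM PiE_iff extensional_restrict)
    then show ?thesis by simp
  qed
  also have "\<dots> = PiM I (\<lambda>i. distr (PiM I (\<lambda>_. Q)) Q (\<lambda>z. z i))"
    using Q distr_PiM_component[of I "\<lambda>_. Q"] by (intro PiM_cong) auto
  finally show ?thesis
    by (subst P.indep_vars_iff_distr_eq_PiM'[OF I]) auto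
qed

lemma indep_var_coordinate_blocks:
  assumes Q: "prob_space Q" and I: "I \<noteq> {}" and AB: "A \<inter> B = {}" "A \<subseteq> I" "B \<subseteq> I"
  shows "prob_space.indep_var (PiM I (\<lambda>_. Q)) (PiM A (\<lambda>_. Q)) (\<lambda>z. restrict z A) (PiM B (\<lambda>_. Q)) (\<lambda>z. restrict z B)"
proof -
  interpret P: prob_space "PiM I (\<lambda>_. Q)" using Q by (intro prob_space_PiM) auto
  from P.indep_var_restrict[OF indep_vars_coordinates[OF Q I] AB]
  show ?thesis by simp
qed

lemma indep_var_coordinates:
  assumes Q: "prob_space Q" and ij: "i \<in> I" "j \<in> I" "i \<noteq> j"
    and f: "f \<in> measurable Q M1" and g: "g \<in> measurable Q M2"
  shows "prob_space.indep_var (PiM I (\<lambda>_. Q)) M1 (\<lambda>z. f (z i)) M2 (\<lambda>z. g (z j))"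
proof -
  interpret P: prob_space "PiM I (\<lambda>_. Q)" using Q by (intro prob_space_PiM) auto
  have c: "(\<lambda>z. z k) \<in> measurable (PiM {k} (\<lambda>_. Q)) Q" for k
    by (intro measurable_component_singleton) auto
  have "P.indep_var M1 ((\<lambda>z. f (z i)) \<circ> (\<lambda>z. restrict z {i})) M2 ((\<lambda>z. g (z j)) \<circ> (\<lambda>z. restrict z {j}))"
    using ij measurable_compose[OF c f] measurable_compose[OF c g]
    by (intro P.indep_var_compose[OF indep_var_coordinate_blocks[OF Q]]) auto
  then show ?thesis by (simp add: o_def)
qed

section \<open>The law of a single observation and the masses of boxes\<close>

text \<open>
  \<open>Q\<close> is the law of an observation whose input is restricted to the features in \<open>F\<close>, so that the two
  forests being compared are both instances. The density enters only through its bounds on boxes.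
\<close>

locale forest_law =
  fixes F :: "nat set" and Q :: "(input \<times> 'h::{real_inner, banach, second_countable_topology}) measure"
    and m :: "input \<Rightarrow> 'h" and b L c C :: real
  assumes finite_F [simp]: "finite F"
    and prob_Q: "prob_space Q"
    and sets_Q [measurable_cong]: "sets Q = sets (input_space F \<Otimes>\<^sub>M borel)"
    and response_bounded: "AE q in Q. norm (snd q) \<le> b"
    and inputs_in_cube: "AE q in Q. fst q \<in> cube F"
    and m_measurable [measurable]: "m \<in> borel_measurable (input_space F)"
    and m_bounded: "\<And>x. x \<in> cube F \<Longrightarrow> norm (m x) \<le> b"
    and m_lipschitz: "\<And>x y. x \<in> cube F \<Longrightarrow> y \<in> cube F \<Longrightarrow> norm (m x - m y) \<le> L * (\<Sum>l\<in>F. \<bar>x l - y l\<bar>)"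
    and L_nonneg: "0 \<le> L"
    and regress: "\<And>A. A \<in> sets (input_space F) \<Longrightarrow>
        (\<integral>q. indicator A (fst q) *\<^sub>R snd q \<partial>Q) = (\<integral>q. indicator A (fst q) *\<^sub>R m (fst q) \<partial>Q)"
    and c_pos: "0 < c"
    and box_bounds: "\<And>lo hi. valid_box F lo hi \<Longrightarrow>
        c * box_vol F lo hi \<le> measure Q {q \<in> space Q. fst q \<in> hbox F lo hi} \<and>
        measure Q {q \<in> space Q. fst q \<in> hbox F lo hi} \<le> C * box_vol F lo hi"
begin

sublocale Q: prob_space Q by (rule prob_Q)

definition pr :: "input set \<Rightarrow> real" where
  "pr A = measure Q {q \<in> space Q. fst q \<in> A}"

abbreviation samples :: "nat \<Rightarrow> 'h sample measure" where
  "samples s \<equiv> PiM {..<s} (\<lambda>_. Q)"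

lemma space_Q: "space Q = space (input_space F \<Otimes>\<^sub>M borel)"
  using sets_Q by (rule sets_eq_imp_space_eq)

lemma sets_samples: "sets (samples s) = sets (sample_space F s)"
  unfolding sample_space_def by (rule sets_PiM_cong) (auto simp: sets_Q)

lemma space_samples: "space (samples s) = space (sample_space F s)"
  using sets_samples by (rule sets_eq_imp_space_eq)

lemma measurable_id_samples: "(\<lambda>z. z) \<in> measurable (samples s) (sample_space F s)"
  by (rule measurable_ident_sets[OF sets_samples])

lemma prob_samples: "prob_space (samples s)"
  using prob_Q by (intro prob_space_PiM) auto

lemma measurable_fst_Q [measurable]: "fst \<in> measurable Q (input_space F)"
  using sets_Q by (simp cong: measurable_cong_sets)

lemma measurable_snd_Q [measurable]: "snd \<in> borel_measurable Q"
  using sets_Q by (simp cong: measurable_cong_sets)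

lemma c_le_C: "c \<le> C" "0 < C"
proof -
  have "box_vol F (\<lambda>_. 0) (\<lambda>_. 1) = 1" by (simp add: box_vol_def)
  then show "c \<le> C" using box_bounds[OF valid_cube] by simp
  then show "0 < C" using c_pos by simp
qed

lemma b_nonneg: "0 \<le> b"
proof -
  have "AE q in Q. 0 \<le> b"
    using response_bounded by eventually_elim (meson norm_ge_zero order_trans)
  then show ?thesis by (simp add: Q.prob_space)
qed

lemma AE_samples:
  assumes "AE q in Q. R q"
  shows "AE z in samples s. \<forall>i<s. R (z i)"
proof -
  have "AE z in samples s. \<forall>i\<in>{..<s}. R (z i)"
    using assms prob_Q by (intro AE_finite_allI) (auto intro!: AE_PiM_component)
  then show ?thesis by eventually_elim auto
qed

lemma hbox_pred [measurable]: "Measurable.pred Q (\<lambda>q. fst q \<in> hbox F lo hi)"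
proof -
  have [measurable]: "hbox F lo hi \<in> sets (input_space F)" by simp
  show ?thesis by measurable
qed

lemma pr_box: "valid_box F lo hi \<Longrightarrow> c * box_vol F lo hi \<le> pr (hbox F lo hi) \<and> pr (hbox F lo hi) \<le> C * box_vol F lo hi"
  using box_bounds unfolding pr_def .

lemma pr_mono: "hbox F lo hi \<subseteq> hbox F lo' hi' \<Longrightarrow> pr (hbox F lo hi) \<le> pr (hbox F lo' hi')"
  unfolding pr_def by (intro Q.finite_measure_mono) auto

lemma pr_subadd:
  assumes I: "finite I" and sub: "hbox F lo' hi' \<subseteq> hbox F lo hi \<union> (\<Union>i\<in>I. hbox F (l1 i) (h1 i))"
  shows "pr (hbox F lo' hi') \<le> pr (hbox F lo hi) + (\<Sum>i\<in>I. pr (hbox F (l1 i) (h1 i)))"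
proof -
  let ?S = "\<lambda>lo hi. {q \<in> space Q. fst q \<in> hbox F lo hi}"
  have S [simp]: "?S lo hi \<in> sets Q" for lo hi
    using hbox_pred by (simp only: pred_def)
  have "pr (hbox F lo' hi') \<le> measure Q (?S lo hi \<union> (\<Union>i\<in>I. ?S (l1 i) (h1 i)))"
    unfolding pr_def using sub I by (intro Q.finite_measure_mono sets.Un sets.finite_UN S) auto
  also have "\<dots> \<le> measure Q (?S lo hi) + measure Q (\<Union>i\<in>I. ?S (l1 i) (h1 i))"
    using I by (intro measure_Un_le sets.finite_UN S)
  also have "measure Q (\<Union>i\<in>I. ?S (l1 i) (h1 i)) \<le> (\<Sum>i\<in>I. measure Q (?S (l1 i) (h1 i)))"
    using I by (intro measure_UNION_le S)
  finally show ?thesis by (simp add: pr_def)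
qed

section \<open>Absence of ties\<close>

text \<open>Within the cube the hyperplane is contained in a slab of arbitrarily small thickness
  \<open>\<epsilon>\<close>, of mass at most \<open>C * \<epsilon>\<close>. The density itself is no
  longer at hand, only its bounds on boxes.\<close>

lemma coordinate_prob_zero:
  assumes l: "l \<in> F"
  shows "AE q in Q. fst q l \<noteq> a"
proof -
  have [measurable]: "(\<lambda>q. fst q l) \<in> borel_measurable Q"
    by (rule measurable_input_component[OF measurable_fst_Q])
  have small: "measure Q {q \<in> space Q. fst q \<in> cube F \<and> fst q l = a} \<le> C * \<epsilon>" if \<epsilon>: "0 < \<epsilon>" for \<epsilon>
  proof (cases "0 < a \<and> a \<le> 1")
    case True
    \<comment> \<open>The slab ends at \<open>a\<close>, as boxes contain their upper faces; the
      maximum with 0 keeps it inside the cube.\<close>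
    let ?lo = "(\<lambda>_. 0)(l := max 0 (a - \<epsilon>))" and ?hi = "(\<lambda>_. 1)(l := a)"
    have valid: "valid_box F ?lo ?hi" using True \<epsilon> by (auto simp: valid_box_def)
    have vol: "box_vol F ?lo ?hi = (?hi l - ?lo l) * box_vol (F - {l}) (\<lambda>_. 0) (\<lambda>_. 1)"
      by (rule box_vol_remove[OF finite_F l]) auto
    have "measure Q {q \<in> space Q. fst q \<in> cube F \<and> fst q l = a} \<le> pr (hbox F ?lo ?hi)"
      unfolding pr_def using True \<epsilon> by (intro Q.finite_measure_mono) (auto simp: hbox_iff)
    also have "\<dots> \<le> C * box_vol F ?lo ?hi" using pr_box[OF valid] by simp
    also have "\<dots> \<le> C * \<epsilon>"
      unfolding vol using c_le_C(2) True by (intro mult_left_mono) (auto simp: box_vol_def)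
    finally show ?thesis .
  next
    case False
    then have "{q \<in> space Q. fst q \<in> cube F \<and> fst q l = a} = {}" using l by (auto simp: hbox_iff)
    then show ?thesis using \<epsilon> c_le_C(2) by (simp only: measure_empty) simp
  qed
  have "measure Q {q \<in> space Q. fst q \<in> cube F \<and> fst q l = a} \<le> 0"
  proof (rule field_le_epsilon)
    fix e :: real assume "0 < e"
    then show "measure Q {q \<in> space Q. fst q \<in> cube F \<and> fst q l = a} \<le> 0 + e"
      using small[of "e / C"] c_le_C(2) by simp
  qed
  then have "emeasure Q {q \<in> space Q. \<not> \<not> (fst q \<in> cube F \<and> fst q l = a)} = 0"
    by (simp add: Q.emeasure_eq_measure measure_le_0_iff)
  moreover have "Measurable.pred Q (\<lambda>q. \<not> (fst q \<in> cube F \<and> fst q l = a))"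
    by measurable
  ultimately have "AE q in Q. \<not> (fst q \<in> cube F \<and> fst q l = a)"
    by (subst AE_iff_measurable[OF _ refl]) (auto simp: pred_def)
  then show ?thesis using inputs_in_cube by eventually_elim auto
qed

text \<open>Two coordinates of the sample are independent with law \<open>Q\<close>; for a fixed
  value of the first, the second avoids a hyperplane almost surely.\<close>

lemma AE_no_tie:
  assumes l: "l \<in> F" and ij: "i < s" "j < s" "i \<noteq> j"
  shows "AE z in samples s. fst (z i) l \<noteq> fst (z j) l"
proof -
  interpret S: prob_space "samples s" by (rule prob_samples)
  interpret QQ: pair_prob_space Q Q ..
  have ind: "S.indep_var Q (\<lambda>z. z i) Q (\<lambda>z. z j)"
    using indep_var_coordinates[OF prob_Q, of i "{..<s}" j "\<lambda>q. q" Q "\<lambda>q. q" Q] ij by simp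
  have eq: "distr (samples s) (Q \<Otimes>\<^sub>M Q) (\<lambda>z. (z i, z j)) = Q \<Otimes>\<^sub>M Q"
    using ind ij distr_PiM_component[of "{..<s}" "\<lambda>_. Q"] prob_Q
    unfolding S.indep_var_distribution_eq by simp
  have [measurable]: "(\<lambda>q. fst q l) \<in> borel_measurable Q"
    by (rule measurable_input_component[OF measurable_fst_Q])
  have "AE p in Q \<Otimes>\<^sub>M Q. fst (fst p) l \<noteq> fst (snd p) l"
  proof (rule QQ.AE_pair_measure)
    show "{p \<in> space (Q \<Otimes>\<^sub>M Q). fst (fst p) l \<noteq> fst (snd p) l} \<in> sets (Q \<Otimes>\<^sub>M Q)" by measurable
    show "AE x in Q. AE y in Q. fst (fst (x, y)) l \<noteq> fst (snd (x, y)) l"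
      using coordinate_prob_zero[OF l] by (auto simp: eq_commute)
  qed
  moreover have "(\<lambda>z. (z i, z j)) \<in> measurable (samples s) (Q \<Otimes>\<^sub>M Q)"
    using ij by (intro measurable_Pair measurable_component_singleton) auto
  ultimately show ?thesis
    using AE_distrD[of "\<lambda>z. (z i, z j)" "samples s" "Q \<Otimes>\<^sub>M Q" "\<lambda>p. fst (fst p) l \<noteq> fst (snd p) l"]
    unfolding eq by simp
qed

lemma AE_tie_free: "AE z in samples s. z \<in> tie_free_samples F s"
proof -
  have "AE z in samples s. \<forall>l\<in>F. \<forall>i\<in>{..<s}. \<forall>j\<in>{..<s} - {i}. fst (z i) l \<noteq> fst (z j) l"
    by (intro AE_finite_allI AE_no_tie) auto
  moreover have "AE z in samples s. z \<in> space (sample_space F s)"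
    using AE_space[of "samples s"] by (simp add: space_samples)
  ultimately show ?thesis
    by eventually_elim (auto simp: tie_free_samples_def tie_free_def inj_on_def)
qed

section \<open>Empirical frequencies of boxes\<close>

text \<open>A frequency is an average of independent indicators, so the general estimate applies
  with bound 1. The set \<open>J\<close> has to be deterministic, which the leaf half is once the
  tree randomization is fixed.\<close>

lemma freq_mean_square:
  assumes J: "J \<subseteq> {..<s}" "J \<noteq> {}" and A: "A = hbox F lo hi"
  shows "integrable (samples s) (\<lambda>z. (freq J (\<lambda>i. fst (z i)) A - pr A)\<^sup>2)"
    "(\<integral>z. (freq J (\<lambda>i. fst (z i)) A - pr A)\<^sup>2 \<partial>samples s) \<le> 4 / real (card J)"
proof -
  interpret S: prob_space "samples s" by (rule prob_samples)
  have fJ: "finite J" using J(1) finite_subset by blast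
  define f where "f i z = (indicator A (fst (z i)) :: real)" for i and z :: "'h sample"
  have ind: "(\<lambda>q. indicator A (fst q) :: real) \<in> borel_measurable Q"
    unfolding A by simp
  have fm: "f i \<in> borel_measurable (samples s)" if "i \<in> J" for i
  proof -
    have "(\<lambda>z. z i) \<in> measurable (samples s) Q"
      using that J by (intro measurable_component_singleton) auto
    from measurable_compose[OF this ind] show ?thesis by (simp add: f_def[abs_def])
  qed
  have mean: "S.expectation (f i) = pr A" if "i \<in> J" for i
  proof -
    have "S.expectation (f i) = (\<integral>q. indicator A (fst q) \<partial>distr (samples s) Q (\<lambda>z. z i))"
      unfolding f_def[abs_def] using ind that J by (subst integral_distr) auto
    also have "distr (samples s) Q (\<lambda>z. z i) = Q"
      using that J prob_Q distr_PiM_component[of "{..<s}" "\<lambda>_. Q" i] by auto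
    also have "(\<integral>q. indicator A (fst q) \<partial>Q) = (\<integral>q. indicator {q \<in> space Q. fst q \<in> A} q \<partial>Q)"
      by (intro Bochner_Integration.integral_cong) (auto simp: indicator_def)
    also have "\<dots> = measure Q ({q \<in> space Q. fst q \<in> A} \<inter> space Q)"
      by (rule Bochner_Integration.integral_indicator)
    also have "\<dots> = pr A" unfolding pr_def by (intro arg_cong[where f = "measure Q"]) auto
    finally show ?thesis .
  qed
  have freq: "freq J (\<lambda>i. fst (z i)) A = (1 / real (card J)) *\<^sub>R (\<Sum>i\<in>J. f i z)" for z
  proof -
    have "(\<Sum>i\<in>J. f i z) = (\<Sum>i\<in>{i\<in>J. fst (z i) \<in> A}. 1)"
      unfolding f_def using fJ by (intro sum.mono_neutral_cong_right) (auto simp: indicator_def)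
    then show ?thesis by (simp add: freq_def)
  qed
  note ms = S.mean_square_average[of J f 1 "pr A", OF fJ J(2) _ fm _ mean]
  have pair: "S.indep_var borel (f i) borel (f j)" if "i \<in> J" "j \<in> J" "i \<noteq> j" for i j
    unfolding f_def using that J by (intro indep_var_coordinates[OF prob_Q _ _ _ ind ind]) auto
  show "integrable (samples s) (\<lambda>z. (freq J (\<lambda>i. fst (z i)) A - pr A)\<^sup>2)"
    using ms(2)[OF pair] by (simp add: freq f_def)
  show "(\<integral>z. (freq J (\<lambda>i. fst (z i)) A - pr A)\<^sup>2 \<partial>samples s) \<le> 4 / real (card J)"
    using ms(1)[OF pair] by (simp add: freq f_def)
qed

text \<open>The exceptional event of the bias estimate. Restricted to grid boxes it is a finite
  union, so probabilities can be summed.\<close>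

definition grid_deviation :: "nat \<Rightarrow> real \<Rightarrow> nat set \<Rightarrow> 'h sample \<Rightarrow> bool" where
  "grid_deviation N \<delta> J z \<longleftrightarrow>
     (\<exists>lo\<in>grid F N. \<exists>hi\<in>grid F N. \<bar>freq J (\<lambda>i. fst (z i)) (hbox F lo hi) - pr (hbox F lo hi)\<bar> > \<delta>)"

text \<open>Chebyshev for each pair of grid corners and a union bound. With the grid fixed the
  number of pairs does not grow, so the bound vanishes as \<open>J\<close> gets larger.\<close>

lemma prob_grid_deviation:
  assumes J: "J \<subseteq> {..<s}" "J \<noteq> {}" and \<delta>: "0 < \<delta>"
  shows "\<P>(z in samples s. grid_deviation N \<delta> J z) \<le> (real (card (grid F N)))\<^sup>2 * (4 / (real (card J) * \<delta>\<^sup>2))"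
proof -
  interpret S: prob_space "samples s" by (rule prob_samples)
  let ?f = "\<lambda>lo hi z. freq J (\<lambda>i. fst (z i)) (hbox F lo hi) - pr (hbox F lo hi)"
  let ?E = "\<lambda>lo hi. {z \<in> space (samples s). \<bar>?f lo hi z\<bar> > \<delta>}"
  have G: "finite (grid F N)" by (rule finite_grid) simp
  have one: "?E lo hi \<in> sets (samples s)" "measure (samples s) (?E lo hi) \<le> 4 / (real (card J) * \<delta>\<^sup>2)" for lo hi
  proof -
    note ms = freq_mean_square[OF J refl, of lo hi]
    have eq: "?E lo hi = {z \<in> space (samples s). \<delta>\<^sup>2 < (?f lo hi z)\<^sup>2}"
      using \<delta> abs_le_square_iff[of "?f lo hi _" \<delta>] by (auto simp: not_le[symmetric])
    have m: "(\<lambda>z. (?f lo hi z)\<^sup>2) \<in> borel_measurable (samples s)"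
      using ms(1) by (rule borel_measurable_integrable)
    show "?E lo hi \<in> sets (samples s)" unfolding eq using m by measurable
    have "measure (samples s) (?E lo hi) \<le> measure (samples s) {z \<in> space (samples s). \<delta>\<^sup>2 \<le> (?f lo hi z)\<^sup>2}"
      unfolding eq using m by (intro S.finite_measure_mono) auto
    also have "\<dots> \<le> (\<integral>z. (?f lo hi z)\<^sup>2 \<partial>samples s) / \<delta>\<^sup>2"
      using \<delta> ms(1) by (intro integral_Markov_inequality_measure[where A = "{}"]) auto
    also have "\<dots> \<le> 4 / real (card J) / \<delta>\<^sup>2"
      using ms(2) by (intro divide_right_mono) auto
    finally show "measure (samples s) (?E lo hi) \<le> 4 / (real (card J) * \<delta>\<^sup>2)" by simp
  qed
  have "{z \<in> space (samples s). grid_deviation N \<delta> J z} = (\<Union>(lo, hi)\<in>grid F N \<times> grid F N. ?E lo hi)"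
    by (auto simp: grid_deviation_def)
  then have "\<P>(z in samples s. grid_deviation N \<delta> J z) = measure (samples s) (\<Union>p\<in>grid F N \<times> grid F N. ?E (fst p) (snd p))"
    by (simp add: case_prod_unfold)
  also have "\<dots> \<le> (\<Sum>p\<in>grid F N \<times> grid F N. measure (samples s) (?E (fst p) (snd p)))"
    using G one(1) by (intro measure_UNION_le) auto
  also have "\<dots> \<le> (\<Sum>p\<in>grid F N \<times> grid F N. 4 / (real (card J) * \<delta>\<^sup>2))"
    using one(2) by (intro sum_mono) auto
  finally show ?thesis by (simp add: card_cartesian_product power2_eq_square)
qed

lemma close_on_boxes:
  assumes dev: "\<not> grid_deviation N \<delta> J z" and J: "finite J" and N: "0 < N" and valid: "valid_box F lo hi"
  shows "\<bar>freq J (\<lambda>i. fst (z i)) (hbox F lo hi) - pr (hbox F lo hi)\<bar> \<le> \<delta> + 2 * real (card F) * C / real N"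
proof (rule grid_close[where pr = pr and \<nu> = "freq J (\<lambda>i. fst (z i))", OF finite_F N _ _ pr_mono pr_subadd _ _ valid])
  show "0 \<le> C" using c_le_C by simp
  show "freq J (\<lambda>i. fst (z i)) (hbox F lo hi) \<le> freq J (\<lambda>i. fst (z i)) (hbox F lo' hi')"
    if "hbox F lo hi \<subseteq> hbox F lo' hi'" for lo hi lo' hi'
    using J that by (rule freq_mono)
  show "pr (hbox F lo hi) \<le> C * box_vol F lo hi" if "valid_box F lo hi" for lo hi
    using pr_box[OF that] by simp
  show "\<bar>freq J (\<lambda>i. fst (z i)) (hbox F lo hi) - pr (hbox F lo hi)\<bar> \<le> \<delta>"
    if "lo \<in> grid F N" "hi \<in> grid F N" for lo hi
    using dev that by (auto simp: grid_deviation_def not_less)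
qed

end

context forest_law
begin

section \<open>Honesty\<close>

lemma AE_m_bounded: "AE q in Q. norm (m (fst q)) \<le> b"
  using inputs_in_cube by eventually_elim (rule m_bounded)

lemma integrable_response: "integrable Q snd" "integrable Q (\<lambda>q. m (fst q))"
  by (auto intro!: Q.integrable_const_bound[where B = b] response_bounded AE_m_bounded)

text \<open>The regression identity is assumed for indicators of sets of inputs, but the weight of
  an observation, as a function of its own input, is only known to be bounded and measurable. Simple
  functions and dominated convergence bridge the gap, applied to the difference of response and
  regression function.\<close>

lemma regress_bounded:
  fixes \<phi> :: "input \<Rightarrow> real"
  assumes \<phi> [measurable]: "\<phi> \<in> borel_measurable (input_space F)"
    and bd: "\<And>x. x \<in> space (input_space F) \<Longrightarrow> \<bar>\<phi> x\<bar> \<le> 1"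
  shows "(\<integral>q. \<phi> (fst q) *\<^sub>R snd q \<partial>Q) = (\<integral>q. \<phi> (fst q) *\<^sub>R m (fst q) \<partial>Q)"
proof -
  let ?N = "input_space F"
  define D where "D q = snd q - m (fst q)" for q
  have D [measurable]: "D \<in> borel_measurable Q" by (simp add: D_def[abs_def])
  have intD: "integrable Q D"
    unfolding D_def[abs_def] by (intro Bochner_Integration.integrable_diff integrable_response)
  have mult: "integrable Q (\<lambda>q. f (fst q) *\<^sub>R g q)"
    if "f \<in> borel_measurable ?N" "\<And>x. x \<in> space ?N \<Longrightarrow> \<bar>f x\<bar> \<le> B" "integrable Q g" 
    for f :: "input \<Rightarrow> real" and B and g :: "_ \<Rightarrow> 'h"
  proof (rule Bochner_Integration.integrable_bound[where f = "\<lambda>q. B *\<^sub>R g q"])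
    note [measurable] = that(1) borel_measurable_integrable[OF that(3)]
    show "integrable Q (\<lambda>q. B *\<^sub>R g q)" using that(3) by simp
    show "(\<lambda>q. f (fst q) *\<^sub>R g q) \<in> borel_measurable Q" by measurable
    show "AE q in Q. norm (f (fst q) *\<^sub>R g q) \<le> norm (B *\<^sub>R g q)"
    proof (rule AE_I2)
      fix q assume "q \<in> space Q"
      then have "\<bar>f (fst q)\<bar> \<le> B"
        using that(2) by (auto simp: space_Q space_pair_measure)
      then show "norm (f (fst q) *\<^sub>R g q) \<le> norm (B *\<^sub>R g q)"
        using mult_right_mono[of "\<bar>f (fst q)\<bar>" "\<bar>B\<bar>" "norm (g q)"] by simp
    qed
  qed
  have ind0: "(\<integral>q. indicator A (fst q) *\<^sub>R D q \<partial>Q) = 0" if A: "A \<in> sets ?N" for A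
  proof -
    have 1: "integrable Q (\<lambda>q. (indicator A (fst q) :: real) *\<^sub>R snd q)"
      "integrable Q (\<lambda>q. (indicator A (fst q) :: real) *\<^sub>R m (fst q))"
      using A by (auto intro!: mult[of _ 1] integrable_response simp: indicator_def)
    show ?thesis
      unfolding D_def scaleR_diff_right using 1 regress[OF A] by simp
  qed
  \<comment> \<open>The approximating simple functions are at most twice as large as
    \<open>\<phi>\<close>, hence bounded by 2, which gives the dominating function
    \<open>2 * norm (D q)\<close>.\<close>
  obtain f where f: "\<And>i. simple_function ?N (f i)"
    "\<And>x. x \<in> space ?N \<Longrightarrow> (\<lambda>i. f i x) \<longlonglongrightarrow> \<phi> x"
    "\<And>i x. x \<in> space ?N \<Longrightarrow> dist (f i x) 0 \<le> 2 * dist (\<phi> x) 0"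
    using borel_measurable_implies_sequence_metric[OF \<phi>, of 0] by blast
  have f2: "\<bar>f i x\<bar> \<le> 2" if "x \<in> space ?N" for i x
    using f(3)[OF that, of i] bd[OF that] by simp
  have fm [measurable]: "f i \<in> borel_measurable ?N" for i
    using f(1) by (rule borel_measurable_simple_function)
  have f0: "(\<integral>q. f i (fst q) *\<^sub>R D q \<partial>Q) = 0" for i
  proof -
    have fin: "finite (f i ` space ?N)" using f(1) by (rule simple_functionD(1))
    have S: "f i -` {y} \<inter> space ?N \<in> sets ?N" for y using f(1) by (rule simple_functionD(2))
    have ii: "integrable Q (\<lambda>q. (indicator (f i -` {y} \<inter> space ?N) (fst q) :: real) *\<^sub>R D q)" for y
      using S intD by (intro mult[of _ 1]) (auto simp: indicator_def)
    have "(\<integral>q. f i (fst q) *\<^sub>R D q \<partial>Q) =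
        (\<integral>q. (\<Sum>y\<in>f i ` space ?N. y *\<^sub>R (indicator (f i -` {y} \<inter> space ?N) (fst q) *\<^sub>R D q)) \<partial>Q)"
    proof (intro Bochner_Integration.integral_cong refl)
      fix q assume "q \<in> space Q"
      then have q: "fst q \<in> space ?N" by (auto simp: space_Q space_pair_measure)
      have "f i (fst q) = (\<Sum>y\<in>f i ` space ?N. indicator (f i -` {y} \<inter> space ?N) (fst q) *\<^sub>R y)"
        by (rule simple_function_indicator_representation_banach[OF f(1) q])
      then show "f i (fst q) *\<^sub>R D q =
          (\<Sum>y\<in>f i ` space ?N. y *\<^sub>R (indicator (f i -` {y} \<inter> space ?N) (fst q) *\<^sub>R D q))"
        by (subst \<open>f i (fst q) = _\<close>)
          (simp only: scaleR_sum_left scaleR_scaleR real_scaleR_def mult.commute)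
    qed
    also have "\<dots> = (\<Sum>y\<in>f i ` space ?N. y *\<^sub>R (\<integral>q. indicator (f i -` {y} \<inter> space ?N) (fst q) *\<^sub>R D q \<partial>Q))"
      by (subst Bochner_Integration.integral_sum)
        (intro integrable_scaleR_right ii, simp only: Bochner_Integration.integral_scaleR_right)
    also have "\<dots> = 0" using ind0[OF S] by simp
    finally show ?thesis .
  qed
  have "(\<lambda>i. \<integral>q. f i (fst q) *\<^sub>R D q \<partial>Q) \<longlonglongrightarrow> (\<integral>q. \<phi> (fst q) *\<^sub>R D q \<partial>Q)"
  proof (rule integral_dominated_convergence[where w = "\<lambda>q. 2 * norm (D q)"])
    show "AE q in Q. (\<lambda>i. f i (fst q) *\<^sub>R D q) \<longlonglongrightarrow> \<phi> (fst q) *\<^sub>R D q"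
      using f(2) by (intro AE_I2 tendsto_intros) (auto simp: space_Q space_pair_measure)
    show "AE q in Q. norm (f i (fst q) *\<^sub>R D q) \<le> 2 * norm (D q)" for i
      using f2 by (intro AE_I2) (auto simp: space_Q space_pair_measure intro!: mult_right_mono)
  qed (use intD in auto)
  then have "(\<integral>q. \<phi> (fst q) *\<^sub>R D q \<partial>Q) = 0"
    unfolding f0 using LIMSEQ_unique tendsto_const by blast
  moreover have "integrable Q (\<lambda>q. \<phi> (fst q) *\<^sub>R snd q)" "integrable Q (\<lambda>q. \<phi> (fst q) *\<^sub>R m (fst q))"
    using bd by (auto intro!: mult[of _ 1] integrable_response)
  ultimately show ?thesis
    by (simp add: D_def scaleR_diff_right)
qed

text \<open>Used for two samples that differ only in the response of a point populating the leaves,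
  to which an honest tree is blind.\<close>

lemma leaf_weight_cong:
  assumes hon: "honest F s P" and e: "e \<in> space (rand P)"
    and z: "z \<in> space (sample_space F s)" "z' \<in> space (sample_space F s)"
    and eq: "\<And>i. i < s \<Longrightarrow> fst (z i) = fst (z' i)" "\<And>i. i \<in> split_half P e \<Longrightarrow> snd (z i) = snd (z' i)"
    and i: "i < s"
  shows "leaf_weight P s x e z i = leaf_weight P s x e z' i"
proof -
  have grow: "grow P e z = grow P e z'"
    using hon e z eq unfolding honest_def by blast
  have "{j \<in> leaf_half P s e. fst (z j) \<in> A} = {j \<in> leaf_half P s e. fst (z' j) \<in> A}" for A
    using eq(1) by (auto simp: leaf_half_def)
  then show ?thesis
    using grow eq(1)[OF i] by (simp add: leaf_weight_def cell_count_def)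
qed

lemma integrable_leaf_weight:
  fixes g :: "input \<times> 'h \<Rightarrow> 'h"
  assumes wf: "well_formed_procedure F s P" and e: "e \<in> space (rand P)"
    and x: "x \<in> space (input_space F)" and i: "i < s"
    and g [measurable]: "g \<in> borel_measurable Q" and bd: "AE q in Q. norm (g q) \<le> b"
  shows "integrable (samples s) (\<lambda>z. leaf_weight P s x e z i *\<^sub>R g (z i))"
proof -
  interpret S: prob_space "samples s" by (rule prob_samples)
  have w [measurable]: "(\<lambda>z. leaf_weight P s x e z i) \<in> borel_measurable (samples s)"
    by (rule measurable_leaf_weight[OF wf _ _ measurable_id_samples]) (use x e in auto)
  have comp [measurable]: "(\<lambda>z. z i) \<in> measurable (samples s) Q"
    using i by (intro measurable_component_singleton) auto
  show ?thesis
  proof (rule S.integrable_const_bound[where B = b])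
    show "AE z in samples s. norm (leaf_weight P s x e z i *\<^sub>R g (z i)) \<le> b"
      using AE_samples[OF bd, of s]
    proof eventually_elim
      case (elim z)
      have "norm (leaf_weight P s x e z i *\<^sub>R g (z i)) \<le> 1 * norm (g (z i))"
        using leaf_weight_le[of P s x e z i] by (auto intro!: mult_left_le_one_le)
      also have "\<dots> \<le> b" using elim i by simp
      finally show ?case .
    qed
  qed measurable
qed

text \<open>With the randomization fixed, it is known whether \<open>i\<close> populates the leaves.
  If so, freeze all other observations: the weight becomes a function of the input of observation
  \<open>i\<close> alone, and integrating over this observation replaces the response by its
  conditional mean.\<close>

lemma honest_expectation:
  assumes wf: "well_formed_procedure F s P" and hon: "honest F s P"
    and e: "e \<in> space (rand P)" and x: "x \<in> space (input_space F)" and i: "i < s"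
  shows "(\<integral>z. leaf_weight P s x e z i *\<^sub>R snd (z i) \<partial>samples s) =
         (\<integral>z. leaf_weight P s x e z i *\<^sub>R m (fst (z i)) \<partial>samples s)"
proof (cases "i \<in> leaf_half P s e")
  case False
  then show ?thesis by (simp add: leaf_weight_def)
next
  case True
  then have i_split: "i \<notin> split_half P e" by (simp add: leaf_half_def)
  interpret prod: product_prob_space "\<lambda>_. Q" by unfold_locales
  interpret fin: finite_product_sigma_finite "\<lambda>_. Q" "{..<s} - {i}" by unfold_locales auto
  interpret S: prob_space "samples s" by (rule prob_samples)
  let ?I = "{..<s} - {i}"
  let ?w = "\<lambda>z. leaf_weight P s x e z i"
  have ins: "insert i ?I = {..<s}" using i by auto
  have idm [measurable]: "(\<lambda>z. z) \<in> measurable (samples s) (sample_space F s)" by (rule measurable_id_samples)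
  have w [measurable]: "?w \<in> borel_measurable (samples s)"
    by (rule measurable_leaf_weight[OF wf _ _ idm]) (use x e in auto)
  have inner: "(\<integral>q. ?w (y(i := q)) *\<^sub>R snd q \<partial>Q) = (\<integral>q. ?w (y(i := q)) *\<^sub>R m (fst q) \<partial>Q)"
    if y: "y \<in> space (PiM ?I (\<lambda>_. Q))" for y
  proof -
    \<comment> \<open>The response is filled in with 0; by honesty any other value would give the
      same weight.\<close>
    define \<phi> where "\<phi> u = ?w (y(i := (u, 0)))" for u
    have upd: "y(i := q) \<in> space (sample_space F s)" if "q \<in> space Q" for q
    proof -
      have "y(i := q) \<in> space (samples s)"
        using y that i by (auto simp: space_PiM PiE_iff extensional_def)
      then show ?thesis by (simp add: space_samples)
    qed
    have w_\<phi>: "?w (y(i := q)) = \<phi> (fst q)" if q: "q \<in> space Q" for q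
      unfolding \<phi>_def
    proof (rule leaf_weight_cong[OF hon e upd[OF q] upd])
      show "(fst q, 0) \<in> space Q" using q by (auto simp: space_Q space_pair_measure)
    qed (use i i_split in auto)
    have \<phi>_meas: "\<phi> \<in> borel_measurable (input_space F)"
    proof -
      have "(\<lambda>u. y(i := (u, 0))) \<in> measurable (input_space F) (PiM (insert i ?I) (\<lambda>_. Q))"
      proof (rule measurable_fun_upd[where J = ?I])
        show "insert i ?I = ?I \<union> {i}" by auto
        show "(\<lambda>u. y) \<in> measurable (input_space F) (PiM ?I (\<lambda>_. Q))" using y by simp
        show "(\<lambda>u. (u, 0)) \<in> measurable (input_space F) Q"
          using sets_Q by (simp cong: measurable_cong_sets)
      qed
      then have "(\<lambda>u. y(i := (u, 0))) \<in> measurable (input_space F) (samples s)" by (simp only: ins)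
      from measurable_compose[OF this w] show ?thesis by (simp add: \<phi>_def[abs_def])
    qed
    have \<phi>_bd: "\<bar>\<phi> u\<bar> \<le> 1" for u
      unfolding \<phi>_def using leaf_weight_le[of P s x e _ i] by (simp add: abs_of_nonneg)
    have "(\<integral>q. ?w (y(i := q)) *\<^sub>R snd q \<partial>Q) = (\<integral>q. \<phi> (fst q) *\<^sub>R snd q \<partial>Q)"
      using w_\<phi> by (intro Bochner_Integration.integral_cong) auto
    also have "\<dots> = (\<integral>q. \<phi> (fst q) *\<^sub>R m (fst q) \<partial>Q)"
      using \<phi>_meas \<phi>_bd by (rule regress_bounded)
    also have "\<dots> = (\<integral>q. ?w (y(i := q)) *\<^sub>R m (fst q) \<partial>Q)"
      using w_\<phi> by (intro Bochner_Integration.integral_cong) auto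
    finally show ?thesis .
  qed
  have split: "(\<integral>z. ?w z *\<^sub>R g (z i) \<partial>samples s) = (\<integral>y. (\<integral>q. ?w (y(i := q)) *\<^sub>R g q \<partial>Q) \<partial>PiM ?I (\<lambda>_. Q))"
    if "g \<in> borel_measurable Q" "AE q in Q. norm (g q) \<le> b" for g :: "_ \<Rightarrow> 'h"
    using prod.product_integral_insert[of ?I i "\<lambda>z. ?w z *\<^sub>R g (z i)"] integrable_leaf_weight[OF wf e x i that] unfolding ins by simp
  have m_fst: "(\<lambda>q. m (fst q)) \<in> borel_measurable Q" by measurable
  show ?thesis
    unfolding split[OF measurable_snd_Q response_bounded] split[OF m_fst AE_m_bounded]
    by (intro Bochner_Integration.integral_cong refl inner)
qed

end

context forest_law
begin

section \<open>Bias of a tree\<close>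

lemma space_input_cube: "x \<in> cube F \<Longrightarrow> x \<in> space (input_space F)"
  by (auto simp: hbox_iff space_PiM PiE_iff)

lemma tree_features_empty: "tree_features T \<subseteq> {} \<Longrightarrow> T = Leaf"
  by (cases T) auto

text \<open>Deterministic once ties and grid deviations are excluded: the path of \<open>x\<close>
  then follows \<open>K\<close> contracting splits, and the cell at its end contains the leaf, hence
  every input with positive weight. The weights sum to 1, so the Lipschitz bound passes to their
  average.\<close>

lemma leaf_average_error:
  fixes P :: "('e, 'h) tree_procedure"
  assumes wf: "well_formed_procedure F s P" and reg: "regular \<alpha> \<kappa> F s P"
    and e: "e \<in> space (rand P)" and z: "z \<in> tie_free_samples F s"
    and data: "\<And>i. i < s \<Longrightarrow> fst (z i) \<in> cube F" and x: "x \<in> cube F"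
    and const: "0 < \<alpha>" "\<alpha> \<le> 1" "1 \<le> \<kappa>" "\<kappa> \<le> card (leaf_half P s e)" "0 < N"
    and dev: "\<not> grid_deviation N \<delta> (leaf_half P s e) z"
    and \<delta>: "4 * (\<delta> + 2 * real (card F) * C / real N) \<le> \<alpha> * \<alpha> ^ K"
    and big: "real (2 * \<kappa> - 1) < \<alpha> ^ K * real (card (leaf_half P s e))"
    and \<gamma>: "\<gamma> = \<alpha> * c / (2 * C)" and \<gamma>1: "\<gamma> \<le> 1"
  shows "norm ((\<Sum>i<s. leaf_weight P s x e z i *\<^sub>R m (fst (z i))) - m x)
    \<le> L * (\<Sum>l\<in>F. path_shrinkage (1 - \<gamma>) K l (grow P e z) x)"
proof -
  define J where "J = leaf_half P s e"
  define T where "T = grow P e z"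
  let ?\<xi> = "\<lambda>i. fst (z i)"
  let ?A = "leaf_cell T x"
  have J: "finite J" "0 < card J" "\<And>i. i \<in> J \<Longrightarrow> i < s" using const by (auto simp: J_def leaf_half_def)
  have zs: "z \<in> space (sample_space F s)" using z by (simp add: tie_free_samples_def)
  have feat: "tree_features T \<subseteq> F"
    using wf e zs unfolding well_formed_procedure_def T_def by blast
  have cc: "real (cell_count P s e z A) = freq J ?\<xi> A * real (card J)" for A
    using J(2) by (simp add: cell_count_def freq_def J_def)
  note reg' = reg[unfolded regular_def, rule_format, OF e z]
  have split: "\<alpha> * freq J ?\<xi> A' \<le> freq J ?\<xi> (A' \<inter> {u. u l \<le> t}) \<and> \<alpha> * freq J ?\<xi> A' \<le> freq J ?\<xi> (A' \<inter> {u. u l > t})"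
    if "(A', Split l t L R) \<in> nodes UNIV T" for A' l t L R
  proof -
    have "\<alpha> * real (cell_count P s e z A') \<le> real (cell_count P s e z (A' \<inter> {u. u l \<le> t}))"
      "\<alpha> * real (cell_count P s e z A') \<le> real (cell_count P s e z (A' \<inter> {u. u l > t}))"
      using reg' that unfolding T_def by blast+
    then show ?thesis using J(2) by (simp add: cc mult.assoc[symmetric])
  qed
  have leaf: "\<kappa> \<le> cell_count P s e z A \<and> cell_count P s e z A \<le> 2 * \<kappa> - 1"
    if "(A, Leaf) \<in> nodes UNIV T" "F \<noteq> {}" for A
    using reg' that const(4) unfolding T_def by blast
  have leaf_x: "(?A, Leaf) \<in> nodes UNIV T" using leaf_cell_in_nodes[of UNIV T x] by simp
  have pos: "cell_count P s e z ?A > 0"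
  \<comment> \<open>Without features, as happens when the only input is removed, there are no
    splits: the leaf is the whole space. Its size is then not constrained by \<open>regular\<close>,
    but the leaf half is nonempty.\<close>
  proof (cases "F = {}")
    case True
    then have "T = Leaf" using feat tree_features_empty by simp
    then show ?thesis using J(2) by (simp add: cell_count_def J_def)
  next
    case False
    then show ?thesis using leaf[OF leaf_x] const(3) by simp
  qed
  have coord: "\<bar>u l - x l\<bar> \<le> path_shrinkage (1 - \<gamma>) K l T x"
    if l: "l \<in> F" and u: "u \<in> cube F" "u \<in> ?A" for l u
  proof -
    have "\<exists>a. length a = K \<and> reaches T a x \<and> (\<forall>l\<in>F. \<forall>u\<in>cube F \<inter> leaf_cell T x.
        \<bar>u l - x l\<bar> \<le> (1 - \<gamma>) ^ nsplits l T a * (1 - 0))"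
    \<comment> \<open>At the root the cell is everything, its box is the cube, and its frequency 1
      is \<open>\<alpha> ^ (K - K)\<close>.\<close>
    proof (rule regular_split_path[where A = UNIV and J = J and \<xi> = ?\<xi> and K = K and c = c and C = C and pr = pr
          and B = "real (2 * \<kappa> - 1) / real (card J)"])
      show "finite F" "finite J" "0 < \<alpha>" "\<alpha> \<le> 1" "0 < c" "0 < C" "K \<le> K" "valid_box F (\<lambda>_. 0) (\<lambda>_. 1)"
        "UNIV \<inter> cube F = cube F" "x \<in> cube F" "tree_features T \<subseteq> F" "\<gamma> = \<alpha> * c / (2 * C)"
        using J const c_pos c_le_C feat x \<gamma> by auto
      show "?\<xi> i \<in> cube F" if "i \<in> J" for i using data J that by simp
      show "c * box_vol F lo hi \<le> pr (hbox F lo hi) \<and> pr (hbox F lo hi) \<le> C * box_vol F lo hi"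
        if "valid_box F lo hi" for lo hi using pr_box[OF that] .
      show "\<bar>freq J ?\<xi> (hbox F lo hi) - pr (hbox F lo hi)\<bar> \<le> \<delta> + 2 * real (card F) * C / real N"
        if "valid_box F lo hi" for lo hi
        using close_on_boxes[OF dev _ const(5) that] by (simp add: J_def)
      show "4 * (\<delta> + 2 * real (card F) * C / real N) \<le> \<alpha> * \<alpha> ^ K" by (rule \<delta>)
      show "real (2 * \<kappa> - 1) / real (card J) < \<alpha> ^ K"
        using big J(2) by (simp add: J_def[symmetric] divide_less_eq)
      show "\<alpha> ^ (K - K) \<le> freq J ?\<xi> UNIV" using J(2) by (simp add: freq_def)
      \<comment> \<open>The bound on leaf sizes requires a feature to split on; \<open>l\<close> is
        one.\<close>
      show "freq J ?\<xi> A' \<le> real (2 * \<kappa> - 1) / real (card J)" if "(A', Leaf) \<in> nodes UNIV T" for A'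
      proof -
        have "real (cell_count P s e z A') \<le> real (2 * \<kappa> - 1)"
          using leaf[OF that] l by (intro of_nat_mono) auto
        then show ?thesis using J(2) unfolding cc by (simp add: pos_le_divide_eq)
      qed
    qed (rule split)
    then obtain a where a: "length a = K" "reaches T a x" "\<bar>u l - x l\<bar> \<le> (1 - \<gamma>) ^ nsplits l T a"
      using l u by auto
    then show ?thesis using path_shrinkage_ge[of "1 - \<gamma>" T a x l] \<gamma>1 by simp
  qed
  let ?E = "L * (\<Sum>l\<in>F. path_shrinkage (1 - \<gamma>) K l T x)"
  let ?w = "\<lambda>i. leaf_weight P s x e z i"
  have w1: "(\<Sum>i<s. ?w i) = 1" using pos unfolding T_def by (rule sum_leaf_weight_eq_1)
  have "(\<Sum>i<s. ?w i *\<^sub>R m (?\<xi> i)) - m x = (\<Sum>i<s. ?w i *\<^sub>R (m (?\<xi> i) - m x))"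
    by (simp add: scaleR_diff_right sum_subtractf scaleR_sum_left[symmetric] w1)
  also have "norm \<dots> \<le> (\<Sum>i<s. ?w i * ?E)"
  proof (rule sum_norm_le)
    fix i assume i: "i \<in> {..<s}"
    show "norm (?w i *\<^sub>R (m (?\<xi> i) - m x)) \<le> ?w i * ?E"
    proof (cases "?\<xi> i \<in> ?A")
      case True
      have "norm (m (?\<xi> i) - m x) \<le> L * (\<Sum>l\<in>F. \<bar>?\<xi> i l - x l\<bar>)"
        using data i x by (intro m_lipschitz) auto
      also have "\<dots> \<le> ?E"
        using data i True L_nonneg by (intro mult_left_mono sum_mono coord) auto
      finally show ?thesis by (simp add: mult_left_mono)
    next
      case False
      then show ?thesis by (simp add: leaf_weight_def T_def)
    qed
  qed
  also have "\<dots> = ?E" by (simp add: sum_distrib_right[symmetric] w1)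
  finally show ?thesis by (simp add: T_def)
qed

lemma pred_grid_deviation:
  assumes wf: "well_formed_procedure F s P"
    and f: "f \<in> measurable N (rand P)" and g: "g \<in> measurable N (sample_space F s)"
  shows "Measurable.pred N (\<lambda>w. grid_deviation n \<delta> (leaf_half P s (f w)) (g w))"
proof -
  have [measurable]: "Measurable.pred N (\<lambda>w. i \<in> split_half P (f w))" for i
    by (rule pred_split_half[OF wf f])
  have in_box: "Measurable.pred N (\<lambda>w. fst (g w i) \<in> hbox F lo hi)" if "i < s" for i lo hi
  proof -
    have [measurable]: "(\<lambda>w. fst (g w i)) \<in> measurable N (input_space F)"
      using measurable_compose[OF measurable_sample[OF g that] measurable_fst] .
    have [measurable]: "hbox F lo hi \<in> sets (input_space F)" by simp
    show ?thesis by measurable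
  qed
  have num: "(\<lambda>w. \<Sum>i<s. of_bool (i \<notin> split_half P (f w) \<and> fst (g w i) \<in> hbox F lo hi) :: real) \<in> borel_measurable N"
    for lo hi
  proof (intro borel_measurable_sum)
    fix i assume "i \<in> {..<s}"
    then have [measurable]: "Measurable.pred N (\<lambda>w. fst (g w i) \<in> hbox F lo hi)" using in_box by simp
    show "(\<lambda>w. of_bool (i \<notin> split_half P (f w) \<and> fst (g w i) \<in> hbox F lo hi) :: real) \<in> borel_measurable N"
      by measurable
  qed
  have den [measurable]: "(\<lambda>w. \<Sum>i<s. of_bool (i \<notin> split_half P (f w)) :: real) \<in> borel_measurable N"
    by measurable
  have card: "real (card {i \<in> leaf_half P s e. Q' i}) = (\<Sum>i<s. of_bool (i \<notin> split_half P e \<and> Q' i))" for e Q'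
  proof -
    have "(\<Sum>i<s. of_bool (i \<notin> split_half P e \<and> Q' i)) = (\<Sum>i\<in>{i \<in> leaf_half P s e. Q' i}. 1 :: real)"
      by (intro sum.mono_neutral_cong_right) (auto simp: leaf_half_def)
    then show ?thesis by simp
  qed
  have freq: "freq (leaf_half P s e) (\<lambda>i. fst (z i)) A =
      (\<Sum>i<s. of_bool (i \<notin> split_half P e \<and> fst (z i) \<in> A)) / (\<Sum>i<s. of_bool (i \<notin> split_half P e))" for e z A
    unfolding freq_def card using card[of e "\<lambda>_. True"] by (simp only: simp_thms Collect_mem_eq)
  have meas: "(\<lambda>w. \<bar>freq (leaf_half P s (f w)) (\<lambda>i. fst (g w i)) (hbox F lo hi) - pr (hbox F lo hi)\<bar>) \<in> borel_measurable N" for lo hi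
    unfolding freq by (intro borel_measurable_abs borel_measurable_diff borel_measurable_divide num den borel_measurable_const)
  show ?thesis
    unfolding grid_deviation_def
    by (intro pred_intros_finite(4) finite_grid finite_F borel_measurable_pred_less borel_measurable_const meas)
qed


lemma path_shrinkage_bounded:
  assumes "0 \<le> r" "r \<le> 1"
  shows "\<bar>path_shrinkage r K l T x\<bar> \<le> real (card {a :: bool list. length a = K})"
proof -
  have "\<bar>path_shrinkage r K l T x\<bar> \<le>
      (\<Sum>a | length a = K. \<bar>of_bool (reaches T a x) * r ^ nsplits l T a\<bar>)"
    unfolding path_shrinkage_def by (rule sum_abs)
  also have "\<dots> \<le> (\<Sum>a :: bool list | length a = K. 1)"
    using assms by (intro sum_mono) (simp add: abs_mult power_le_one)
  finally show ?thesis by simp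
qed

text \<open>The tree output \<open>T\<close> is replaced by the average \<open>U\<close> of
  regression values, with the sample integrated out for a fixed randomization. The error of
  \<open>U\<close> is bounded by the path shrinkage outside the exceptional event and by
  \<open>2 * b\<close> on it. The shrinkage is then estimated in the other order of
  integration.\<close>

lemma bias_bound:
  fixes P :: "('e, 'h) tree_procedure"
  assumes wf: "well_formed_procedure F s P" and hon: "honest F s P" and rs: "random_split \<pi> F s P"
    and reg: "regular \<alpha> \<kappa> F s P"
    and const: "0 < \<alpha>" "\<alpha> \<le> 1" "1 \<le> \<kappa>" "\<kappa> \<le> s div 2" "0 < N" "0 < \<delta>"
    and \<delta>: "4 * (\<delta> + 2 * real (card F) * C / real N) \<le> \<alpha> * \<alpha> ^ K"
    and big: "real (2 * \<kappa> - 1) < \<alpha> ^ K * real (s div 2)"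
    and \<gamma>: "\<gamma> = \<alpha> * c / (2 * C)"
    and q: "F \<noteq> {} \<Longrightarrow> q \<le> \<pi> / real (card F)" "0 \<le> q" "q \<le> 1"
    and x: "x \<in> cube F"
  shows "norm ((\<integral>z. (\<integral>e. tree_output P s x e z \<partial>rand P) \<partial>samples s) - m x)
    \<le> L * (real (card F) * (1 - \<gamma> * q) ^ K)
      + 2 * b * ((real (card (grid F N)))\<^sup>2 * (4 / (real (s div 2) * \<delta>\<^sup>2)))"
proof -
  interpret R: prob_space "rand P" by (rule well_formed_prob_space[OF wf])
  interpret S: prob_space "samples s" by (rule prob_samples)
  interpret PS: pair_prob_space "rand P" "samples s" ..
  let ?PM = "rand P \<Otimes>\<^sub>M samples s"
  have \<gamma>01: "0 \<le> \<gamma>" "\<gamma> \<le> 1"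
    using const(1,2) c_pos c_le_C mult_mono[of \<alpha> 1 c C] by (auto simp: \<gamma> divide_le_eq)
  have xs: "x \<in> space (input_space F)" by (rule space_input_cube[OF x])
  \<comment> \<open>For odd \<open>s\<close> the halves differ by one point; \<open>s div 2\<close>
    is the size of the smaller one.\<close>
  have leaf_half: "s div 2 \<le> card (leaf_half P s e)" "leaf_half P s e \<subseteq> {..<s}" if "e \<in> space (rand P)" for e
  proof -
    have sub: "split_half P e \<subseteq> {..<s}" and "card (split_half P e) \<in> {s div 2, s - s div 2}"
      using hon that unfolding honest_def by blast+
    moreover have "card (leaf_half P s e) = s - card (split_half P e)"
      unfolding leaf_half_def using sub finite_subset by (subst card_Diff_subset) auto
    ultimately show "s div 2 \<le> card (leaf_half P s e)" by auto
    show "leaf_half P s e \<subseteq> {..<s}" by (auto simp: leaf_half_def)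
  qed
  define T where "T e z = tree_output P s x e z" for e z
  define U where "U e z = (\<Sum>i<s. leaf_weight P s x e z i *\<^sub>R m (fst (z i)))" for e z
  define Bd where "Bd e z \<longleftrightarrow> grid_deviation N \<delta> (leaf_half P s e) z" for e z
  define sh where "sh l e z = path_shrinkage (1 - \<gamma>) K l (grow P e z) x" for l e z
  have f: "fst \<in> measurable ?PM (rand P)" by simp
  have g: "snd \<in> measurable ?PM (sample_space F s)"
    using measurable_compose[OF measurable_snd measurable_id_samples] .
  have cx: "(\<lambda>_. x) \<in> measurable ?PM (input_space F)" using xs by simp
  have mT: "(\<lambda>p. T (fst p) (snd p)) \<in> borel_measurable ?PM"
    unfolding T_def by (rule measurable_tree_output[OF wf cx f g])
  have mU: "(\<lambda>p. U (fst p) (snd p)) \<in> borel_measurable ?PM"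
    unfolding U_def
  proof (intro borel_measurable_sum borel_measurable_scaleR)
    fix i assume "i \<in> {..<s}"
    then show "(\<lambda>p. m (fst (snd p i))) \<in> borel_measurable ?PM"
      using measurable_compose[OF measurable_compose[OF measurable_sample[OF g] measurable_fst] m_measurable] by simp
  qed (rule measurable_leaf_weight[OF wf cx f g])
  have mB: "Measurable.pred ?PM (\<lambda>p. Bd (fst p) (snd p))"
    unfolding Bd_def by (rule pred_grid_deviation[OF wf f g])
  have msh: "(\<lambda>p. sh l (fst p) (snd p)) \<in> borel_measurable ?PM" for l
    unfolding sh_def by (rule measurable_path_shrinkage[OF measurable_grow[OF wf f g] cx])
  define good where "good z \<longleftrightarrow> z \<in> tie_free_samples F s \<and> (\<forall>i<s. fst (z i) \<in> cube F) \<and> (\<forall>i<s. norm (snd (z i)) \<le> b)" for z :: "'h sample"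
  have good: "AE z in samples s. good z"
    using AE_tie_free[of s] AE_samples[OF inputs_in_cube, of s] AE_samples[OF response_bounded, of s]
    by eventually_elim (auto simp: good_def)
  have goodP: "AE p in ?PM. good (snd p)"
    by (rule AE_pair_snd[OF S.sigma_finite_measure_axioms good])
  have bT: "AE p in ?PM. norm (T (fst p) (snd p)) \<le> b"
    using goodP by eventually_elim (auto simp: T_def tree_output_eq good_def intro!: norm_leaf_average_le b_nonneg)
  have bU: "AE p in ?PM. norm (U (fst p) (snd p)) \<le> b"
    using goodP by eventually_elim (auto simp: U_def good_def intro!: norm_leaf_average_le b_nonneg m_bounded)
  have iT: "integrable ?PM (\<lambda>p. T (fst p) (snd p))" and iU: "integrable ?PM (\<lambda>p. U (fst p) (snd p))"
    using PS.P.integrable_const_bound[OF bT mT] PS.P.integrable_const_bound[OF bU mU] by auto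
  have ish: "integrable ?PM (\<lambda>p. sh l (fst p) (snd p))" for l
    using path_shrinkage_bounded[of "1 - \<gamma>" K l _ x] \<gamma>01
    by (intro PS.P.integrable_const_bound[OF _ msh, where B = "real (card {a :: bool list. length a = K})"])
      (auto simp: sh_def)
  have iB: "integrable ?PM (\<lambda>p. of_bool (Bd (fst p) (snd p)) :: real)"
  proof (rule PS.P.integrable_const_bound[where B = 1])
    show "(\<lambda>p. of_bool (Bd (fst p) (snd p)) :: real) \<in> borel_measurable ?PM"
      using mB by measurable
  qed simp
  have eq: "(\<integral>z. T e z \<partial>samples s) = (\<integral>z. U e z \<partial>samples s)" if e: "e \<in> space (rand P)" for e
  proof -
    have m_fst: "(\<lambda>q. m (fst q)) \<in> borel_measurable Q" by measurable
    have "(\<integral>z. T e z \<partial>samples s) = (\<Sum>i<s. \<integral>z. leaf_weight P s x e z i *\<^sub>R snd (z i) \<partial>samples s)"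
      unfolding T_def tree_output_eq
      by (intro Bochner_Integration.integral_sum integrable_leaf_weight[OF wf e xs _ measurable_snd_Q response_bounded]) auto
    also have "\<dots> = (\<Sum>i<s. \<integral>z. leaf_weight P s x e z i *\<^sub>R m (fst (z i)) \<partial>samples s)"
      by (intro sum.cong refl honest_expectation[OF wf hon e xs]) auto
    also have "\<dots> = (\<integral>z. U e z \<partial>samples s)"
      unfolding U_def
      by (intro Bochner_Integration.integral_sum[symmetric] integrable_leaf_weight[OF wf e xs _ m_fst AE_m_bounded]) auto
    finally show ?thesis .
  qed
  have "(\<integral>z. (\<integral>e. T e z \<partial>rand P) \<partial>samples s) = (\<integral>e. (\<integral>z. T e z \<partial>samples s) \<partial>rand P)"
    using PS.Fubini_integral[of T] iT by (simp add: case_prod_unfold)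
  also have "\<dots> = (\<integral>e. (\<integral>z. U e z \<partial>samples s) \<partial>rand P)"
    by (intro Bochner_Integration.integral_cong refl eq)
  also have "\<dots> = (\<integral>p. U (fst p) (snd p) \<partial>?PM)"
    using PS.integral_fst'[OF iU] by simp
  finally have "(\<integral>z. (\<integral>e. T e z \<partial>rand P) \<partial>samples s) - m x = (\<integral>p. U (fst p) (snd p) - m x \<partial>?PM)"
    using iU by (simp add: PS.P.prob_space)
  also have "norm \<dots> \<le> (\<integral>p. norm (U (fst p) (snd p) - m x) \<partial>?PM)" by (rule integral_norm_bound)
  also have "\<dots> \<le> (\<integral>p. L * (\<Sum>l\<in>F. sh l (fst p) (snd p)) + 2 * b * of_bool (Bd (fst p) (snd p)) \<partial>?PM)"
  proof (rule integral_mono_AE)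
    show "integrable ?PM (\<lambda>p. norm (U (fst p) (snd p) - m x))" using iU by simp
    show "integrable ?PM (\<lambda>p. L * (\<Sum>l\<in>F. sh l (fst p) (snd p)) + 2 * b * of_bool (Bd (fst p) (snd p)))"
      using ish iB by (intro Bochner_Integration.integrable_add Bochner_Integration.integrable_mult_right
        Bochner_Integration.integrable_sum) auto
    show "AE p in ?PM. norm (U (fst p) (snd p) - m x) \<le>
        L * (\<Sum>l\<in>F. sh l (fst p) (snd p)) + 2 * b * of_bool (Bd (fst p) (snd p))"
      using goodP bU AE_space
    proof eventually_elim
      case (elim p)
      have e: "fst p \<in> space (rand P)" using elim(3) by (auto simp: space_pair_measure)
      note lh = leaf_half[OF e]
      have sh0: "0 \<le> L * (\<Sum>l\<in>F. sh l (fst p) (snd p))"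
        using L_nonneg \<gamma>01 unfolding sh_def path_shrinkage_def by (intro mult_nonneg_nonneg sum_nonneg) auto
      show ?case
      proof (cases "Bd (fst p) (snd p)")
        case True
        have "norm (U (fst p) (snd p) - m x) \<le> norm (U (fst p) (snd p)) + norm (m x)" by (rule norm_triangle_ineq4)
        then show ?thesis using True elim(2) m_bounded[OF x] sh0 by simp
      next
        case False
        have "norm (U (fst p) (snd p) - m x) \<le> L * (\<Sum>l\<in>F. sh l (fst p) (snd p))"
          unfolding U_def sh_def
        proof (rule leaf_average_error[OF wf reg e _ _ x const(1-3) _ const(5) _ \<delta> _ \<gamma> \<gamma>01(2)])
          show "\<kappa> \<le> card (leaf_half P s (fst p))" using lh const(4) by simp
          show "\<not> grid_deviation N \<delta> (leaf_half P s (fst p)) (snd p)" using False by (simp add: Bd_def)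
          have "\<alpha> ^ K * real (s div 2) \<le> \<alpha> ^ K * real (card (leaf_half P s (fst p)))"
            using lh const(1) by (intro mult_left_mono) auto
          then show "real (2 * \<kappa> - 1) < \<alpha> ^ K * real (card (leaf_half P s (fst p)))" using big by linarith
        qed (use elim(1) in \<open>auto simp: good_def\<close>)
        then show ?thesis using False by simp
      qed
    qed
  qed
  also have "\<dots> = L * (\<Sum>l\<in>F. \<integral>p. sh l (fst p) (snd p) \<partial>?PM) + 2 * b * (\<integral>p. of_bool (Bd (fst p) (snd p)) \<partial>?PM)"
  proof -
    have "(\<integral>p. (\<Sum>l\<in>F. sh l (fst p) (snd p)) \<partial>?PM) = (\<Sum>l\<in>F. \<integral>p. sh l (fst p) (snd p) \<partial>?PM)"
      by (intro Bochner_Integration.integral_sum ish)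
    moreover have "integrable ?PM (\<lambda>p. L * (\<Sum>l\<in>F. sh l (fst p) (snd p)))"
      "integrable ?PM (\<lambda>p. 2 * b * of_bool (Bd (fst p) (snd p)))"
      using ish iB by (intro Bochner_Integration.integrable_mult_right Bochner_Integration.integrable_sum; simp)+
    ultimately show ?thesis by (simp only: Bochner_Integration.integral_add Bochner_Integration.integral_mult_right_zero)
  qed
  also have "\<dots> \<le> L * (\<Sum>l\<in>F. (1 - \<gamma> * q) ^ K)
      + 2 * b * ((real (card (grid F N)))\<^sup>2 * (4 / (real (s div 2) * \<delta>\<^sup>2)))"
  proof (intro add_mono mult_left_mono sum_mono)
    fix l assume l: "l \<in> F"
    \<comment> \<open>Here the randomization is the inner variable: the decay holds for every sample
      without ties.\<close>
    have "(\<integral>p. sh l (fst p) (snd p) \<partial>?PM) = (\<integral>z. (\<integral>e. sh l e z \<partial>rand P) \<partial>samples s)"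
      using PS.integral_snd[of "sh l"] ish[of l] by (simp add: case_prod_unfold)
    also have "\<dots> \<le> (\<integral>z. (1 - \<gamma> * q) ^ K \<partial>samples s)"
    proof (rule integral_mono_AE)
      show "integrable (samples s) (\<lambda>z. \<integral>e. sh l e z \<partial>rand P)"
        using PS.integrable_snd[of "sh l"] ish[of l] by (simp add: case_prod_unfold)
      show "AE z in samples s. (\<integral>e. sh l e z \<partial>rand P) \<le> (1 - \<gamma> * q) ^ K"
        using AE_tie_free[of s]
      proof eventually_elim
        case (elim z)
        show ?case unfolding sh_def
          using l q by (intro path_shrinkage_decay[OF wf rs elim l xs \<gamma>01]) auto
      qed
    qed simp
    finally show "(\<integral>p. sh l (fst p) (snd p) \<partial>?PM) \<le> (1 - \<gamma> * q) ^ K" by (simp add: S.prob_space)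
  next
    \<comment> \<open>Here the sample is the inner variable, because the deviation bound needs a
      deterministic leaf half.\<close>
    have "(\<integral>p. of_bool (Bd (fst p) (snd p)) \<partial>?PM) = (\<integral>e. (\<integral>z. (of_bool (Bd e z) :: real) \<partial>samples s) \<partial>rand P)"
      using PS.integral_fst'[OF iB] by simp
    also have "\<dots> \<le> (\<integral>e. (real (card (grid F N)))\<^sup>2 * (4 / (real (s div 2) * \<delta>\<^sup>2)) \<partial>rand P)"
    proof (rule integral_mono)
      show "integrable (rand P) (\<lambda>e. \<integral>z. (of_bool (Bd e z) :: real) \<partial>samples s)"
        using PS.integrable_fst'[OF iB] by simp
      fix e assume e: "e \<in> space (rand P)"
      note lh = leaf_half[OF e]
      have "(\<integral>z. (of_bool (Bd e z) :: real) \<partial>samples s) = (\<integral>z. indicator {z \<in> space (samples s). Bd e z} z \<partial>samples s)"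
        by (intro Bochner_Integration.integral_cong) (auto simp: indicator_def)
      also have "\<dots> = measure (samples s) ({z \<in> space (samples s). Bd e z} \<inter> space (samples s))"
        by (rule Bochner_Integration.integral_indicator)
      also have "\<dots> = \<P>(z in samples s. Bd e z)" by (intro arg_cong[where f = "measure _"]) auto
      also have "\<dots> \<le> (real (card (grid F N)))\<^sup>2 * (4 / (real (card (leaf_half P s e)) * \<delta>\<^sup>2))"
        unfolding Bd_def using lh const by (intro prob_grid_deviation) auto
      also have "\<dots> \<le> (real (card (grid F N)))\<^sup>2 * (4 / (real (s div 2) * \<delta>\<^sup>2))"
        using lh const by (intro mult_left_mono divide_left_mono mult_right_mono mult_pos_pos) auto
      finally show "(\<integral>z. (of_bool (Bd e z) :: real) \<partial>samples s) \<le> (real (card (grid F N)))\<^sup>2 * (4 / (real (s div 2) * \<delta>\<^sup>2))" .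
    qed simp
    finally show "(\<integral>p. of_bool (Bd (fst p) (snd p)) \<partial>?PM) \<le> (real (card (grid F N)))\<^sup>2 * (4 / (real (s div 2) * \<delta>\<^sup>2))"
      by (simp add: R.prob_space)
  qed (use L_nonneg b_nonneg in auto)
  finally show ?thesis by (simp add: T_def)
qed

end

section \<open>Averages over all subsamples\<close>

abbreviation subsamples :: "nat \<Rightarrow> nat \<Rightarrow> nat set set" where
  "subsamples n s \<equiv> {I. I \<subseteq> {1..n} \<and> card I = s}"

text \<open>A bijection of \<open>I\<close> onto \<open>J\<close> and one between the complements
  glue to a permutation: permutations act transitively on the subsets of a given size.\<close>

lemma exists_permutes_image:
  assumes S: "finite S" and IJ: "I \<subseteq> S" "J \<subseteq> S" "card I = card J"
  shows "\<exists>\<tau>. \<tau> permutes S \<and> \<tau> ` I = J"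
proof -
  have fin: "finite I" "finite J" using S IJ finite_subset by auto
  obtain g where g: "bij_betw g I J" using finite_same_card_bij[OF fin IJ(3)] by auto
  have "card (S - I) = card (S - J)" using fin IJ by (simp add: card_Diff_subset)
  then obtain h where h: "bij_betw h (S - I) (S - J)"
    using finite_same_card_bij[of "S - I" "S - J"] S by auto
  define \<tau> where "\<tau> i = (if i \<in> S then if i \<in> I then g i else h i else i)" for i
  have gI: "bij_betw \<tau> I J"
    using g IJ by (subst bij_betw_cong[of I \<tau> g]) (auto simp: \<tau>_def)
  moreover have "bij_betw \<tau> (S - I) (S - J)"
    using h by (subst bij_betw_cong[of "S - I" \<tau> h]) (auto simp: \<tau>_def)
  ultimately have "bij_betw \<tau> (I \<union> (S - I)) (J \<union> (S - J))"
    by (rule bij_betw_combine) auto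
  then have "bij_betw \<tau> S S" using IJ by (simp add: Un_absorb1)
  then have "\<tau> permutes S" by (rule bij_imp_permutes) (auto simp: \<tau>_def)
  then show ?thesis using gI by (auto simp: bij_betw_def)
qed

text \<open>Composing with a permutation that carries one subset to another shows that each subset
  of size \<open>s\<close> is the image of \<open>A\<close> equally often. The average over
  permutations is thus the uniform average over subsets, for whatever \<open>A\<close> one starts
  from.\<close>

lemma sum_over_permutations:
  fixes f :: "nat set \<Rightarrow> 'v::real_vector"
  assumes A: "A \<subseteq> {1..n}" "card A = s"
  shows "(1 / fact n) *\<^sub>R (\<Sum>\<sigma> | \<sigma> permutes {1..n}. f (\<sigma> ` A)) =
         (1 / real (n choose s)) *\<^sub>R (\<Sum>I\<in>subsamples n s. f I)"
proof -
  let ?P = "{\<sigma>. \<sigma> permutes {1..n}}"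
  define N where "N I = card {\<sigma> \<in> ?P. \<sigma> ` A = I}" for I
  have finP: "finite ?P" by (simp add: finite_permutations)
  have finI: "finite (subsamples n s)" by (rule finite_subset[of _ "Pow {1..n}"]) auto
  have le: "N I \<le> N J" if IJ: "I \<in> subsamples n s" "J \<in> subsamples n s" for I J
  proof -
    have "card I = card J" using IJ by simp
    then obtain \<tau> where \<tau>: "\<tau> permutes {1..n}" "\<tau> ` I = J"
      using exists_permutes_image[OF finite_atLeastAtMost, of I 1 n J] IJ by auto
    show ?thesis
      unfolding N_def
    proof (rule card_inj_on_le)
      show "inj_on (\<lambda>\<sigma>. \<tau> \<circ> \<sigma>) {\<sigma> \<in> ?P. \<sigma> ` A = I}"
        using permutes_inj[OF \<tau>(1)] by (auto simp: inj_on_def fun_eq_iff)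
      show "(\<lambda>\<sigma>. \<tau> \<circ> \<sigma>) ` {\<sigma> \<in> ?P. \<sigma> ` A = I} \<subseteq> {\<sigma> \<in> ?P. \<sigma> ` A = J}"
        using \<tau> by (auto intro: permutes_compose simp: image_comp[symmetric])
    qed (use finP in auto)
  qed
  have A_in: "A \<in> subsamples n s" using A by simp
  have N_eq: "N I = N A" if "I \<in> subsamples n s" for I
    using le[OF that A_in] le[OF A_in that] by simp
  have img: "(\<lambda>\<sigma>. \<sigma> ` A) ` ?P \<subseteq> subsamples n s"
  proof (rule image_subsetI)
    fix \<sigma> assume "\<sigma> \<in> ?P"
    then have \<sigma>: "\<sigma> permutes {1..n}" by simp
    have "\<sigma> ` A \<subseteq> \<sigma> ` {1..n}" using A(1) by (rule image_mono)
    then show "\<sigma> ` A \<in> subsamples n s"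
      using A(2) card_image[OF permutes_inj_on[OF \<sigma>]] by (simp only: permutes_image[OF \<sigma>]) simp
  qed
  have sum: "(\<Sum>\<sigma>\<in>?P. g (\<sigma> ` A)) = real (N A) *\<^sub>R (\<Sum>I\<in>subsamples n s. g I)" for g :: "nat set \<Rightarrow> 'u::real_vector"
  proof -
    have "(\<Sum>\<sigma>\<in>?P. g (\<sigma> ` A)) = (\<Sum>I\<in>subsamples n s. \<Sum>\<sigma>\<in>{\<sigma> \<in> ?P. \<sigma> ` A = I}. g (\<sigma> ` A))"
      by (rule sum.group[OF finP finI img, symmetric])
    also have "\<dots> = (\<Sum>I\<in>subsamples n s. real (N I) *\<^sub>R g I)"
      by (intro sum.cong refl) (simp add: N_def sum_constant_scaleR)
    also have "\<dots> = (\<Sum>I\<in>subsamples n s. real (N A) *\<^sub>R g I)"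
      using N_eq by (intro sum.cong refl) simp
    finally show ?thesis by (simp add: scaleR_sum_right)
  qed
  \<comment> \<open>Summing the constant 1 counts the permutations and identifies the common
    multiplicity \<open>N A\<close>.\<close>
  have "fact n = real (N A) * real (n choose s)"
    using sum[of "\<lambda>_. 1 :: real"] n_subsets[of "{1..n}" s] card_permutations[of "{1..n}" n] by simp
  moreover have "(fact n :: real) \<noteq> 0" by simp
  ultimately have "1 / fact n * real (N A) = 1 / real (n choose s)" by (auto simp: field_simps)
  then show ?thesis unfolding sum by simp
qed

lemma norm_average_power2_le:
  fixes v :: "'i \<Rightarrow> 'v::real_normed_vector"
  assumes "finite S" "S \<noteq> {}"
  shows "(norm ((1 / real (card S)) *\<^sub>R (\<Sum>i\<in>S. v i)))\<^sup>2 \<le> (1 / real (card S)) * (\<Sum>i\<in>S. (norm (v i))\<^sup>2)"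
proof -
  have n: "0 < real (card S)" using assms by (simp add: card_gt_0_iff)
  have "(norm (\<Sum>i\<in>S. v i))\<^sup>2 \<le> (\<Sum>i\<in>S. norm (v i))\<^sup>2"
    by (intro power_mono norm_sum) auto
  also have "\<dots> \<le> (\<Sum>i\<in>S. (norm (v i))\<^sup>2) * real (card S)"
    by (rule sum_squared_le_sum_of_squares)
  finally show ?thesis
    using n by (simp add: power_divide field_simps power2_eq_square)
qed

lemma sorted_list_of_set_nth_mem: "finite I \<Longrightarrow> i < card I \<Longrightarrow> sorted_list_of_set I ! i \<in> I"
  by (metis length_sorted_list_of_set nth_mem set_sorted_list_of_set)

lemma measurable_subsample:
  assumes I: "finite I" "I \<subseteq> K" "card I = s"
  shows "(\<lambda>D. \<lambda>i\<in>{..<card I}. D (sorted_list_of_set I ! i)) \<in> measurable (PiM K (\<lambda>_. N)) (PiM {..<s} (\<lambda>_. N))"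
  unfolding I(3)
proof (rule measurable_restrict)
  fix i assume "i \<in> {..<s}"
  then have "sorted_list_of_set I ! i \<in> K" using I sorted_list_of_set_nth_mem[of I i] by auto
  then show "(\<lambda>D. D (sorted_list_of_set I ! i)) \<in> measurable (PiM K (\<lambda>_. N)) N"
    by (rule measurable_component_singleton)
qed

text \<open>
  Writing the average over all subsamples as an average, over permutations, of averages over
  \<open>n div s\<close> disjoint blocks makes the summands of the inner average independent.
\<close>

lemma subsample_average_variance:
  fixes G :: "(nat \<Rightarrow> 'q) \<Rightarrow> 'h::{real_inner, banach, second_countable_topology}"
  assumes Q: "prob_space Q" and s: "0 < s" "s \<le> n"
    and G [measurable]: "G \<in> borel_measurable (PiM {..<s} (\<lambda>_. Q))"
    and b: "AE z in PiM {..<s} (\<lambda>_. Q). norm (G z) \<le> b"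
  defines "U \<equiv> \<lambda>D. (1 / real (n choose s)) *\<^sub>R (\<Sum>I\<in>subsamples n s. G (\<lambda>i\<in>{..<card I}. D (sorted_list_of_set I ! i)))"
    and "e \<equiv> \<integral>z. G z \<partial>PiM {..<s} (\<lambda>_. Q)"
  shows "integrable (PiM {1..n} (\<lambda>_. Q)) (\<lambda>D. (norm (U D - e))\<^sup>2)"
    "(\<integral>D. (norm (U D - e))\<^sup>2 \<partial>PiM {1..n} (\<lambda>_. Q)) \<le> 4 * b\<^sup>2 / real (n div s)"
proof -
  let ?D = "PiM {1..n} (\<lambda>_. Q)"
  interpret D: prob_space ?D using Q by (intro prob_space_PiM) auto
  define sub where "sub D I = (\<lambda>i\<in>{..<card I}. D (sorted_list_of_set I ! i))" for D :: "nat \<Rightarrow> 'q" and I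
  define h where "h I D = G (sub D I)" for I D
  define B where "B = n div s"
  \<comment> \<open>Block \<open>k\<close> consists of \<open>s\<close> consecutive indices starting
    at \<open>k * s + 1\<close>; the blocks with \<open>k < B\<close> leave out the last
    \<open>n mod s\<close> indices.\<close>
  define A where "A k = {k * s<..Suc k * s}" for k
  let ?P = "{\<sigma>. \<sigma> permutes {1..n}}"
  have B: "0 < B" using s by (simp add: B_def div_greater_zero_iff)
  have A: "A k \<subseteq> {1..n}" "card (A k) = s" if "k < B" for k
  proof -
    have "Suc k * s \<le> B * s" using that by (intro mult_right_mono) auto
    also have "\<dots> \<le> n" by (simp add: B_def)
    finally show "A k \<subseteq> {1..n}" by (auto simp: A_def)
    show "card (A k) = s" by (simp add: A_def)
  qed
  have A_disj: "A k \<inter> A k' = {}" if "k \<noteq> k'" for k k'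
  proof -
    have "A k \<inter> A k' = {}" if "k < k'" for k k'
      using mult_right_mono[of "Suc k" k' s] that by (force simp: A_def)
    then show ?thesis using that by (metis Int_commute linorder_neqE_nat)
  qed
  have \<sigma>A: "\<sigma> ` A k \<subseteq> {1..n}" "card (\<sigma> ` A k) = s" if "\<sigma> \<in> ?P" "k < B" for \<sigma> k
  proof -
    have \<sigma>: "\<sigma> permutes {1..n}" using that by simp
    have "\<sigma> ` A k \<subseteq> \<sigma> ` {1..n}" using A(1)[OF that(2)] by (rule image_mono)
    then show "\<sigma> ` A k \<subseteq> {1..n}" by (simp only: permutes_image[OF \<sigma>])
    show "card (\<sigma> ` A k) = s"
      using A(2)[OF that(2)] card_image[OF permutes_inj_on[OF \<sigma>]] by simp
  qed
  have subm: "(\<lambda>D. sub D I) \<in> measurable (PiM K (\<lambda>_. Q)) (PiM {..<s} (\<lambda>_. Q))"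
    if "finite I" "I \<subseteq> K" "card I = s" for I K
    unfolding sub_def using that by (rule measurable_subsample)
  \<comment> \<open>The observations are independent and identically distributed, so any
    \<open>s\<close> of them, listed in increasing order of index, have the law of a fresh
    sample.\<close>
  have sub_distr: "distr ?D (PiM {..<s} (\<lambda>_. Q)) (\<lambda>D. sub D I) = PiM {..<s} (\<lambda>_. Q)"
    if I: "I \<subseteq> {1..n}" "card I = s" for I
  proof -
    have fin: "finite I" using I finite_subset by blast
    have mem: "sorted_list_of_set I ! i \<in> I" if "i < s" for i
      using I fin that by (intro sorted_list_of_set_nth_mem) auto
    have "inj_on ((!) (sorted_list_of_set I)) {..<s}"
      by (rule inj_on_nth) (auto simp: I)
    then show ?thesis
      unfolding sub_def I(2)
      using distr_PiM_reindex[of "{1..n}" "\<lambda>_. Q" "(!) (sorted_list_of_set I)" "{..<s}"] Q mem I by auto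
  qed
  have hm: "h I \<in> borel_measurable ?D" and hb: "AE D in ?D. norm (h I D) \<le> b" and he: "(\<integral>D. h I D \<partial>?D) = e"
    if I: "I \<subseteq> {1..n}" "card I = s" for I
  proof -
    have fin: "finite I" using I finite_subset by blast
    note m = subm[OF fin I]
    show "h I \<in> borel_measurable ?D"
      unfolding h_def[abs_def] using measurable_compose[OF m G] .
    show "AE D in ?D. norm (h I D) \<le> b"
      unfolding h_def by (rule AE_distrD[OF m]) (subst sub_distr[OF I], rule b)
    have "(\<integral>D. h I D \<partial>?D) = (\<integral>z. G z \<partial>distr ?D (PiM {..<s} (\<lambda>_. Q)) (\<lambda>D. sub D I))"
      unfolding h_def by (rule integral_distr[OF m G, symmetric])
    then show "(\<integral>D. h I D \<partial>?D) = e" unfolding sub_distr[OF I] e_def .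
  qed
  have h_indep: "D.indep_var borel (h I) borel (h J)"
    if I: "I \<subseteq> {1..n}" "card I = s" and J: "J \<subseteq> {1..n}" "card J = s" and IJ: "I \<inter> J = {}" for I J
  proof -
    have fin: "finite I" "finite J" using I J finite_subset by blast+
    have ne: "{1..n} \<noteq> {}" using s by auto
    have m: "h I \<in> borel_measurable (PiM I (\<lambda>_. Q))" "h J \<in> borel_measurable (PiM J (\<lambda>_. Q))"
      unfolding h_def[abs_def]
      using measurable_compose[OF subm[OF fin(1) order_refl I(2)] G] measurable_compose[OF subm[OF fin(2) order_refl J(2)] G] by auto
    \<comment> \<open>\<open>h I\<close> looks only at the coordinates in \<open>I\<close>, which is
      why disjoint index sets give independent values.\<close>
    have res: "h I (restrict D I) = h I D" if "finite I" for I D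
    proof -
      have "sorted_list_of_set I ! i \<in> I" if "i < card I" for i
        using \<open>finite I\<close> that by (rule sorted_list_of_set_nth_mem)
      then have "sub (restrict D I) I = sub D I" by (auto simp: sub_def)
      then show ?thesis by (simp add: h_def)
    qed
    have "D.indep_var borel (h I \<circ> (\<lambda>D. restrict D I)) borel (h J \<circ> (\<lambda>D. restrict D J))"
      by (rule D.indep_var_compose[OF indep_var_coordinate_blocks[OF Q ne IJ I(1) J(1)] m])
    then show ?thesis using res[OF fin(1)] res[OF fin(2)] by (simp add: o_def)
  qed
  define V where "V \<sigma> D = (1 / real (card {..<B})) *\<^sub>R (\<Sum>k<B. h (\<sigma> ` A k) D)" for \<sigma> D
  have V: "integrable ?D (\<lambda>D. (norm (V \<sigma> D - e))\<^sup>2)" "(\<integral>D. (norm (V \<sigma> D - e))\<^sup>2 \<partial>?D) \<le> 4 * b\<^sup>2 / real B"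
    if \<sigma>: "\<sigma> \<in> ?P" for \<sigma>
  proof -
    have ind: "D.indep_var borel (h (\<sigma> ` A i)) borel (h (\<sigma> ` A j))" if "i \<in> {..<B}" "j \<in> {..<B}" "i \<noteq> j" for i j
    proof (rule h_indep)
      have "inj \<sigma>" using \<sigma> permutes_inj by blast
      then show "\<sigma> ` A i \<inter> \<sigma> ` A j = {}"
        using A_disj[OF that(3)] by (simp add: image_Int[symmetric])
    qed (use \<sigma>A[OF \<sigma>] that in auto)
    have "{..<B} \<noteq> {}" using B by auto
    from D.mean_square_average[of "{..<B}" "\<lambda>k. h (\<sigma> ` A k)" b e, OF finite_lessThan this ind] 
    show "integrable ?D (\<lambda>D. (norm (V \<sigma> D - e))\<^sup>2)" "(\<integral>D. (norm (V \<sigma> D - e))\<^sup>2 \<partial>?D) \<le> 4 * b\<^sup>2 / real B"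
      using \<sigma>A[OF \<sigma>] hm hb he unfolding V_def by auto
  qed
  have "id \<in> ?P" by (simp only: mem_Collect_eq permutes_id)
  then have "?P \<noteq> {}" by blast
  moreover have "finite ?P" by (simp add: finite_permutations)
  ultimately have finP: "finite ?P" "?P \<noteq> {}" by blast+
  have cardP: "real (card ?P) = fact n"
    using card_permutations[of "{1..n}" n] by simp
  have U: "U D - e = (1 / real (card ?P)) *\<^sub>R (\<Sum>\<sigma>\<in>?P. V \<sigma> D - e)" for D
  proof -
    have "(1 / fact n) *\<^sub>R (\<Sum>\<sigma>\<in>?P. h (\<sigma> ` A k) D) = U D" if "k < B" for k
      using sum_over_permutations[OF A[OF that], of "\<lambda>I. h I D"] by (simp only: U_def h_def sub_def)
    then have "(\<Sum>k<B. (1 / fact n) *\<^sub>R (\<Sum>\<sigma>\<in>?P. h (\<sigma> ` A k) D)) = real B *\<^sub>R U D"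
      by (simp add: sum_constant_scaleR)
    then have "real B *\<^sub>R U D = (1 / fact n) *\<^sub>R (\<Sum>\<sigma>\<in>?P. \<Sum>k<B. h (\<sigma> ` A k) D)"
      unfolding scaleR_sum_right[symmetric] by (subst sum.swap) (rule sym)
    then have "(1 / real B) *\<^sub>R (real B *\<^sub>R U D) = (1 / fact n) *\<^sub>R (\<Sum>\<sigma>\<in>?P. V \<sigma> D)"
      by (simp add: V_def scaleR_sum_right[symmetric])
    then have "U D = (1 / fact n) *\<^sub>R (\<Sum>\<sigma>\<in>?P. V \<sigma> D)" using B by simp
    moreover have "(1 / fact n) *\<^sub>R (\<Sum>\<sigma>\<in>?P. e) = e"
      by (simp only: sum_constant_scaleR cardP) simp
    ultimately show ?thesis unfolding cardP by (simp add: sum_subtractf scaleR_diff_right)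
  qed
  \<comment> \<open>Convexity: the \<open>V \<sigma>\<close> depend on each other, but averaging
    over \<open>\<sigma>\<close> cannot push the mean square error beyond the bound valid for each
    of them.\<close>
  have le: "(norm (U D - e))\<^sup>2 \<le> (1 / real (card ?P)) * (\<Sum>\<sigma>\<in>?P. (norm (V \<sigma> D - e))\<^sup>2)" for D
    unfolding U by (rule norm_average_power2_le[OF finP])
  have iR: "integrable ?D (\<lambda>D. (1 / real (card ?P)) * (\<Sum>\<sigma>\<in>?P. (norm (V \<sigma> D - e))\<^sup>2))"
    using V(1) by (intro Bochner_Integration.integrable_mult_right Bochner_Integration.integrable_sum) auto
  have Um: "U \<in> borel_measurable ?D"
  proof -
    have "U = (\<lambda>D. (1 / real (n choose s)) *\<^sub>R (\<Sum>I\<in>subsamples n s. h I D))"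
      by (simp add: U_def h_def sub_def fun_eq_iff)
    then show ?thesis using hm by (auto intro!: borel_measurable_scaleR borel_measurable_sum)
  qed
  show "integrable ?D (\<lambda>D. (norm (U D - e))\<^sup>2)"
  proof (rule Bochner_Integration.integrable_bound[OF iR])
    show "AE D in ?D. norm ((norm (U D - e))\<^sup>2) \<le> norm ((1 / real (card ?P)) * (\<Sum>\<sigma>\<in>?P. (norm (V \<sigma> D - e))\<^sup>2))"
      using le by (intro AE_I2) (simp add: abs_of_nonneg sum_nonneg)
  qed (use Um in measurable)
  then have "(\<integral>D. (norm (U D - e))\<^sup>2 \<partial>?D) \<le> (\<integral>D. (1 / real (card ?P)) * (\<Sum>\<sigma>\<in>?P. (norm (V \<sigma> D - e))\<^sup>2) \<partial>?D)"
    using le by (intro integral_mono iR) auto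
  also have "\<dots> = (1 / real (card ?P)) * (\<Sum>\<sigma>\<in>?P. \<integral>D. (norm (V \<sigma> D - e))\<^sup>2 \<partial>?D)"
    using V(1) by (simp add: Bochner_Integration.integral_sum)
  also have "\<dots> \<le> (1 / real (card ?P)) * (\<Sum>\<sigma>\<in>?P. 4 * b\<^sup>2 / real B)"
    using V(2) by (intro mult_left_mono sum_mono) auto
  also have "\<dots> = 4 * b\<^sup>2 / real B" using finP by simp
  finally show "(\<integral>D. (norm (U D - e))\<^sup>2 \<partial>?D) \<le> 4 * b\<^sup>2 / real (n div s)" by (simp add: B_def)
qed

section \<open>Consistency of the forest\<close>

lemma subsample_size_le: "real (subsample_size \<beta> n) \<le> real n powr \<beta>"
  by (simp add: subsample_size_def of_nat_nat)

text \<open>Rounding down to an integer and halving lose a bounded amount, for which the 2 leaves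
  room.\<close>

lemma filterlim_half_subsample_size:
  assumes "0 < \<beta>"
  shows "filterlim (\<lambda>n. real (subsample_size \<beta> n div 2)) at_top sequentially"
proof (rule filterlim_at_top_mono)
  show "filterlim (\<lambda>n. real n powr \<beta> / 2 - 2) at_top sequentially"
    using assms by real_asymp
  show "\<forall>\<^sub>F n in sequentially. real n powr \<beta> / 2 - 2 \<le> real (subsample_size \<beta> n div 2)"
  proof (rule always_eventually, rule allI)
    fix n
    have "real n powr \<beta> - 1 \<le> real (subsample_size \<beta> n)"
      unfolding subsample_size_def by (simp add: of_nat_nat)
    moreover have "real (subsample_size \<beta> n) \<le> 2 * real (subsample_size \<beta> n div 2) + 1"
      using of_nat_mono[of "subsample_size \<beta> n" "2 * (subsample_size \<beta> n div 2) + 1", where 'a = real]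
      by simp
    ultimately show "real n powr \<beta> / 2 - 2 \<le> real (subsample_size \<beta> n div 2)" by linarith
  qed
qed

text \<open>There are about \<open>n powr (1 - \<beta>)\<close> blocks: this is where
  \<open>\<beta> < 1\<close> makes the variance vanish.\<close>

lemma filterlim_number_of_blocks:
  assumes "0 < \<beta>" "\<beta> < 1"
  shows "filterlim (\<lambda>n. real (n div subsample_size \<beta> n)) at_top sequentially"
proof (rule filterlim_at_top_mono)
  show "filterlim (\<lambda>n. real n powr (1 - \<beta>) - 1) at_top sequentially"
    using assms by real_asymp
  have "\<forall>\<^sub>F n in sequentially. 2 \<le> real (subsample_size \<beta> n div 2)"
    using filterlim_half_subsample_size[OF assms(1)] unfolding filterlim_at_top by blast
  then show "\<forall>\<^sub>F n in sequentially. real n powr (1 - \<beta>) - 1 \<le> real (n div subsample_size \<beta> n)"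
    using eventually_gt_at_top[of 0]
  proof eventually_elim
    case (elim n)
    let ?s = "subsample_size \<beta> n"
    have s: "0 < ?s" using elim(1) by (intro Nat.gr0I) auto
    have "real n powr (1 - \<beta>) = real n / real n powr \<beta>"
      using elim(2) by (simp add: powr_diff)
    also have "\<dots> \<le> real n / real ?s"
      using s subsample_size_le[of \<beta> n] by (intro divide_left_mono) (auto intro!: mult_pos_pos simp: elim(2))
    also have "\<dots> \<le> real (n div ?s) + 1"
    proof -
      have "n \<le> ?s * (n div ?s) + ?s"
        using mod_less_divisor[OF s, of n] mult_div_mod_eq[of ?s n] by linarith
      then have "real n \<le> real ?s * real (n div ?s) + real ?s"
        by (metis of_nat_add of_nat_le_iff of_nat_mult)
      then show ?thesis using s by (simp add: divide_le_eq algebra_simps)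
    qed
    finally show ?case by simp
  qed
qed

context forest_law
begin

text \<open>The infinite forest is a complete U-statistic of order \<open>s\<close> whose kernel
  \<open>G\<close> is the tree averaged over its randomization. Its mean is that of a single tree,
  so the bias of the forest is the bias of a tree. The factors 2 come from squaring the sum of the
  two errors.\<close>

lemma forest_mean_square:
  fixes P :: "('e, 'h) tree_procedure"
  assumes wf: "well_formed_procedure F s P" and s: "0 < s" "s \<le> n" and x: "x \<in> cube F"
    and bias: "norm ((\<integral>z. (\<integral>e. tree_output P s x e z \<partial>rand P) \<partial>samples s) - m x) \<le> \<eta>"
  shows "integrable (PiM {1..n} (\<lambda>_. Q)) (\<lambda>D. (norm (infinite_forest P s n D x - m x))\<^sup>2)"
    "(\<integral>D. (norm (infinite_forest P s n D x - m x))\<^sup>2 \<partial>PiM {1..n} (\<lambda>_. Q)) \<le> 8 * b\<^sup>2 / real (n div s) + 2 * \<eta>\<^sup>2"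
proof -
  let ?D = "PiM {1..n} (\<lambda>_. Q)"
  interpret D: prob_space ?D using prob_Q by (intro prob_space_PiM) auto
  interpret R: prob_space "rand P" by (rule well_formed_prob_space[OF wf])
  define G where "G z = (\<integral>e. tree_output P s x e z \<partial>rand P)" for z
  have xs: "x \<in> space (input_space F)" by (rule space_input_cube[OF x])
  have Gm: "G \<in> borel_measurable (samples s)"
  proof -
    have g: "fst \<in> measurable (samples s \<Otimes>\<^sub>M rand P) (sample_space F s)"
      using measurable_compose[OF measurable_fst measurable_id_samples] .
    have "(\<lambda>p. tree_output P s x (snd p) (fst p)) \<in> borel_measurable (samples s \<Otimes>\<^sub>M rand P)"
      by (rule measurable_tree_output[OF wf _ measurable_snd g]) (use xs in simp)
    then show ?thesis
      unfolding G_def[abs_def] by (intro R.borel_measurable_lebesgue_integral) (simp add: case_prod_unfold)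
  qed
  have Gb: "AE z in samples s. norm (G z) \<le> b"
    using AE_samples[OF response_bounded, of s] AE_space
  proof eventually_elim
    case (elim z)
    have zs: "z \<in> space (sample_space F s)" using elim(2) by (simp add: space_samples)
    have le: "norm (tree_output P s x e z) \<le> b" for e
      unfolding tree_output_eq using elim(1) b_nonneg by (intro norm_leaf_average_le) auto
    have me: "(\<lambda>e. tree_output P s x e z) \<in> borel_measurable (rand P)"
      by (rule measurable_tree_output[OF wf _ measurable_ident_sets[OF refl]]) (use xs zs in auto)
    have "norm (G z) \<le> (\<integral>e. norm (tree_output P s x e z) \<partial>rand P)"
      unfolding G_def by (rule integral_norm_bound)
    also have "\<dots> \<le> (\<integral>e. b \<partial>rand P)"
      using le me b_nonneg by (intro integral_mono integrable_norm R.integrable_const_bound[where B = b]) auto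
    finally show ?case by (simp add: R.prob_space)
  qed
  let ?U = "\<lambda>D. infinite_forest P s n D x"
  let ?e = "\<integral>z. G z \<partial>samples s"
  have U: "?U D = (1 / real (n choose s)) *\<^sub>R
      (\<Sum>I\<in>subsamples n s. G (\<lambda>i\<in>{..<card I}. D (sorted_list_of_set I ! i)))" for D
    by (simp only: infinite_forest_def G_def subsample_def)
  have var: "integrable ?D (\<lambda>D. (norm (?U D - ?e))\<^sup>2)"
    "(\<integral>D. (norm (?U D - ?e))\<^sup>2 \<partial>?D) \<le> 4 * b\<^sup>2 / real (n div s)"
    unfolding U by (rule subsample_average_variance[OF prob_Q s Gm Gb])+
  have le: "(norm (?U D - m x))\<^sup>2 \<le> 2 * (norm (?U D - ?e))\<^sup>2 + 2 * \<eta>\<^sup>2" for D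
  proof -
    have "norm (?U D - m x) \<le> norm (?U D - ?e) + norm (?e - m x)"
      using norm_triangle_ineq[of "?U D - ?e" "?e - m x"] by simp
    also have "\<dots> \<le> norm (?U D - ?e) + \<eta>" using bias unfolding G_def by simp
    finally have "(norm (?U D - m x))\<^sup>2 \<le> (norm (?U D - ?e) + \<eta>)\<^sup>2" by (intro power_mono) auto
    also have "\<dots> \<le> 2 * (norm (?U D - ?e))\<^sup>2 + 2 * \<eta>\<^sup>2" using sum_squares_bound[of "norm (?U D - ?e)" \<eta>] by (simp add: power2_sum)
    finally show ?thesis .
  qed
  have iR: "integrable ?D (\<lambda>D. 2 * (norm (?U D - ?e))\<^sup>2 + 2 * \<eta>\<^sup>2)"
    using var(1) by (intro Bochner_Integration.integrable_add Bochner_Integration.integrable_mult_right D.integrable_const)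
  have Um: "?U \<in> borel_measurable ?D"
  proof -
    have "(\<lambda>D. G (\<lambda>i\<in>{..<card I}. D (sorted_list_of_set I ! i))) \<in> borel_measurable ?D" if "I \<in> subsamples n s" for I
    proof -
      have I: "finite I" "I \<subseteq> {1..n}" "card I = s" using that finite_subset by auto
      show ?thesis using measurable_compose[OF measurable_subsample[OF I] Gm] .
    qed
    then show ?thesis
      unfolding U by (intro borel_measurable_scaleR borel_measurable_sum) auto
  qed
  show int: "integrable ?D (\<lambda>D. (norm (?U D - m x))\<^sup>2)"
  proof (rule Bochner_Integration.integrable_bound[OF iR])
    show "AE D in ?D. norm ((norm (?U D - m x))\<^sup>2) \<le> norm (2 * (norm (?U D - ?e))\<^sup>2 + 2 * \<eta>\<^sup>2)"
      using le by (intro AE_I2) (simp add: abs_of_nonneg)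
  qed (use Um in measurable)
  have "(\<integral>D. (norm (?U D - m x))\<^sup>2 \<partial>?D) \<le> (\<integral>D. 2 * (norm (?U D - ?e))\<^sup>2 + 2 * \<eta>\<^sup>2 \<partial>?D)"
    using le by (intro integral_mono int iR) auto
  also have "\<dots> = 2 * (\<integral>D. (norm (?U D - ?e))\<^sup>2 \<partial>?D) + 2 * \<eta>\<^sup>2"
    using var(1) by (simp add: D.prob_space del: One_nat_def)
  also have "\<dots> \<le> 8 * b\<^sup>2 / real (n div s) + 2 * \<eta>\<^sup>2" using var(2) by simp
  finally show "(\<integral>D. (norm (?U D - m x))\<^sup>2 \<partial>?D) \<le> 8 * b\<^sup>2 / real (n div s) + 2 * \<eta>\<^sup>2" .
qed

text \<open>The threshold for \<open>n\<close> does not depend on \<open>x\<close>, which later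
  allows the estimate to be integrated over a random test point. Depth, tolerance and grid are fixed
  before \<open>n\<close>, so only finitely many conditions remain to hold for large
  \<open>n\<close>.\<close>

lemma forest_consistent:
  fixes Cn :: "('e, 'h) forest_construction"
  assumes fp: "forest_properties \<pi> \<alpha> \<kappa> \<beta> F Cn" and \<epsilon>: "0 < \<epsilon>"
  shows "\<forall>\<^sub>F n in sequentially. \<forall>x\<in>cube F.
    integrable (PiM {1..n} (\<lambda>_. Q)) (\<lambda>D. (norm (infinite_forest (Cn F n) (subsample_size \<beta> n) n D x - m x))\<^sup>2) \<and>
    (\<integral>D. (norm (infinite_forest (Cn F n) (subsample_size \<beta> n) n D x - m x))\<^sup>2 \<partial>PiM {1..n} (\<lambda>_. Q)) \<le> \<epsilon>"
proof -
  note fp' = fp[unfolded forest_properties_def]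
  have \<pi>: "0 < \<pi>" and \<alpha>: "0 < \<alpha>" "\<alpha> \<le> 1" and \<kappa>: "1 \<le> \<kappa>" and \<beta>: "0 < \<beta>" "\<beta> < 1"
    using fp' by auto
  \<comment> \<open>Half of \<open>\<epsilon>\<close> is left to the variance. The bias
    \<open>\<eta>\<close> is itself shared equally by the shrinkage at depth \<open>K\<close> and
    the exceptional event.\<close>
  define \<eta> where "\<eta> = sqrt \<epsilon> / 2"
  have \<eta>: "0 < \<eta>" "2 * \<eta>\<^sup>2 = \<epsilon> / 2" using \<epsilon> by (auto simp: \<eta>_def power_divide)
  define \<gamma> where "\<gamma> = \<alpha> * c / (2 * C)"
  \<comment> \<open>Capped at 1 because nothing bounds \<open>\<pi>\<close> from above, and set to 1
    without features, where \<open>\<pi> / real (card F)\<close> would be 0.\<close>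
  define q where "q = (if F = {} then 1 else min 1 (\<pi> / real (card F)))"
  have q: "0 < q" "q \<le> 1" "F \<noteq> {} \<Longrightarrow> q \<le> \<pi> / real (card F)"
    using \<pi> by (auto simp: q_def card_gt_0_iff)
  have \<gamma>: "0 < \<gamma>" "\<gamma> \<le> 1"
    using \<alpha> c_pos c_le_C mult_mono[of \<alpha> 1 c C] by (auto simp: \<gamma>_def divide_le_eq)
  have \<rho>: "0 \<le> 1 - \<gamma> * q" "1 - \<gamma> * q < 1" using \<gamma> q mult_le_one[of \<gamma> q] by auto
  have "(\<lambda>K. L * (real (card F) * (1 - \<gamma> * q) ^ K)) \<longlonglongrightarrow> L * (real (card F) * 0)"
    by (intro tendsto_intros LIMSEQ_realpow_zero \<rho>)
  then have "\<forall>\<^sub>F K in sequentially. L * (real (card F) * (1 - \<gamma> * q) ^ K) < \<eta> / 2"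
    using \<eta> by (intro order_tendstoD) auto
  then obtain K where K: "L * (real (card F) * (1 - \<gamma> * q) ^ K) < \<eta> / 2"
    by (auto simp: eventually_sequentially)
  \<comment> \<open>One half of the admissible error \<open>\<alpha> * \<alpha> ^ K / 4\<close> goes
    to the deviation on the grid, the other to the rounding of boxes, which determines
    \<open>N\<close>.\<close>
  define \<delta> where "\<delta> = \<alpha> * \<alpha> ^ K / 8"
  have \<delta>: "0 < \<delta>" using \<alpha> by (simp add: \<delta>_def)
  obtain N :: nat where N: "2 * real (card F) * C / \<delta> < real N" using reals_Archimedean2 by blast
  have N0: "0 < N"
  proof -
    have "0 \<le> 2 * real (card F) * C / \<delta>" using \<delta> c_le_C by simp
    then show ?thesis using N by (intro Nat.gr0I) auto
  qed
  have \<delta>N: "4 * (\<delta> + 2 * real (card F) * C / real N) \<le> \<alpha> * \<alpha> ^ K"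
  proof -
    have "2 * real (card F) * C / real N \<le> \<delta>"
      using N N0 \<delta> by (simp add: divide_less_eq divide_le_eq mult.commute)
    then show ?thesis by (simp add: \<delta>_def)
  qed
  define c0 where "c0 = 2 * b * ((real (card (grid F N)))\<^sup>2 * (4 / \<delta>\<^sup>2))"
  have ev: "\<forall>\<^sub>F n in sequentially. M \<le> real (subsample_size \<beta> n div 2)" for M
    using filterlim_half_subsample_size[OF \<beta>(1)] by (simp add: filterlim_at_top)
  have ev': "\<forall>\<^sub>F n in sequentially. M \<le> real (n div subsample_size \<beta> n)" for M
    using filterlim_number_of_blocks[OF \<beta>] by (simp add: filterlim_at_top)
  show ?thesis
    using ev[of "real \<kappa>"] ev[of "real (2 * \<kappa> - 1) / \<alpha> ^ K + 1"] ev[of "2 * c0 / \<eta>"] ev'[of 1] ev'[of "16 * b\<^sup>2 / \<epsilon>"]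
  proof eventually_elim
    case (elim n)
    let ?s = "subsample_size \<beta> n"
    have s2: "\<kappa> \<le> ?s div 2" using elim(1) by simp
    have s: "0 < ?s" using s2 \<kappa> by (intro Nat.gr0I) auto
    have sn: "?s \<le> n" using elim(4) s by (metis div_less not_le of_nat_0 of_nat_le_iff not_one_le_zero of_nat_1)
    have big: "real (2 * \<kappa> - 1) < \<alpha> ^ K * real (?s div 2)"
    proof -
      have "real (2 * \<kappa> - 1) / \<alpha> ^ K < real (?s div 2)" using elim(2) by linarith
      then show ?thesis using \<alpha> by (simp add: divide_less_eq mult.commute)
    qed
    have spos: "0 < real (?s div 2)" using s2 \<kappa> by simp
    have dev: "2 * b * ((real (card (grid F N)))\<^sup>2 * (4 / (real (?s div 2) * \<delta>\<^sup>2))) \<le> \<eta> / 2"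
    proof -
      have "2 * b * ((real (card (grid F N)))\<^sup>2 * (4 / (real (?s div 2) * \<delta>\<^sup>2))) = c0 / real (?s div 2)"
        by (simp add: c0_def)
      also have "\<dots> \<le> \<eta> / 2" using elim(3) spos \<eta> by (simp add: divide_le_eq mult.commute)
      finally show ?thesis .
    qed
    have var: "8 * b\<^sup>2 / real (n div ?s) \<le> \<epsilon> / 2"
    proof -
      have "0 < real (n div ?s)" using elim(4) by linarith
      then show ?thesis using elim(5) \<epsilon> by (simp add: divide_le_eq mult.commute)
    qed
    have props: "well_formed_procedure F ?s (Cn F n)" "honest F ?s (Cn F n)" "random_split \<pi> F ?s (Cn F n)"
      "regular \<alpha> \<kappa> F ?s (Cn F n)"
      using fp' by auto
    show ?case
    proof
      fix x assume x: "x \<in> cube F"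
      have "norm ((\<integral>z. (\<integral>e. tree_output (Cn F n) ?s x e z \<partial>rand (Cn F n)) \<partial>samples ?s) - m x) \<le> \<eta>"
        using bias_bound[OF props \<alpha> \<kappa> s2 N0 \<delta> \<delta>N big \<gamma>_def q(3) less_imp_le[OF q(1)] q(2) x] dev K by linarith
      from forest_mean_square[OF props(1) s sn x this]
      show "integrable (PiM {1..n} (\<lambda>_. Q)) (\<lambda>D. (norm (infinite_forest (Cn F n) ?s n D x - m x))\<^sup>2) \<and>
        (\<integral>D. (norm (infinite_forest (Cn F n) ?s n D x - m x))\<^sup>2 \<partial>PiM {1..n} (\<lambda>_. Q)) \<le> \<epsilon>"
        using var \<eta>(2) by auto
    qed
  qed
qed

end

section \<open>Convergence of the ratio\<close>

lemma norm_power2_diff_le: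
  fixes x y :: "'v::real_normed_vector"
  assumes "norm x \<le> b" "norm y \<le> b"
  shows "\<bar>(norm x)\<^sup>2 - (norm y)\<^sup>2\<bar> \<le> 2 * b * norm (x - y)"
proof -
  have "\<bar>(norm x)\<^sup>2 - (norm y)\<^sup>2\<bar> = \<bar>norm x - norm y\<bar> * (norm x + norm y)"
    by (simp add: power2_eq_square square_diff_square_factored abs_mult mult.commute)
  also have "\<dots> \<le> norm (x - y) * (2 * b)"
    using assms by (intro mult_mono norm_triangle_ineq3) auto
  finally show ?thesis by (simp add: mult_ac)
qed

lemma sum_square_deviation:
  fixes u :: "'i \<Rightarrow> 'v::real_inner"
  assumes "finite I" "I \<noteq> {}"
  defines "a \<equiv> (1 / real (card I)) *\<^sub>R (\<Sum>i\<in>I. u i)"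
  shows "(1 / real (card I)) * (\<Sum>i\<in>I. (norm (u i - a))\<^sup>2) = (1 / real (card I)) * (\<Sum>i\<in>I. (norm (u i))\<^sup>2) - (norm a)\<^sup>2"
proof -
  have n: "real (card I) > 0" using assms by (simp add: card_gt_0_iff)
  have s: "(\<Sum>i\<in>I. u i) = real (card I) *\<^sub>R a" using n by (simp add: a_def)
  have "(\<Sum>i\<in>I. (norm (u i - a))\<^sup>2) = (\<Sum>i\<in>I. (norm (u i))\<^sup>2 - 2 * inner (u i) a + (norm a)\<^sup>2)"
    by (intro sum.cong refl) (simp add: power2_norm_eq_inner inner_diff_left inner_diff_right inner_commute)
  also have "\<dots> = (\<Sum>i\<in>I. (norm (u i))\<^sup>2) - 2 * inner (\<Sum>i\<in>I. u i) a + real (card I) * (norm a)\<^sup>2"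
    by (simp add: sum.distrib sum_subtractf inner_sum_left sum_distrib_left)
  also have "\<dots> = (\<Sum>i\<in>I. (norm (u i))\<^sup>2) - real (card I) * (norm a)\<^sup>2"
    unfolding s by (simp add: power2_norm_eq_inner)
  finally show ?thesis using n by (simp add: right_diff_distrib)
qed

lemma le_plus_square_div:
  fixes t \<tau> :: real
  assumes "0 < \<tau>"
  shows "t \<le> \<tau> + t\<^sup>2 / \<tau>"
proof -
  have "t * \<tau> \<le> \<tau>\<^sup>2 + t\<^sup>2"
    using sum_squares_bound[of t \<tau>] zero_le_power2[of t] zero_le_power2[of \<tau>] by linarith
  then show ?thesis using assms by (simp add: field_simps power2_eq_square)
qed

text \<open>Passes from mean square to mean by \<open>t \<le> \<tau> + t\<^sup>2 / \<tau>\<close> in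
  place of Cauchy-Schwarz; this also yields integrability, and the factor 2 is harmless.\<close>

lemma (in prob_space) expectation_norm_le:
  fixes f :: "'a \<Rightarrow> 'v::{banach, second_countable_topology}"
  assumes f: "f \<in> borel_measurable M" and sq: "integrable M (\<lambda>w. (norm (f w))\<^sup>2)"
    and le: "expectation (\<lambda>w. (norm (f w))\<^sup>2) \<le> \<tau>\<^sup>2" and \<tau>: "0 < \<tau>"
  shows "integrable M (\<lambda>w. norm (f w))" "expectation (\<lambda>w. norm (f w)) \<le> 2 * \<tau>"
proof -
  have pt: "norm (f w) \<le> \<tau> + (norm (f w))\<^sup>2 / \<tau>" for w by (rule le_plus_square_div[OF \<tau>])
  have iR: "integrable M (\<lambda>w. \<tau> + (norm (f w))\<^sup>2 / \<tau>)" using sq by simp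
  show int: "integrable M (\<lambda>w. norm (f w))"
    by (rule Bochner_Integration.integrable_bound[OF iR]) (use f pt \<tau> in \<open>auto simp: abs_of_nonneg\<close>)
  have "expectation (\<lambda>w. norm (f w)) \<le> expectation (\<lambda>w. \<tau> + (norm (f w))\<^sup>2 / \<tau>)"
    using pt by (intro integral_mono int iR) auto
  also have "\<dots> = \<tau> + expectation (\<lambda>w. (norm (f w))\<^sup>2) / \<tau>" using sq by (simp add: prob_space)
  also have "\<dots> \<le> \<tau> + \<tau>\<^sup>2 / \<tau>" using le \<tau> by (intro add_left_mono divide_right_mono) auto
  finally show "expectation (\<lambda>w. norm (f w)) \<le> 2 * \<tau>" using \<tau> by (simp add: power2_eq_square)
qed

lemma ratio_stability:
  fixes x0 y0 :: real
  assumes "y0 \<noteq> 0" "0 < \<delta>"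
  obtains \<eta> where "0 < \<eta>" "\<And>x y. \<bar>x - x0\<bar> \<le> \<eta> \<Longrightarrow> \<bar>y - y0\<bar> \<le> \<eta> \<Longrightarrow> \<bar>x / y - x0 / y0\<bar> \<le> \<delta>"
proof -
  have "((\<lambda>p. fst p / snd p) \<longlongrightarrow> fst (x0, y0) / snd (x0, y0)) (nhds (x0, y0))"
    by (intro tendsto_divide tendsto_fst tendsto_snd filterlim_ident) (use assms in auto)
  then have "\<forall>\<^sub>F p in nhds (x0, y0). dist (fst p / snd p) (x0 / y0) < \<delta>"
    using assms by (auto dest: tendstoD)
  then obtain d where d: "0 < d" "\<And>p. dist p (x0, y0) < d \<Longrightarrow> dist (fst p / snd p) (x0 / y0) < \<delta>"
    unfolding eventually_nhds_metric by blast
  show ?thesis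
  proof (rule that[of "d / 3"])
    show "0 < d / 3" using d by simp
    fix x y assume "\<bar>x - x0\<bar> \<le> d / 3" "\<bar>y - y0\<bar> \<le> d / 3"
    moreover have "dist (x, y) (x0, y0) \<le> \<bar>x - x0\<bar> + \<bar>y - y0\<bar>"
      using sqrt_sum_squares_le_sum_abs[of "x - x0" "y - y0"] by (simp add: dist_Pair_Pair dist_real_def)
    ultimately have "dist (x, y) (x0, y0) < d" using d(1) by linarith
    from d(2)[OF this] show "\<bar>x / y - x0 / y0\<bar> \<le> \<delta>" by (simp add: dist_real_def)
  qed
qed

text \<open>The values \<open>u n i\<close> at the test points come from one forest and are
  therefore dependent over \<open>i\<close>, so the law of large numbers is applied only to the
  limits \<open>a i\<close> and \<open>a' i\<close>, and the forests are compared with these in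
  mean. The empirical variance is the mean of squares minus the square of the mean, so that three
  averages cover numerator and denominator.\<close>

lemma (in prob_space) importance_ratio_converges:
  fixes u v :: "nat \<Rightarrow> nat \<Rightarrow> 'a \<Rightarrow> 'h::{real_inner, banach, second_countable_topology}"
    and a a' :: "nat \<Rightarrow> 'a \<Rightarrow> 'h"
  assumes u [measurable]: "\<And>n i. 1 \<le> i \<Longrightarrow> u n i \<in> borel_measurable M"
    and v [measurable]: "\<And>n i. 1 \<le> i \<Longrightarrow> v n i \<in> borel_measurable M"
    and a [measurable]: "\<And>i. 1 \<le> i \<Longrightarrow> a i \<in> borel_measurable M"
    and a' [measurable]: "\<And>i. 1 \<le> i \<Longrightarrow> a' i \<in> borel_measurable M"
    and bd: "AE w in M. \<forall>i\<ge>1. norm (a i w) \<le> b \<and> norm (a' i w) \<le> b \<and> (\<forall>n. norm (u n i w) \<le> b \<and> norm (v n i w) \<le> b)"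
    and eu: "\<And>\<epsilon>. 0 < \<epsilon> \<Longrightarrow> \<forall>\<^sub>F n in sequentially. \<forall>i\<ge>1. expectation (\<lambda>w. (norm (u n i w - a i w))\<^sup>2) \<le> \<epsilon>"
    and ev: "\<And>\<epsilon>. 0 < \<epsilon> \<Longrightarrow> \<forall>\<^sub>F n in sequentially. \<forall>i\<ge>1. expectation (\<lambda>w. (norm (v n i w - a' i w))\<^sup>2) \<le> \<epsilon>"
    and ind1: "\<And>i j. 1 \<le> i \<Longrightarrow> 1 \<le> j \<Longrightarrow> i \<noteq> j \<Longrightarrow>
        indep_var borel (\<lambda>w. (norm (a i w - a' i w))\<^sup>2) borel (\<lambda>w. (norm (a j w - a' j w))\<^sup>2)"
    and ind2: "\<And>i j. 1 \<le> i \<Longrightarrow> 1 \<le> j \<Longrightarrow> i \<noteq> j \<Longrightarrow> indep_var borel (a i) borel (a j)"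
    and mean1: "\<And>i. 1 \<le> i \<Longrightarrow> expectation (\<lambda>w. (norm (a i w - a' i w))\<^sup>2) = num"
    and mean2: "\<And>i. 1 \<le> i \<Longrightarrow> expectation (\<lambda>w. (norm (a i w))\<^sup>2) = A2"
    and mean3: "\<And>i. 1 \<le> i \<Longrightarrow> expectation (a i) = A1"
    and den: "den = A2 - (norm A1)\<^sup>2" "den \<noteq> 0"
    and \<delta>: "0 < \<delta>"
  shows "(\<lambda>n. \<P>(w in M. \<bar>importance_ratio n (\<lambda>i. u n i w) (\<lambda>i. v n i w) - num / den\<bar> > \<delta>)) \<longlonglongrightarrow> 0"
proof -
  have b0: "0 \<le> b"
  proof -
    have "AE w in M. 0 \<le> b"
      using bd by eventually_elim (metis norm_ge_zero order_trans order_refl)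
    then show ?thesis by (simp add: prob_space)
  qed
  have [measurable]: "(\<lambda>w. \<Sum>i=1..n. g i w) \<in> borel_measurable M"
    if "\<And>i. 1 \<le> i \<Longrightarrow> g i \<in> borel_measurable M" for n and g :: "nat \<Rightarrow> 'a \<Rightarrow> 'b::{second_countable_topology, topological_comm_monoid_add}"
    using that by (intro borel_measurable_sum) auto
  define r where "r n w = (1 / real n) * (\<Sum>i=1..n. norm (u n i w - a i w) + norm (v n i w - a' i w))" for n w
  define Z1 where "Z1 n w = (1 / real n) * (\<Sum>i=1..n. (norm (a i w - a' i w))\<^sup>2) - num" for n w
  define Z2 where "Z2 n w = (1 / real n) * (\<Sum>i=1..n. (norm (a i w))\<^sup>2) - A2" for n w
  define Z3 where "Z3 n w = (1 / real n) *\<^sub>R (\<Sum>i=1..n. a i w) - A1" for n w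
  \<comment> \<open>One quantity dominating the errors of numerator and denominator at once. In the
    numerator \<open>4 * b\<close> arises from differences bounded by \<open>2 * b\<close>; in the
    denominator it is \<open>2 * b\<close> each for the mean of squares and for the squared
    mean.\<close>
  define H where "H n w = 4 * b * r n w + norm (Z1 n w) + norm (Z2 n w) + 2 * b * norm (Z3 n w)" for n w
  have sq_int: "integrable M (\<lambda>w. (norm (u n i w - a i w))\<^sup>2)" "integrable M (\<lambda>w. (norm (v n i w - a' i w))\<^sup>2)" if i: "1 \<le> i" for n i
  proof -
    have *: "(norm (x - y))\<^sup>2 \<le> (2 * b)\<^sup>2" if "norm x \<le> b" "norm y \<le> b" for x y :: 'h
      using that norm_triangle_ineq4[of x y] by (intro power_mono) auto
    have "AE w in M. norm ((norm (u n i w - a i w))\<^sup>2) \<le> (2 * b)\<^sup>2"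
      using bd by eventually_elim (use i * in auto)
    then show "integrable M (\<lambda>w. (norm (u n i w - a i w))\<^sup>2)"
      using u[OF i] a[OF i] by (intro integrable_const_bound) auto
    have "AE w in M. norm ((norm (v n i w - a' i w))\<^sup>2) \<le> (2 * b)\<^sup>2"
      using bd by eventually_elim (use i * in auto)
    then show "integrable M (\<lambda>w. (norm (v n i w - a' i w))\<^sup>2)"
      using v[OF i] a'[OF i] by (intro integrable_const_bound) auto
  qed
  have E_r: "\<forall>\<^sub>F n in sequentially. integrable M (r n) \<and> expectation (r n) \<le> 4 * \<tau>" if \<tau>: "0 < \<tau>" for \<tau>
    using eu[OF zero_less_power[OF \<tau>, of 2]] ev[OF zero_less_power[OF \<tau>, of 2]] eventually_gt_at_top[of 0]
  proof eventually_elim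
    case (elim n)
    have 1: "integrable M (\<lambda>w. norm (u n i w - a i w))" "expectation (\<lambda>w. norm (u n i w - a i w)) \<le> 2 * \<tau>"
      "integrable M (\<lambda>w. norm (v n i w - a' i w))" "expectation (\<lambda>w. norm (v n i w - a' i w)) \<le> 2 * \<tau>"
      if i: "i \<in> {1..n}" for i
      using expectation_norm_le[of "\<lambda>w. u n i w - a i w" \<tau>] expectation_norm_le[of "\<lambda>w. v n i w - a' i w" \<tau>]
        elim sq_int[of i n] i \<tau> by auto
    have 2: "integrable M (\<lambda>w. norm (u n i w - a i w) + norm (v n i w - a' i w))" if "i \<in> {1..n}" for i
      using 1[OF that] by simp
    have "expectation (r n) = (1 / real n) * (\<Sum>i=1..n. expectation (\<lambda>w. norm (u n i w - a i w) + norm (v n i w - a' i w)))"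
      unfolding r_def using 2 by (simp add: Bochner_Integration.integral_sum)
    also have "\<dots> \<le> (1 / real n) * (\<Sum>i=1..n. 4 * \<tau>)"
    proof (intro mult_left_mono sum_mono)
      fix i assume i: "i \<in> {1..n}"
      have "expectation (\<lambda>w. norm (u n i w - a i w) + norm (v n i w - a' i w)) =
          expectation (\<lambda>w. norm (u n i w - a i w)) + expectation (\<lambda>w. norm (v n i w - a' i w))"
        by (rule Bochner_Integration.integral_add[OF 1(1,3)[OF i]])
      then show "expectation (\<lambda>w. norm (u n i w - a i w) + norm (v n i w - a' i w)) \<le> 4 * \<tau>"
        using 1(2,4)[OF i] by linarith
    qed simp
    also have "\<dots> = 4 * \<tau>" using elim(3) by simp
    finally have "expectation (r n) \<le> 4 * \<tau>" .
    moreover have "integrable M (r n)"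
      unfolding r_def using 2 by (intro Bochner_Integration.integrable_mult_right Bochner_Integration.integrable_sum) auto
    ultimately show ?case by blast
  qed
  \<comment> \<open>The law of large numbers in mean, for a generic average because it is needed for
    two real averages and for one in the Hilbert space.\<close>
  have E_Z: "\<forall>\<^sub>F n in sequentially. integrable M (\<lambda>w. norm (Z n w)) \<and> expectation (\<lambda>w. norm (Z n w)) \<le> 2 * \<tau>"
    if \<tau>: "0 < \<tau>" and Z: "\<And>n w. Z n w = (1 / real n) *\<^sub>R (\<Sum>i=1..n. g i w) - e"
      and g: "\<And>i. 1 \<le> i \<Longrightarrow> g i \<in> borel_measurable M" and gb: "\<And>i. 1 \<le> i \<Longrightarrow> AE w in M. norm (g i w) \<le> B"
      and gi: "\<And>i j. 1 \<le> i \<Longrightarrow> 1 \<le> j \<Longrightarrow> i \<noteq> j \<Longrightarrow> indep_var borel (g i) borel (g j)"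
      and ge: "\<And>i. 1 \<le> i \<Longrightarrow> expectation (g i) = e"
    for \<tau> B and Z g :: "nat \<Rightarrow> 'a \<Rightarrow> 'k::{real_inner, banach, second_countable_topology}" and e
  proof -
    have "(\<lambda>n. 4 * B\<^sup>2 / real n) \<longlonglongrightarrow> 0" by real_asymp
    then have "\<forall>\<^sub>F n in sequentially. 4 * B\<^sup>2 / real n < \<tau>\<^sup>2" using \<tau> by (intro order_tendstoD) auto
    then show ?thesis
      using eventually_gt_at_top[of 0]
    proof eventually_elim
      case (elim n)
      have ne: "{1..n} \<noteq> {}" using elim(2) by simp
      have ms: "expectation (\<lambda>w. (norm (Z n w))\<^sup>2) \<le> 4 * B\<^sup>2 / real n" "integrable M (\<lambda>w. (norm (Z n w))\<^sup>2)"
        using mean_square_average[of "{1..n}" g B e, OF finite_atLeastAtMost ne] g gb gi ge by (auto simp: Z)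
      have Zm: "Z n \<in> borel_measurable M"
      proof -
        have "(\<lambda>w. \<Sum>i=1..n. g i w) \<in> borel_measurable M" using g by (intro borel_measurable_sum) auto
        then show ?thesis unfolding Z by measurable
      qed
      show ?case
        using expectation_norm_le[OF Zm ms(2) _ \<tau>] ms(1) elim(1) by auto
    qed
  qed
  have sqb: "AE w in M. norm ((norm (a i w - a' i w))\<^sup>2) \<le> (2 * b)\<^sup>2" "AE w in M. norm ((norm (a i w))\<^sup>2) \<le> (2 * b)\<^sup>2"
    "AE w in M. norm (a i w) \<le> b" if i: "1 \<le> i" for i
  proof -
    show "AE w in M. norm ((norm (a i w - a' i w))\<^sup>2) \<le> (2 * b)\<^sup>2"
      using bd
    proof eventually_elim
      case (elim w)
      then have "norm (a i w - a' i w) \<le> 2 * b" using i norm_triangle_ineq4[of "a i w" "a' i w"] by fastforce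
      then have "(norm (a i w - a' i w))\<^sup>2 \<le> (2 * b)\<^sup>2" by (intro power_mono) auto
      then show ?case by simp
    qed
    show "AE w in M. norm ((norm (a i w))\<^sup>2) \<le> (2 * b)\<^sup>2"
      using bd
    proof eventually_elim
      case (elim w)
      then have "norm (a i w) \<le> 2 * b" using i b0 by fastforce
      then have "(norm (a i w))\<^sup>2 \<le> (2 * b)\<^sup>2" by (intro power_mono) auto
      then show ?case by simp
    qed
    show "AE w in M. norm (a i w) \<le> b" using bd by eventually_elim (use i in auto)
  qed
  have ind2': "indep_var borel (\<lambda>w. (norm (a i w))\<^sup>2) borel (\<lambda>w. (norm (a j w))\<^sup>2)" if "1 \<le> i" "1 \<le> j" "i \<noteq> j" for i j
  proof -
    have m: "(\<lambda>x :: 'h. (norm x)\<^sup>2) \<in> borel_measurable borel" by measurable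
    show ?thesis using indep_var_compose[OF ind2[OF that] m m] by (simp add: o_def)
  qed
  have E_H: "\<forall>\<^sub>F n in sequentially. integrable M (H n) \<and> expectation (H n) \<le> (20 * b + 4) * \<tau>" if \<tau>: "0 < \<tau>" for \<tau>
  proof -
    have EZ1: "\<forall>\<^sub>F n in sequentially. integrable M (\<lambda>w. norm (Z1 n w)) \<and> expectation (\<lambda>w. norm (Z1 n w)) \<le> 2 * \<tau>"
    proof (rule E_Z[OF \<tau>])
      show "Z1 n w = (1 / real n) *\<^sub>R (\<Sum>i=1..n. (norm (a i w - a' i w))\<^sup>2) - num" for n w by (simp add: Z1_def)
      show "(\<lambda>w. (norm (a i w - a' i w))\<^sup>2) \<in> borel_measurable M" if "1 \<le> i" for i
        using a[OF that] a'[OF that] by measurable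
    qed (rule sqb(1) ind1 mean1; assumption)+
    have EZ2: "\<forall>\<^sub>F n in sequentially. integrable M (\<lambda>w. norm (Z2 n w)) \<and> expectation (\<lambda>w. norm (Z2 n w)) \<le> 2 * \<tau>"
    proof (rule E_Z[OF \<tau>])
      show "Z2 n w = (1 / real n) *\<^sub>R (\<Sum>i=1..n. (norm (a i w))\<^sup>2) - A2" for n w by (simp add: Z2_def)
      show "(\<lambda>w. (norm (a i w))\<^sup>2) \<in> borel_measurable M" if "1 \<le> i" for i
        using a[OF that] by measurable
    qed (rule sqb(2) ind2' mean2; assumption)+
    have EZ3: "\<forall>\<^sub>F n in sequentially. integrable M (\<lambda>w. norm (Z3 n w)) \<and> expectation (\<lambda>w. norm (Z3 n w)) \<le> 2 * \<tau>"
    proof (rule E_Z[OF \<tau>])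
      show "Z3 n w = (1 / real n) *\<^sub>R (\<Sum>i=1..n. a i w) - A1" for n w by (simp add: Z3_def)
    qed (rule a sqb(3) ind2 mean3; assumption)+
    show ?thesis
      using E_r[OF \<tau>] EZ1 EZ2 EZ3
    proof eventually_elim
      case (elim n)
      have int: "integrable M (\<lambda>w. 4 * b * r n w)" "integrable M (\<lambda>w. 2 * b * norm (Z3 n w))" using elim by auto
      have "expectation (H n) = 4 * b * expectation (r n) + expectation (\<lambda>w. norm (Z1 n w))
          + expectation (\<lambda>w. norm (Z2 n w)) + 2 * b * expectation (\<lambda>w. norm (Z3 n w))"
        unfolding H_def using elim int by simp
      also have "\<dots> \<le> 4 * b * (4 * \<tau>) + 2 * \<tau> + 2 * \<tau> + 2 * b * (2 * \<tau>)"
        using elim b0 by (intro add_mono mult_left_mono) auto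
      finally have "expectation (H n) \<le> (20 * b + 4) * \<tau>" by (simp add: algebra_simps)
      moreover have "integrable M (H n)" unfolding H_def using elim int by auto
      ultimately show ?case by blast
    qed
  qed
  \<comment> \<open>A distance within which the quotient is stable; this is where the denominator of
    the limit must not vanish.\<close>
  obtain \<eta> where \<eta>: "0 < \<eta>" "\<And>x y. \<bar>x - num\<bar> \<le> \<eta> \<Longrightarrow> \<bar>y - den\<bar> \<le> \<eta> \<Longrightarrow> \<bar>x / y - num / den\<bar> \<le> \<delta>"
    using ratio_stability[OF den(2) \<delta>] by metis
  let ?R = "\<lambda>n w. importance_ratio n (\<lambda>i. u n i w) (\<lambda>i. v n i w)"
  have dev: "AE w in M. \<delta> < \<bar>?R n w - num / den\<bar> \<longrightarrow> \<eta> \<le> H n w" if n: "0 < n" for n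
    using bd
  proof eventually_elim
    case (elim w)
    let ?ub = "(1 / real n) *\<^sub>R (\<Sum>i=1..n. u n i w)"
    define x where "x = (1 / real n) * (\<Sum>i=1..n. (norm (u n i w - v n i w))\<^sup>2)"
    define y where "y = (1 / real n) * (\<Sum>i=1..n. (norm (u n i w - ?ub))\<^sup>2)"
    have avg: "norm ((1 / real n) *\<^sub>R (\<Sum>i=1..n. f i)) \<le> (1 / real n) * (\<Sum>i=1..n. norm (f i))" for f :: "nat \<Rightarrow> 'k::real_normed_vector"
      using norm_sum[of f "{1..n}"] n by (simp add: divide_right_mono)
    have avg_b: "norm ((1 / real n) *\<^sub>R (\<Sum>i=1..n. f i)) \<le> b" if "\<And>i. 1 \<le> i \<Longrightarrow> norm (f i) \<le> b" for f :: "nat \<Rightarrow> 'h"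
    proof -
      have "(1 / real n) * (\<Sum>i=1..n. norm (f i)) \<le> (1 / real n) * (\<Sum>i=1..n. b)"
        using that by (intro mult_left_mono sum_mono) auto
      then show ?thesis using avg[of f] n by simp
    qed
    have r_ge: "(1 / real n) * (\<Sum>i=1..n. norm (u n i w - a i w)) \<le> r n w"
      unfolding r_def by (intro mult_left_mono sum_mono) auto
    have "\<bar>x - (1 / real n) * (\<Sum>i=1..n. (norm (a i w - a' i w))\<^sup>2)\<bar> \<le>
        (1 / real n) * (\<Sum>i=1..n. \<bar>(norm (u n i w - v n i w))\<^sup>2 - (norm (a i w - a' i w))\<^sup>2\<bar>)"
      using avg[of "\<lambda>i. (norm (u n i w - v n i w))\<^sup>2 - (norm (a i w - a' i w))\<^sup>2"]
      by (simp add: x_def sum_subtractf right_diff_distrib diff_divide_distrib)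
    also have "\<dots> \<le> (1 / real n) * (\<Sum>i=1..n. 4 * b * (norm (u n i w - a i w) + norm (v n i w - a' i w)))"
    proof (intro mult_left_mono sum_mono)
      fix i assume i: "i \<in> {1..n}"
      have le: "norm (u n i w - v n i w) \<le> 2 * b" "norm (a i w - a' i w) \<le> 2 * b"
      proof -
        have "norm (u n i w) \<le> b" "norm (v n i w) \<le> b" "norm (a i w) \<le> b" "norm (a' i w) \<le> b"
          using elim i by auto
        then show "norm (u n i w - v n i w) \<le> 2 * b" "norm (a i w - a' i w) \<le> 2 * b"
          using norm_triangle_ineq4[of "u n i w" "v n i w"] norm_triangle_ineq4[of "a i w" "a' i w"] by linarith+
      qed
      have "\<bar>(norm (u n i w - v n i w))\<^sup>2 - (norm (a i w - a' i w))\<^sup>2\<bar> \<le>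
          2 * (2 * b) * norm ((u n i w - v n i w) - (a i w - a' i w))"
        by (rule norm_power2_diff_le[OF le])
      also have "norm ((u n i w - v n i w) - (a i w - a' i w)) \<le> norm (u n i w - a i w) + norm (v n i w - a' i w)"
        using norm_triangle_ineq4[of "u n i w - a i w" "v n i w - a' i w"] by (simp add: algebra_simps)
      finally show "\<bar>(norm (u n i w - v n i w))\<^sup>2 - (norm (a i w - a' i w))\<^sup>2\<bar> \<le>
          4 * b * (norm (u n i w - a i w) + norm (v n i w - a' i w))"
        using b0 by (simp add: mult_left_mono)
    qed simp
    also have "\<dots> = 4 * b * r n w" by (simp add: r_def sum_distrib_left mult_ac)
    finally have x1: "\<bar>x - num\<bar> \<le> 4 * b * r n w + norm (Z1 n w)" unfolding Z1_def real_norm_def by linarith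
    have y_eq: "y = (1 / real n) * (\<Sum>i=1..n. (norm (u n i w))\<^sup>2) - (norm ?ub)\<^sup>2"
      using sum_square_deviation[of "{1..n}" "\<lambda>i. u n i w"] n by (simp add: y_def)
    have "\<bar>(1 / real n) * (\<Sum>i=1..n. (norm (u n i w))\<^sup>2) - (1 / real n) * (\<Sum>i=1..n. (norm (a i w))\<^sup>2)\<bar> \<le>
        (1 / real n) * (\<Sum>i=1..n. \<bar>(norm (u n i w))\<^sup>2 - (norm (a i w))\<^sup>2\<bar>)"
      using avg[of "\<lambda>i. (norm (u n i w))\<^sup>2 - (norm (a i w))\<^sup>2"]
      by (simp add: sum_subtractf right_diff_distrib diff_divide_distrib)
    also have "\<dots> \<le> (1 / real n) * (\<Sum>i=1..n. 2 * b * norm (u n i w - a i w))"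
      using elim by (intro mult_left_mono sum_mono norm_power2_diff_le) auto
    also have "\<dots> = 2 * b * ((1 / real n) * (\<Sum>i=1..n. norm (u n i w - a i w)))" by (simp add: sum_distrib_left mult_ac)
    also have "\<dots> \<le> 2 * b * r n w" using r_ge b0 by (intro mult_left_mono) auto
    finally have y1: "\<bar>(1 / real n) * (\<Sum>i=1..n. (norm (u n i w))\<^sup>2) - A2\<bar> \<le> 2 * b * r n w + norm (Z2 n w)"
      unfolding Z2_def real_norm_def by linarith
    have bA1: "norm A1 \<le> b"
    proof -
      have i: "integrable M (a 1)" using sqb(3)[of 1] by (intro integrable_const_bound) auto
      have "norm (expectation (a 1)) \<le> expectation (\<lambda>w. norm (a 1 w))" by (rule integral_norm_bound)
      also have "\<dots> \<le> expectation (\<lambda>_. b)" using i sqb(3)[of 1] by (intro integral_mono_AE) auto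
      finally show ?thesis using mean3[of 1] by (simp add: prob_space)
    qed
    have "\<bar>(norm ?ub)\<^sup>2 - (norm A1)\<^sup>2\<bar> \<le> 2 * b * norm (?ub - A1)"
      using elim bA1 by (intro norm_power2_diff_le avg_b) auto
    also have "norm (?ub - A1) \<le> r n w + norm (Z3 n w)"
    proof -
      have "?ub - A1 = (1 / real n) *\<^sub>R (\<Sum>i=1..n. u n i w - a i w) + Z3 n w"
        by (simp add: Z3_def sum_subtractf scaleR_diff_right)
      also have "norm \<dots> \<le> (1 / real n) * (\<Sum>i=1..n. norm (u n i w - a i w)) + norm (Z3 n w)"
        using avg[of "\<lambda>i. u n i w - a i w"] by (intro order_trans[OF norm_triangle_ineq]) auto
      finally show ?thesis using r_ge by linarith
    qed
    finally have y2: "\<bar>(norm ?ub)\<^sup>2 - (norm A1)\<^sup>2\<bar> \<le> 2 * b * (r n w + norm (Z3 n w))"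
      using b0 by (simp add: mult_left_mono)
    have y3: "\<bar>y - den\<bar> \<le> 4 * b * r n w + norm (Z2 n w) + 2 * b * norm (Z3 n w)"
    proof -
      have "2 * b * (r n w + norm (Z3 n w)) = 2 * b * r n w + 2 * b * norm (Z3 n w)" by (simp add: algebra_simps)
      then show ?thesis using y1 y2 unfolding y_eq den(1) by linarith
    qed
    have pos: "0 \<le> norm (Z1 n w)" "0 \<le> norm (Z2 n w)" "0 \<le> 2 * b * norm (Z3 n w)" using b0 by auto
    \<comment> \<open>The factors \<open>1 / real n\<close> cancel, so the ratio of sums is a ratio
      of averages.\<close>
    have "?R n w = x / y" using n by (simp add: importance_ratio_def x_def y_def)
    then show ?case
      using \<eta>(2)[of x y] x1 y3 pos unfolding H_def by (smt (verit, best))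
  qed
  show ?thesis
  proof (rule tendstoI)
    fix \<epsilon> :: real assume \<epsilon>: "0 < \<epsilon>"
    \<comment> \<open>Chosen so that Markov's inequality at level \<open>\<eta>\<close> yields
      \<open>\<epsilon> / 2\<close>.\<close>
    define \<tau> where "\<tau> = \<eta> * \<epsilon> / (2 * (20 * b + 4))"
    have \<tau>: "0 < \<tau>" using \<eta>(1) \<epsilon> b0 by (simp add: \<tau>_def)
    show "\<forall>\<^sub>F n in sequentially. dist (\<P>(w in M. \<delta> < \<bar>?R n w - num / den\<bar>)) 0 < \<epsilon>"
      using E_H[OF \<tau>] eventually_gt_at_top[of 0]
    proof eventually_elim
      case (elim n)
      have "integrable M (H n)" using elim(1) by blast
      then have [measurable]: "H n \<in> borel_measurable M" by (rule borel_measurable_integrable)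
      have Hm: "{w \<in> space M. \<eta> \<le> H n w} \<in> events" by measurable
      have "\<P>(w in M. \<delta> < \<bar>?R n w - num / den\<bar>) \<le> \<P>(w in M. \<eta> \<le> H n w)"
        using dev[OF elim(2)] Hm by (intro finite_measure_mono_AE) auto
      also have "\<dots> \<le> expectation (H n) / \<eta>"
      proof (rule integral_Markov_inequality_measure[where A = "{}"])
        show "AE w in M. 0 \<le> H n w"
        proof (rule AE_I2)
          fix w
          have "0 \<le> r n w" unfolding r_def by (intro mult_nonneg_nonneg sum_nonneg) auto
          then show "0 \<le> H n w" unfolding H_def using b0 by (intro add_nonneg_nonneg) auto
        qed
        show "integrable M (H n)" using elim(1) by blast
      qed (use \<eta>(1) in auto)
      also have "\<dots> \<le> (20 * b + 4) * \<tau> / \<eta>" using elim(1) \<eta>(1) by (intro divide_right_mono) auto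
      also have "\<dots> = \<epsilon> / 2"
      proof -
        have "t * (\<eta> * \<epsilon> / (2 * t)) / \<eta> = \<epsilon> / 2" if "0 < t" for t
          using that \<eta>(1) by simp
        from this[of "20 * b + 4"] b0 show ?thesis unfolding \<tau>_def by linarith
      qed
      also have "\<dots> < \<epsilon>" using \<epsilon> by simp
      finally show ?case by (simp add: dist_real_def)
    qed
  qed
qed

section \<open>Kernel sections\<close>

lemma
  fixes val :: "'h::{real_inner, banach, second_countable_topology} \<Rightarrow> 'y \<Rightarrow> real"
  assumes "rkhs_of k val"
  shows val_kernel_section: "val (kernel_section k val y) = k y"
    and val_eq_inner: "val f y = inner f (kernel_section k val y)"
proof -
  obtain h where h: "val h = k y" "\<And>f. val f y = inner f h"
    using assms unfolding rkhs_of_def by blast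
  have inj: "inj val" using assms unfolding rkhs_of_def by blast
  have "kernel_section k val y = h"
    unfolding kernel_section_def by (rule the_equality) (use h(1) inj in \<open>auto simp: inj_def\<close>)
  then show "val (kernel_section k val y) = k y" "val f y = inner f (kernel_section k val y)"
    using h by auto
qed

lemma inner_kernel_section:
  assumes "rkhs_of k val"
  shows "inner (kernel_section k val y) (kernel_section k val y') = k y y'"
  using val_eq_inner[OF assms, of "kernel_section k val y" y'] val_kernel_section[OF assms, of y] by simp

text \<open>The squared distance of two sections is a combination of four kernel values. Continuity
  then makes the responses measurable as elements of the Hilbert space.\<close>

lemma continuous_kernel_section:
  fixes k :: "'y::metric_space \<Rightarrow> 'y \<Rightarrow> real"
  assumes rk: "rkhs_of k val" and cont: "continuous_on UNIV (\<lambda>(y, y'). k y y')"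
  shows "continuous_on UNIV (kernel_section k val)"
proof -
  let ?s = "kernel_section k val"
  have dist: "(dist (?s y') (?s y))\<^sup>2 = k y' y' - k y' y - k y y' + k y y" for y y'
    by (simp add: dist_norm power2_norm_eq_inner inner_diff_left inner_diff_right inner_kernel_section[OF rk])
  have ck: "continuous_on UNIV (\<lambda>y'. k (f y') (g y'))" if "continuous_on UNIV f" "continuous_on UNIV g" for f g :: "'y \<Rightarrow> 'y"
    using continuous_on_compose2[OF cont continuous_on_Pair[OF that]] by simp
  have "isCont ?s y" for y
  proof -
    have "continuous_on UNIV (\<lambda>y'. k y' y' - k y' y - k y y' + k y y)"
      by (intro continuous_intros ck)
    then have "isCont (\<lambda>y'. k y' y' - k y' y - k y y' + k y y) y"
      by (simp add: continuous_on_eq_continuous_at)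
    then have "((\<lambda>y'. (dist (?s y') (?s y))\<^sup>2) \<longlongrightarrow> 0) (at y)"
      unfolding dist by (simp add: isCont_def)
    then have "((\<lambda>y'. sqrt ((dist (?s y') (?s y))\<^sup>2)) \<longlongrightarrow> sqrt 0) (at y)"
      by (rule tendsto_real_sqrt)
    then have "((\<lambda>y'. dist (?s y') (?s y)) \<longlongrightarrow> 0) (at y)" by simp
    then show ?thesis unfolding isCont_def by (rule tendsto_dist_iff[THEN iffD2])
  qed
  then show ?thesis by (simp add: continuous_on_eq_continuous_at)
qed

lemma kernel_section_bounded:
  fixes k :: "'y \<Rightarrow> 'y \<Rightarrow> real"
  assumes rk: "rkhs_of k val" and bd: "bounded (range (\<lambda>(y, y'). k y y'))"
  obtains b where "\<And>y. norm (kernel_section k val y) \<le> b"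
proof -
  obtain B where B: "\<And>y y'. \<bar>k y y'\<bar> \<le> B"
    using bd unfolding bounded_iff by auto
  have "norm (kernel_section k val y) \<le> sqrt B" for y
  proof -
    have "(norm (kernel_section k val y))\<^sup>2 \<le> B"
      using B[of y y] by (simp add: power2_norm_eq_inner inner_kernel_section[OF rk])
    then show ?thesis by (rule real_le_rsqrt)
  qed
  then show ?thesis by (rule that)
qed

section \<open>The law of the inputs\<close>

lemma emeasure_lborel_hbox:
  assumes F: "finite F" and valid: "valid_box F lo hi"
  shows "emeasure (PiM F (\<lambda>_. lborel)) (hbox F lo hi) = ennreal (box_vol F lo hi)"
proof -
  interpret product_sigma_finite "\<lambda>_ :: nat. lborel :: real measure" by unfold_locales
  have "emeasure (PiM F (\<lambda>_. lborel)) (hbox F lo hi) = (\<Prod>l\<in>F. emeasure lborel {lo l<..hi l})"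
    unfolding hbox_def using F by (intro emeasure_PiM) auto
  also have "\<dots> = (\<Prod>l\<in>F. ennreal (hi l - lo l))"
    using valid by (intro prod.cong refl) (auto simp: valid_box_def)
  also have "\<dots> = ennreal (box_vol F lo hi)"
    unfolding box_vol_def using valid by (intro prod_ennreal) (auto simp: valid_box_def)
  finally show ?thesis .
qed

text \<open>The mass of a box is an integral of the density, squeezed between \<open>c\<close> and
  \<open>C\<close> times the volume. The density is supported by the closed cube; removing its faces
  through 0, which are null sets, gives the half-open cube on which the other arguments take
  place.\<close>

lemma density_box_bounds:
  assumes M: "prob_space M" and F: "finite F" and dens: "has_bounded_cube_density M F X"
  obtains c C where "0 < c"
    "\<And>lo hi. valid_box F lo hi \<Longrightarrow> c * box_vol F lo hi \<le> measure M {w \<in> space M. X w \<in> hbox F lo hi} \<and>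
        measure M {w \<in> space M. X w \<in> hbox F lo hi} \<le> C * box_vol F lo hi"
    "AE w in M. X w \<in> cube F"
proof -
  interpret M: prob_space M by (rule M)
  let ?L = "PiM F (\<lambda>_. lborel :: real measure)"
  obtain f c C where c: "0 < c" and dist: "distributed M ?L X (\<lambda>x. ennreal (f x))"
    and fb: "\<And>x. x \<in> unit_cube F \<Longrightarrow> c \<le> f x \<and> f x \<le> C" and f0: "\<And>x. x \<notin> unit_cube F \<Longrightarrow> f x = 0"
    using dens unfolding has_bounded_cube_density_def by blast
  have X: "X \<in> measurable M ?L" using dist by (rule distributed_measurable)
  have fm: "(\<lambda>x. ennreal (f x)) \<in> borel_measurable ?L" using dist by (rule distributed_borel_measurable)
  have sets_L: "sets ?L = sets (input_space F)" by (intro sets_PiM_cong) auto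
  have emeas: "emeasure M {w \<in> space M. X w \<in> A} = (\<integral>\<^sup>+x. ennreal (f x) * indicator A x \<partial>?L)" if A: "A \<in> sets ?L" for A
  proof -
    have "emeasure M {w \<in> space M. X w \<in> A} = emeasure (distr M ?L X) A"
      using X A by (subst emeasure_distr) (auto intro!: arg_cong[where f = "emeasure M"])
    also have "\<dots> = emeasure (density ?L (\<lambda>x. ennreal (f x))) A"
      using dist by (simp add: distributed_def)
    also have "\<dots> = (\<integral>\<^sup>+x. ennreal (f x) * indicator A x \<partial>?L)"
      using fm A by (rule emeasure_density)
    finally show ?thesis .
  qed
  have sub: "hbox F lo hi \<subseteq> unit_cube F" if "valid_box F lo hi" for lo hi
    using that by (fastforce simp: hbox_iff unit_cube_def PiE_iff valid_box_def)
  \<comment> \<open>The definition of the density bounds leaves the sign of \<open>C\<close> open;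
    any point of the cube settles it.\<close>
  have C: "0 \<le> C"
  proof -
    have "(\<lambda>l\<in>F. 0) \<in> unit_cube F" by (auto simp: unit_cube_def)
    then show ?thesis using fb[of "\<lambda>l\<in>F. 0"] c by linarith
  qed
  have bounds: "c * box_vol F lo hi \<le> measure M {w \<in> space M. X w \<in> hbox F lo hi} \<and>
        measure M {w \<in> space M. X w \<in> hbox F lo hi} \<le> C * box_vol F lo hi" if valid: "valid_box F lo hi" for lo hi
  proof -
    let ?B = "hbox F lo hi"
    have B: "?B \<in> sets ?L" using hbox_sets[OF F] sets_L by simp
    have vol0: "0 \<le> box_vol F lo hi"
      unfolding box_vol_def using valid by (intro prod_nonneg) (auto simp: valid_box_def)
    have "ennreal (c * box_vol F lo hi) = (\<integral>\<^sup>+x. ennreal c * indicator ?B x \<partial>?L)"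
      using B c vol0 emeasure_lborel_hbox[OF F valid] by (simp add: nn_integral_cmult_indicator ennreal_mult)
    also have "\<dots> \<le> (\<integral>\<^sup>+x. ennreal (f x) * indicator ?B x \<partial>?L)"
      using fb sub[OF valid] by (intro nn_integral_mono) (auto simp: indicator_def intro!: ennreal_leI)
    also have "\<dots> = ennreal (measure M {w \<in> space M. X w \<in> ?B})"
      using emeas[OF B] by (simp add: M.emeasure_eq_measure)
    finally have 1: "c * box_vol F lo hi \<le> measure M {w \<in> space M. X w \<in> ?B}" by simp
    have "ennreal (measure M {w \<in> space M. X w \<in> ?B}) = (\<integral>\<^sup>+x. ennreal (f x) * indicator ?B x \<partial>?L)"
      using emeas[OF B] by (simp add: M.emeasure_eq_measure)
    also have "\<dots> \<le> (\<integral>\<^sup>+x. ennreal C * indicator ?B x \<partial>?L)"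
      using fb sub[OF valid] by (intro nn_integral_mono) (auto simp: indicator_def intro!: ennreal_leI)
    also have "\<dots> = ennreal (C * box_vol F lo hi)"
      using B C vol0 emeasure_lborel_hbox[OF F valid] by (simp add: nn_integral_cmult_indicator ennreal_mult)
    finally have 2: "measure M {w \<in> space M. X w \<in> ?B} \<le> C * box_vol F lo hi"
      using C vol0 by (simp add: ennreal_le_iff)
    show ?thesis using 1 2 by simp
  qed
  have "AE w in M. X w \<in> cube F"
  proof -
    interpret L: product_sigma_finite "\<lambda>_ :: nat. lborel :: real measure" by unfold_locales
    let ?Z = "\<lambda>l. PiE F (\<lambda>i. if i = l then {0} else {0..1 :: real})"
    have Z0: "?Z l \<in> null_sets ?L" if l: "l \<in> F" for l
    proof -
      have "emeasure ?L (?Z l) = (\<Prod>i\<in>F. emeasure lborel (if i = l then {0} else {0..1 :: real}))"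
        using F by (intro L.emeasure_PiM) auto
      also have "\<dots> = 0" using F l by (intro prod_zero) (auto intro!: bexI[of _ l])
      finally show ?thesis using F by (auto simp: null_sets_def intro!: sets_PiM_I_finite)
    qed
    have "AE x in ?L. \<forall>l\<in>F. x \<notin> ?Z l"
      using F Z0 by (intro AE_finite_allI AE_not_in) auto
    then have "AE x in ?L. 0 < ennreal (f x) \<longrightarrow> x \<in> cube F"
    proof eventually_elim
      case (elim x)
      show ?case
      proof
        assume "0 < ennreal (f x)"
        then have x: "x \<in> unit_cube F" using f0[of x] by (cases "x \<in> unit_cube F") auto
        have "0 < x l" if "l \<in> F" for l
        proof (rule ccontr)
          assume "\<not> 0 < x l"
          then have "x l = 0" using x that by (auto simp: unit_cube_def PiE_iff intro!: antisym)
          then have "x \<in> ?Z l" using x by (auto simp: unit_cube_def PiE_iff)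
          then show False using elim that by blast
        qed
        then show "x \<in> cube F" using x by (auto simp: hbox_iff unit_cube_def PiE_iff)
      qed
    qed
    then have "AE x in density ?L (\<lambda>x. ennreal (f x)). x \<in> cube F"
      using fm by (simp add: AE_density)
    moreover have "distr M ?L X = density ?L (\<lambda>x. ennreal (f x))" using dist unfolding distributed_def by blast
    ultimately have "AE x in distr M ?L X. x \<in> cube F" by (simp only:)
    then show ?thesis by (rule AE_distrD[OF X])
  qed
  then show ?thesis using that[OF c bounds] by blast
qed

text \<open>No marginal density is computed for the reduced inputs: a box in the features
  \<open>F\<close> is extended by full sides in the remaining ones, which changes neither its mass
  nor its volume, so the constants of the full density serve again. Boundedness of \<open>m\<close>
  on the cube comes from its Lipschitz property. \<open>W\<close> is tied to \<open>X\<close> on the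
  sample space only, so that it can be \<open>X\<close> itself as well as a restriction.\<close>

lemma forest_law_of_data:
  fixes V :: "'w \<Rightarrow> 'h::{real_inner, banach, second_countable_topology}"
  assumes M: "prob_space M" and S: "finite S" "F \<subseteq> S" and dens: "has_bounded_cube_density M S X"
    and W: "\<And>w. w \<in> space M \<Longrightarrow> W w = restrict (X w) F"
    and V: "V \<in> borel_measurable M" "\<And>w. norm (V w) \<le> b0"
    and reg: "regression_function M (input_space F) W V m" and lip: "lipschitz_on_cube F m"
  obtains b L c C where "b0 \<le> b" "forest_law F (distr M (input_space F \<Otimes>\<^sub>M borel) (\<lambda>w. (W w, V w))) m b L c C"
proof -
  interpret M: prob_space M by (rule M)
  have F: "finite F" using S finite_subset by blast
  obtain c C where c: "0 < c" and box: "\<And>lo hi. valid_box S lo hi \<Longrightarrow>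
       c * box_vol S lo hi \<le> measure M {w \<in> space M. X w \<in> hbox S lo hi} \<and>
        measure M {w \<in> space M. X w \<in> hbox S lo hi} \<le> C * box_vol S lo hi"
    and cube_S: "AE w in M. X w \<in> cube S"
    by (rule density_box_bounds[OF M S(1) dens]) blast
  have Wm [measurable]: "W \<in> measurable M (input_space F)" and mm [measurable]: "m \<in> borel_measurable (input_space F)"
    and ce: "has_cond_exp M (sigma_of M W (input_space F)) V (\<lambda>w. m (W w))"
    using reg unfolding regression_function_def by auto
  note [measurable] = V(1)
  obtain L0 where L0: "\<And>x x'. x \<in> unit_cube F \<Longrightarrow> x' \<in> unit_cube F \<Longrightarrow>
      norm (m x - m x') \<le> L0 * L2_set (\<lambda>i. x i - x' i) F"
    using lip unfolding lipschitz_on_cube_def by blast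
  \<comment> \<open>The Lipschitz constant in the assumption may be negative. The Euclidean distance
    is then replaced by the larger sum of coordinate distances, which the side lengths of a leaf
    control.\<close>
  define L where "L = \<bar>L0\<bar>"
  have lip': "norm (m x - m y) \<le> L * (\<Sum>l\<in>F. \<bar>x l - y l\<bar>)" if "x \<in> cube F" "y \<in> cube F" for x y
  proof -
    have "norm (m x - m y) \<le> L0 * L2_set (\<lambda>i. x i - y i) F"
      using that cube_subset_unit_cube by (intro L0) auto
    also have "\<dots> \<le> L * L2_set (\<lambda>i. x i - y i) F"
      by (intro mult_right_mono) (auto simp: L_def L2_set_nonneg)
    also have "\<dots> \<le> L * (\<Sum>l\<in>F. \<bar>x l - y l\<bar>)"
      by (intro mult_left_mono L2_set_le_sum_abs) (auto simp: L_def)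
    finally show ?thesis .
  qed
  \<comment> \<open>The upper corner, which the half-open cube contains, serves as reference point;
    in each coordinate it is at distance at most 1 from any point of the cube.\<close>
  define x0 :: input where "x0 = (\<lambda>l\<in>F. 1)"
  define b where "b = max b0 (norm (m x0) + L * real (card F))"
  have mb: "norm (m x) \<le> b" if x: "x \<in> cube F" for x
  proof -
    have "norm (m x - m x0) \<le> L * (\<Sum>l\<in>F. \<bar>x l - x0 l\<bar>)"
      using x by (intro lip') (auto simp: x0_def hbox_iff)
    also have "\<dots> \<le> L * (\<Sum>l\<in>F. 1)"
      using x by (intro mult_left_mono sum_mono) (auto simp: L_def x0_def hbox_iff)
    finally have "norm (m x - m x0) \<le> L * real (card F)" by simp
    then have "norm (m x) \<le> norm (m x0) + L * real (card F)"
      using norm_triangle_sub[of "m x" "m x0"] by linarith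
    then show ?thesis by (simp add: b_def)
  qed
  let ?N = "input_space F \<Otimes>\<^sub>M (borel :: 'h measure)"
  let ?Q = "distr M ?N (\<lambda>w. (W w, V w))"
  have pm [measurable]: "(\<lambda>w. (W w, V w)) \<in> measurable M ?N" by measurable
  have cube_F: "AE w in M. W w \<in> cube F"
    using cube_S AE_space
    by eventually_elim (use S W in \<open>auto simp: hbox_iff\<close>)
  have hm [measurable]: "hbox F lo hi \<in> sets (input_space F)" for lo hi using F by simp
  have "forest_law F ?Q m b L c C"
  proof (rule forest_law.intro)
    show "finite F" by (rule F)
    show "prob_space ?Q" by (rule M.prob_space_distr) simp
    show "sets ?Q = sets ?N" by simp
    show "AE q in ?Q. norm (snd q) \<le> b"
      by (subst AE_distr_iff) (auto intro!: AE_I2 order_trans[OF V(2)] simp: b_def)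
    show "AE q in ?Q. fst q \<in> cube F"
      using cube_F by (subst AE_distr_iff) auto
    show "m \<in> borel_measurable (input_space F)" by (rule mm)
    show "norm (m x) \<le> b" if "x \<in> cube F" for x using mb[OF that] .
    show "norm (m x - m y) \<le> L * (\<Sum>l\<in>F. \<bar>x l - y l\<bar>)" if "x \<in> cube F" "y \<in> cube F" for x y
      using lip'[OF that] .
    show "0 \<le> L" by (simp add: L_def)
    show "0 < c" by (rule c)
    show "(\<integral>q. indicator A (fst q) *\<^sub>R snd q \<partial>?Q) = (\<integral>q. indicator A (fst q) *\<^sub>R m (fst q) \<partial>?Q)"
      if A [measurable]: "A \<in> sets (input_space F)" for A
    proof -
      have "W -` A \<inter> space M \<in> sets (sigma_of M W (input_space F))"
        using A unfolding sigma_of_def by (rule in_vimage_algebra)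
      then have eq: "(\<integral>w\<in>W -` A \<inter> space M. V w \<partial>M) = (\<integral>w\<in>W -` A \<inter> space M. m (W w) \<partial>M)"
        using ce unfolding has_cond_exp_def by blast
      have ind: "(\<integral>w. indicator A (W w) *\<^sub>R g w \<partial>M) = (\<integral>w\<in>W -` A \<inter> space M. g w \<partial>M)" for g :: "'w \<Rightarrow> 'h"
        unfolding set_lebesgue_integral_def by (intro Bochner_Integration.integral_cong) (auto simp: indicator_def)
      have "(\<integral>q. indicator A (fst q) *\<^sub>R snd q \<partial>?Q) = (\<integral>w. indicator A (W w) *\<^sub>R V w \<partial>M)"
        by (subst integral_distr) auto
      also have "\<dots> = (\<integral>w. indicator A (W w) *\<^sub>R m (W w) \<partial>M)" unfolding ind by (rule eq)
      also have "\<dots> = (\<integral>q. indicator A (fst q) *\<^sub>R m (fst q) \<partial>?Q)"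
        by (subst integral_distr) auto
      finally show ?thesis .
    qed
    fix lo hi assume valid: "valid_box F lo hi"
    let ?lo = "\<lambda>l. if l \<in> F then lo l else 0" and ?hi = "\<lambda>l. if l \<in> F then hi l else 1"
    have valid': "valid_box S ?lo ?hi" using valid by (auto simp: valid_box_def)
    have vol: "box_vol S ?lo ?hi = box_vol F lo hi"
      unfolding box_vol_def using S by (intro prod.mono_neutral_cong_right) auto
    have Xm: "X \<in> measurable M (input_space S)"
    proof -
      obtain f :: "input \<Rightarrow> real" where "distributed M (PiM S (\<lambda>_. lborel)) X (\<lambda>x. ennreal (f x))"
        using dens unfolding has_bounded_cube_density_def by blast
      then have "X \<in> measurable M (PiM S (\<lambda>_. lborel))" by (rule distributed_measurable)
      moreover have "sets (PiM S (\<lambda>_. lborel :: real measure)) = sets (input_space S)"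
        by (intro sets_PiM_cong) auto
      ultimately show ?thesis by (simp cong: measurable_cong_sets)
    qed
    have hS: "hbox S ?lo ?hi \<in> sets (input_space S)" using S(1) by (rule hbox_sets)
    have "measure ?Q {q \<in> space ?Q. fst q \<in> hbox F lo hi} = measure M {w \<in> space M. W w \<in> hbox F lo hi}"
    proof (subst measure_distr)
      have "{q \<in> space ?Q. fst q \<in> hbox F lo hi} = fst -` hbox F lo hi \<inter> space ?N" by auto
      then show "{q \<in> space ?Q. fst q \<in> hbox F lo hi} \<in> sets ?N"
        using measurable_sets[OF measurable_fst hm] by (simp only:)
      show "measure M ((\<lambda>w. (W w, V w)) -` {q \<in> space ?Q. fst q \<in> hbox F lo hi} \<inter> space M) =
          measure M {w \<in> space M. W w \<in> hbox F lo hi}"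
        using measurable_space[OF pm] by (intro arg_cong[where f = "measure M"]) auto
    qed simp
    also have "\<dots> = measure M {w \<in> space M. X w \<in> hbox S ?lo ?hi}"
    proof (rule M.finite_measure_eq_AE)
      show "AE w in M. (w \<in> {w \<in> space M. W w \<in> hbox F lo hi}) = (w \<in> {w \<in> space M. X w \<in> hbox S ?lo ?hi})"
        using cube_S AE_space by eventually_elim (use S W in \<open>auto simp: hbox_iff subset_iff split: if_splits\<close>)
      show "{w \<in> space M. W w \<in> hbox F lo hi} \<in> M.events" by measurable
      show "{w \<in> space M. X w \<in> hbox S ?lo ?hi} \<in> M.events"
        using Xm hS by measurable
    qed
    finally show "c * box_vol F lo hi \<le> measure ?Q {q \<in> space ?Q. fst q \<in> hbox F lo hi} \<and>
        measure ?Q {q \<in> space ?Q. fst q \<in> hbox F lo hi} \<le> C * box_vol F lo hi"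
      using box[OF valid'] vol by simp
  qed
  moreover have "b0 \<le> b" by (simp add: b_def)
  ultimately show ?thesis using that by blast
qed

section \<open>Conditional expectations in Hilbert space\<close>

text \<open>\<open>cond_expectation\<close> picks an arbitrary version, so versions have to be
  compared. Integrating the difference \<open>D\<close> over the set where
  \<open>inner (D w) h\<close> is positive shows that this set is null, for each \<open>h\<close>
  separately. By separability the exceptional sets can be united over a countable dense set, which
  is enough to force \<open>D w = 0\<close>.\<close>

lemma (in prob_space) has_cond_exp_unique:
  fixes f g1 g2 :: "'a \<Rightarrow> 'h::{real_inner, banach, second_countable_topology}"
  assumes g1: "has_cond_exp M G f g1" and g2: "has_cond_exp M G f g2"
  shows "AE w in M. g1 w = g2 w"
proof -
  define D where "D w = g1 w - g2 w" for w
  have sub: "subalgebra M G" and int: "integrable M g1" "integrable M g2"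
    and meas: "g1 \<in> borel_measurable G" "g2 \<in> borel_measurable G"
    using g1 g2 unfolding has_cond_exp_def by auto
  have DG: "D \<in> borel_measurable G" unfolding D_def[abs_def] using meas by measurable
  have intD: "integrable M D" unfolding D_def[abs_def] using int by simp
  have zero: "(\<integral>w\<in>A. D w \<partial>M) = 0" if A: "A \<in> sets G" for A
  proof -
    have AM: "A \<in> sets M" using A sub unfolding subalgebra_def by blast
    have "(\<integral>w\<in>A. g1 w \<partial>M) = (\<integral>w\<in>A. g2 w \<partial>M)"
      using g1 g2 A unfolding has_cond_exp_def by metis
    moreover have "set_integrable M A g1" "set_integrable M A g2"
      unfolding set_integrable_def using int AM by (auto intro: integrable_mult_indicator)
    ultimately show ?thesis unfolding D_def by (simp add: set_integral_diff)
  qed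
  have nonpos: "AE w in M. inner (D w) h \<le> 0" for h
  proof -
    let ?A = "{w \<in> space G. 0 < inner (D w) h}"
    have A: "?A \<in> sets G" using DG by measurable
    have AM: "?A \<in> sets M" using A sub unfolding subalgebra_def by blast
    have sp: "space G = space M" using sub unfolding subalgebra_def by blast
    have iA: "integrable M (\<lambda>w. indicator ?A w *\<^sub>R D w)" using intD AM by (rule integrable_mult_indicator[rotated])
    have "(\<integral>w. inner (indicator ?A w *\<^sub>R D w) h \<partial>M) = inner (\<integral>w\<in>?A. D w \<partial>M) h"
      unfolding set_lebesgue_integral_def by (rule integral_inner_left) (rule iA)
    then have "(\<integral>w. inner (indicator ?A w *\<^sub>R D w) h \<partial>M) = 0" using zero[OF A] by simp
    moreover have nn: "0 \<le> inner (indicator ?A w *\<^sub>R D w) h" for w by (simp add: indicator_def)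
    moreover have "integrable M (\<lambda>w. inner (indicator ?A w *\<^sub>R D w) h)"
      by (rule integrable_inner_left) (rule iA)
    ultimately have "AE w in M. inner (indicator ?A w *\<^sub>R D w) h = 0"
      using integral_nonneg_eq_0_iff_AE[of M "\<lambda>w. inner (indicator ?A w *\<^sub>R D w) h"] by simp
    then show ?thesis using AE_space
    proof eventually_elim
      case (elim w)
      then show ?case using sp by (cases "0 < inner (D w) h") auto
    qed
  qed
  obtain T :: "'h set" where T: "countable T" "\<And>X. open X \<Longrightarrow> X \<noteq> {} \<Longrightarrow> \<exists>d\<in>T. d \<in> X"
    using countable_dense_setE by blast
  have "AE w in M. \<forall>h\<in>T. inner (D w) h \<le> 0"
    using T(1) nonpos by (simp add: AE_ball_countable)
  then have "AE w in M. D w = 0"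
  proof eventually_elim
    case (elim w)
    show ?case
    proof (rule ccontr)
      assume nz: "D w \<noteq> 0"
      \<comment> \<open>A dense point that is closer to \<open>D w\<close> than the origin is has a
        positive inner product with \<open>D w\<close>, so one sign of the inequality
        suffices.\<close>
      have "\<exists>d\<in>T. d \<in> ball (D w) (norm (D w))" using nz by (intro T(2)) auto
      then obtain h where h: "h \<in> T" "norm (D w - h) < norm (D w)" by (auto simp: dist_norm)
      have "norm (D w) * norm (D w) = inner (D w) h + inner (D w) (D w - h)"
        by (simp add: inner_diff_right power2_norm_eq_inner[symmetric] power2_eq_square)
      also have "\<dots> \<le> 0 + norm (D w) * norm (D w - h)"
        using elim h(1) by (intro add_mono norm_cauchy_schwarz) auto
      also have "\<dots> < norm (D w) * norm (D w)" using h(2) nz by simp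
      finally show False by simp
    qed
  qed
  then show ?thesis by eventually_elim (simp add: D_def)
qed

text \<open>As \<open>W'\<close> is a function of \<open>W\<close>, its \<sigma>-algebra is the
  smaller one, and on its sets the integrals of \<open>f\<close>, of \<open>m1 (W w)\<close> and of
  \<open>g\<close> all agree. This makes the regression on fewer features the conditional mean of
  the full regression function.\<close>

lemma has_cond_exp_tower:
  assumes W: "W \<in> measurable M N" "m1 \<in> borel_measurable N" and r: "r \<in> measurable N N'"
    and W': "\<And>w. w \<in> space M \<Longrightarrow> W' w = r (W w)"
    and 1: "has_cond_exp M (sigma_of M W N) f (\<lambda>w. m1 (W w))"
    and 2: "has_cond_exp M (sigma_of M W' N') f g"
  shows "has_cond_exp M (sigma_of M W' N') (\<lambda>w. m1 (W w)) g"
proof -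
  have sub: "A \<in> sets (sigma_of M W N)" if A: "A \<in> sets (sigma_of M W' N')" for A
  proof -
    have W'm: "W' \<in> space M \<rightarrow> space N'"
      using measurable_space[OF W(1)] measurable_space[OF r] W' by auto
    obtain B where B: "B \<in> sets N'" "A = W' -` B \<inter> space M"
      using A unfolding sigma_of_def sets_vimage_algebra2[OF W'm] by auto
    have "A = W -` (r -` B \<inter> space N) \<inter> space M"
      using B(2) W' measurable_space[OF W(1)] by auto
    then show ?thesis
      unfolding sigma_of_def using in_vimage_algebra[OF measurable_sets[OF r B(1)], of W "space M"] by simp
  qed
  show ?thesis
    using 1 2 sub unfolding has_cond_exp_def by metis
qed

section \<open>The forest as a random function\<close>

lemma infinite_forest_restrict: "infinite_forest P s n (restrict D {1..n}) x = infinite_forest P s n D x"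
proof -
  have "subsample (restrict D {1..n}) I = subsample D I" if "I \<subseteq> {1..n}" for I
  proof -
    have "finite I" using that finite_subset by blast
    then have "sorted_list_of_set I ! i \<in> {1..n}" if "i < card I" for i
      using sorted_list_of_set_nth_mem[OF _ that] \<open>I \<subseteq> {1..n}\<close> by blast
    then show ?thesis unfolding subsample_def by (intro restrict_ext) auto
  qed
  then show ?thesis
    unfolding infinite_forest_def by (intro arg_cong2[where f = scaleR] refl sum.cong) auto
qed

text \<open>Weights of total mass at most 1 keep the bound. No measurability is asked of the data: a
  tree output that is not integrable contributes 0, and when \<open>n choose s\<close> is 0 the
  forest is 0.\<close>

lemma norm_infinite_forest_le:
  fixes P :: "('e, 'h::{banach, second_countable_topology}) tree_procedure"
  assumes R: "prob_space (rand P)" and D: "\<And>i. i \<in> {1..n} \<Longrightarrow> norm (snd (D i)) \<le> b" and b: "0 \<le> b"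
  shows "norm (infinite_forest P s n D x) \<le> b"
proof -
  interpret R: prob_space "rand P" by (rule R)
  have tree: "norm (tree_output P s x e (subsample D I)) \<le> b" if I: "I \<in> subsamples n s" for e I
  proof -
    have fin: "finite I" using I finite_subset by blast
    have "norm (snd (subsample D I i)) \<le> b" if "i < s" for i
      using I sorted_list_of_set_nth_mem[OF fin, of i] that D by (auto simp: subsample_def subset_iff)
    then show ?thesis unfolding tree_output_eq using b by (rule norm_leaf_average_le)
  qed
  have int: "norm (\<integral>e. tree_output P s x e (subsample D I) \<partial>rand P) \<le> b" if I: "I \<in> subsamples n s" for I
  proof (cases "integrable (rand P) (\<lambda>e. tree_output P s x e (subsample D I))")
    case True
    have "norm (\<integral>e. tree_output P s x e (subsample D I) \<partial>rand P) \<le> (\<integral>e. norm (tree_output P s x e (subsample D I)) \<partial>rand P)"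
      by (rule integral_norm_bound)
    also have "\<dots> \<le> (\<integral>e. b \<partial>rand P)"
      using True tree[OF I] by (intro integral_mono) auto
    finally show ?thesis by (simp add: R.prob_space)
  qed (simp add: not_integrable_integral_eq b)
  have card: "card (subsamples n s) = n choose s" using n_subsets[of "{1..n}" s] by simp
  have "norm (\<Sum>I\<in>subsamples n s. \<integral>e. tree_output P s x e (subsample D I) \<partial>rand P) \<le> (\<Sum>I\<in>subsamples n s. b)"
    using int by (intro sum_norm_le)
  then have "norm (\<Sum>I\<in>subsamples n s. \<integral>e. tree_output P s x e (subsample D I) \<partial>rand P) \<le> real (n choose s) * b"
    using card by simp
  then show ?thesis
    using b by (cases "n choose s = 0") (auto simp: infinite_forest_def divide_le_eq mult.commute)
qed

text \<open>Joint measurability in the data and the point is needed because the forest is evaluated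
  at a random test point.\<close>

lemma measurable_infinite_forest:
  fixes P :: "('e, 'h::{banach, second_countable_topology}) tree_procedure"
  assumes wf: "well_formed_procedure F s P"
  shows "(\<lambda>p. infinite_forest P s n (fst p) (snd p)) \<in>
    borel_measurable (PiM {1..n} (\<lambda>_. input_space F \<Otimes>\<^sub>M borel) \<Otimes>\<^sub>M input_space F)"
proof -
  interpret R: prob_space "rand P" by (rule well_formed_prob_space[OF wf])
  let ?N = "PiM {1..n} (\<lambda>_. input_space F \<Otimes>\<^sub>M (borel :: 'h measure)) \<Otimes>\<^sub>M input_space F"
  let ?K = "sample_space F s \<Otimes>\<^sub>M input_space F :: ('h sample \<times> input) measure"
  have G: "(\<lambda>q. \<integral>e. tree_output P s (snd q) e (fst q) \<partial>rand P) \<in> borel_measurable ?K"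
  proof -
    have 1: "(\<lambda>t. fst (fst t)) \<in> measurable (?K \<Otimes>\<^sub>M rand P) (sample_space F s)"
      "(\<lambda>t. snd (fst t)) \<in> measurable (?K \<Otimes>\<^sub>M rand P) (input_space F)"
      using measurable_compose[OF measurable_fst measurable_fst] measurable_compose[OF measurable_fst measurable_snd] .
    have "(\<lambda>t. tree_output P s (snd (fst t)) (snd t) (fst (fst t))) \<in> borel_measurable (?K \<Otimes>\<^sub>M rand P)"
      by (rule measurable_tree_output[OF wf 1(2) measurable_snd 1(1)])
    then show ?thesis
      by (intro R.borel_measurable_lebesgue_integral) (simp add: case_prod_unfold)
  qed
  have each: "(\<lambda>p. \<integral>e. tree_output P s (snd p) e (subsample (fst p) I) \<partial>rand P) \<in> borel_measurable ?N"
    if I: "I \<in> subsamples n s" for I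
  proof -
    have fin: "finite I" and card_I: "card I = s" using I finite_subset by blast+
    have "(\<lambda>p. subsample (fst p) I) \<in> measurable ?N (sample_space F s)"
      unfolding sample_space_def subsample_def
      using I by (intro measurable_compose[OF measurable_fst measurable_subsample[OF fin _ card_I]]) auto
    from measurable_compose[OF measurable_Pair[OF this measurable_snd] G] show ?thesis by simp
  qed
  show ?thesis
    unfolding infinite_forest_def using each by (intro borel_measurable_scaleR borel_measurable_sum) auto
qed

text \<open>Rectangles determine a product law. The families of sets are kept general since the
  independence at hand is between the \<sigma>-algebras of two whole sequences, of which a finite
  sample and one test point use a part.\<close>

lemma (in prob_space) distr_pair_of_indep_set:
  assumes ind: "indep_set \<A> \<B>" and X: "X \<in> measurable M N1" and Y: "Y \<in> measurable M N2"
    and XA: "\<And>A. A \<in> sets N1 \<Longrightarrow> X -` A \<inter> space M \<in> \<A>" and YB: "\<And>B. B \<in> sets N2 \<Longrightarrow> Y -` B \<inter> space M \<in> \<B>"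
  shows "distr M (N1 \<Otimes>\<^sub>M N2) (\<lambda>w. (X w, Y w)) = distr M N1 X \<Otimes>\<^sub>M distr M N2 Y"
proof (rule pair_measure_eqI[symmetric])
  interpret D1: prob_space "distr M N1 X" by (rule prob_space_distr[OF X])
  interpret D2: prob_space "distr M N2 Y" by (rule prob_space_distr[OF Y])
  show "sigma_finite_measure (distr M N1 X)" "sigma_finite_measure (distr M N2 Y)" by unfold_locales
  show "sets (distr M N1 X \<Otimes>\<^sub>M distr M N2 Y) = sets (distr M (N1 \<Otimes>\<^sub>M N2) (\<lambda>w. (X w, Y w)))"
    by (simp cong: sets_pair_measure_cong)
  fix A B assume "A \<in> sets (distr M N1 X)" "B \<in> sets (distr M N2 Y)"
  then have A: "A \<in> sets N1" and B: "B \<in> sets N2" by auto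
  have XY: "(\<lambda>w. (X w, Y w)) \<in> measurable M (N1 \<Otimes>\<^sub>M N2)" using X Y by (rule measurable_Pair)
  have "emeasure (distr M (N1 \<Otimes>\<^sub>M N2) (\<lambda>w. (X w, Y w))) (A \<times> B) = emeasure M ((X -` A \<inter> space M) \<inter> (Y -` B \<inter> space M))"
    using XY A B by (subst emeasure_distr) (auto intro!: arg_cong[where f = "emeasure M"])
  also have "\<dots> = ennreal (prob (X -` A \<inter> space M) * prob (Y -` B \<inter> space M))"
    using indep_setD[OF ind XA[OF A] YB[OF B]] by (simp add: emeasure_eq_measure)
  also have "\<dots> = emeasure (distr M N1 X) A * emeasure (distr M N2 Y) B"
    using X Y A B by (simp add: emeasure_distr emeasure_eq_measure ennreal_mult)
  finally show "emeasure (distr M N1 X) A * emeasure (distr M N2 Y) B =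
      emeasure (distr M (N1 \<Otimes>\<^sub>M N2) (\<lambda>w. (X w, Y w))) (A \<times> B)" by simp
qed

section \<open>Data, test points and the error of the forest at a random test point\<close>

locale importance_setting =
  fixes M :: "'w measure"
    and p :: nat
    and k :: "real ^ 'd \<Rightarrow> real ^ 'd \<Rightarrow> real"
    and val :: "'h::{real_inner, banach, second_countable_topology} \<Rightarrow> real ^ 'd \<Rightarrow> real"
    and X :: "'w \<Rightarrow> input" and Y :: "'w \<Rightarrow> real ^ 'd"
    and Xs :: "nat \<Rightarrow> 'w \<Rightarrow> input" and Ys :: "nat \<Rightarrow> 'w \<Rightarrow> real ^ 'd"
    and X' :: "nat \<Rightarrow> 'w \<Rightarrow> input"
    and C :: "('e, 'h) forest_construction"
    and \<beta> :: real
  assumes prob: "prob_space M"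
    and kernel: "rkhs_of k val"
    and kernel_bounded: "bounded (range (\<lambda>(y, y'). k y y'))"
    and kernel_continuous: "continuous_on UNIV (\<lambda>(y, y'). k y y')"
    and X_measurable: "X \<in> measurable M (input_space {1..p})"
    and Y_measurable: "Y \<in> borel_measurable M"
    and data_indep: "prob_space.indep_vars M (\<lambda>_. input_space {1..p} \<Otimes>\<^sub>M borel)
                       (\<lambda>i w. (Xs i w, Ys i w)) {1..}"
    and data_law: "\<And>i. 1 \<le> i \<Longrightarrow>
                     distr M (input_space {1..p} \<Otimes>\<^sub>M borel) (\<lambda>w. (Xs i w, Ys i w)) =
                     distr M (input_space {1..p} \<Otimes>\<^sub>M borel) (\<lambda>w. (X w, Y w))"
    and test_indep: "prob_space.indep_vars M (\<lambda>_. input_space {1..p}) X' {1..}"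
    and test_law: "\<And>i. 1 \<le> i \<Longrightarrow> distr M (input_space {1..p}) (X' i) = distr M (input_space {1..p}) X"
    and test_data_indep: "prob_space.indep_set M
          (sets (sigma_of M (\<lambda>w. \<lambda>i\<in>{1..}. (Xs i w, Ys i w))
                            (PiM {1..} (\<lambda>_. input_space {1..p} \<Otimes>\<^sub>M borel))))
          (sets (sigma_of M (\<lambda>w. \<lambda>i\<in>{1..}. X' i w) (PiM {1..} (\<lambda>_. input_space {1..p}))))"
    and density: "has_bounded_cube_density M {1..p} X"
begin

sublocale prob_space M by (rule prob)

abbreviation "S \<equiv> {1..p}"
abbreviation "ks \<equiv> kernel_section k val"
abbreviation "data F \<equiv> input_space F \<Otimes>\<^sub>M (borel :: 'h measure)"

definition reduce :: "nat set \<Rightarrow> input \<times> (real ^ 'd) \<Rightarrow> input \<times> 'h" where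
  "reduce F q = (restrict (fst q) F, ks (snd q))"

lemma ks_measurable [measurable]: "ks \<in> borel_measurable borel"
  by (intro borel_measurable_continuous_onI continuous_kernel_section kernel kernel_continuous)

lemma reduce_measurable: "F \<subseteq> S \<Longrightarrow> reduce F \<in> measurable (input_space S \<Otimes>\<^sub>M borel) (data F)"
  unfolding reduce_def
  by (intro measurable_Pair measurable_compose[OF measurable_fst measurable_restrict_subset]
      measurable_compose[OF measurable_snd ks_measurable])

lemma pair_measurable: "1 \<le> i \<Longrightarrow> (\<lambda>w. (Xs i w, Ys i w)) \<in> measurable M (input_space S \<Otimes>\<^sub>M borel)"
  using data_indep unfolding indep_vars_def by auto

lemma test_measurable [measurable (raw)]: "1 \<le> i \<Longrightarrow> X' i \<in> measurable M (input_space S)"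
  using test_indep unfolding indep_vars_def by auto

lemma test_restrict_measurable: "1 \<le> i \<Longrightarrow> F \<subseteq> S \<Longrightarrow> (\<lambda>w. restrict (X' i w) F) \<in> measurable M (input_space F)"
  using measurable_compose[OF test_measurable measurable_restrict_subset] .

definition sample_of :: "nat set \<Rightarrow> nat \<Rightarrow> 'w \<Rightarrow> 'h sample" where
  "sample_of F n w = (\<lambda>i\<in>{1..n}. reduce F (Xs i w, Ys i w))"

lemma sample_of_measurable: "F \<subseteq> S \<Longrightarrow> sample_of F n \<in> measurable M (PiM {1..n} (\<lambda>_. data F))"
  unfolding sample_of_def
  by (intro measurable_restrict measurable_compose[OF pair_measurable reduce_measurable]) auto

text \<open>The forest reads only the observations with index in \<open>{1..n}\<close>, so it may be
  evaluated on \<open>sample_of\<close>, which lives in a finite product space.\<close>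

lemma forest_estimate_eq:
  "forest_estimate C \<beta> F n (\<lambda>i. (Xs i w, ks (Ys i w))) x =
   infinite_forest (C F n) (subsample_size \<beta> n) n (sample_of F n w) (restrict x F)"
proof -
  have "sample_of F n w = restrict (\<lambda>i. (restrict (Xs i w) F, ks (Ys i w))) {1..n}"
    by (simp add: sample_of_def reduce_def)
  then show ?thesis
    unfolding forest_estimate_def by (simp only: infinite_forest_restrict fst_conv snd_conv)
qed

lemma law_reduce:
  assumes F: "F \<subseteq> S" and W: "\<And>w. w \<in> space M \<Longrightarrow> W w = restrict (X w) F" and i: "1 \<le> i"
  shows "distr M (data F) (\<lambda>w. reduce F (Xs i w, Ys i w)) = distr M (data F) (\<lambda>w. (W w, ks (Y w)))"
proof -
  have XY: "(\<lambda>w. (X w, Y w)) \<in> measurable M (input_space S \<Otimes>\<^sub>M borel)"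
    using X_measurable Y_measurable by (rule measurable_Pair)
  have "distr M (data F) (\<lambda>w. reduce F (Xs i w, Ys i w)) =
      distr (distr M (input_space S \<Otimes>\<^sub>M borel) (\<lambda>w. (Xs i w, Ys i w))) (data F) (reduce F)"
    by (subst distr_distr[OF reduce_measurable[OF F] pair_measurable[OF i]]) (simp add: o_def)
  also have "\<dots> = distr (distr M (input_space S \<Otimes>\<^sub>M borel) (\<lambda>w. (X w, Y w))) (data F) (reduce F)"
    by (simp only: data_law[OF i])
  also have "\<dots> = distr M (data F) (\<lambda>w. (W w, ks (Y w)))"
    by (subst distr_distr[OF reduce_measurable[OF F] XY]) (auto intro!: distr_cong simp: reduce_def W)
  finally show ?thesis .
qed

lemma law_test:
  assumes F: "F \<subseteq> S" and W: "\<And>w. w \<in> space M \<Longrightarrow> W w = restrict (X w) F" and i: "1 \<le> i"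
  shows "distr M (input_space F) (\<lambda>w. restrict (X' i w) F) = distr M (input_space F) W"
proof -
  have r: "(\<lambda>x. restrict x F) \<in> measurable (input_space S) (input_space F)"
    using F by (rule measurable_restrict_subset)
  have "distr M (input_space F) (\<lambda>w. restrict (X' i w) F) =
      distr (distr M (input_space S) (X' i)) (input_space F) (\<lambda>x. restrict x F)"
    by (subst distr_distr[OF r test_measurable[OF i]]) (simp add: o_def)
  also have "\<dots> = distr (distr M (input_space S) X) (input_space F) (\<lambda>x. restrict x F)"
    by (simp only: test_law[OF i])
  also have "\<dots> = distr M (input_space F) W"
    by (subst distr_distr[OF r X_measurable]) (auto intro!: distr_cong simp: W)
  finally show ?thesis .
qed

lemma law_sample:
  assumes F: "F \<subseteq> S" and W: "\<And>w. w \<in> space M \<Longrightarrow> W w = restrict (X w) F" and n: "0 < n"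
  shows "distr M (PiM {1..n} (\<lambda>_. data F)) (sample_of F n) =
    PiM {1..n} (\<lambda>_. distr M (data F) (\<lambda>w. (W w, ks (Y w))))"
proof -
  have ne: "{1..n} \<noteq> {}" using n by simp
  have "indep_vars (\<lambda>_. data F) (\<lambda>i w. reduce F (Xs i w, Ys i w)) {1..}"
    by (rule indep_vars_compose2[OF data_indep reduce_measurable[OF F]])
  then have "indep_vars (\<lambda>_. data F) (\<lambda>i w. reduce F (Xs i w, Ys i w)) {1..n}"
    by (rule indep_vars_subset) auto
  moreover have "(\<lambda>w. reduce F (Xs i w, Ys i w)) \<in> measurable M (data F)" if "i \<in> {1..n}" for i
    using measurable_compose[OF pair_measurable reduce_measurable[OF F]] that by auto
  ultimately have "distr M (PiM {1..n} (\<lambda>_. data F)) (sample_of F n) =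
      PiM {1..n} (\<lambda>i. distr M (data F) (\<lambda>w. reduce F (Xs i w, Ys i w)))"
    using indep_vars_iff_distr_eq_PiM'[OF ne, of "\<lambda>i w. reduce F (Xs i w, Ys i w)" "\<lambda>_. data F"]
    by (simp add: sample_of_def[abs_def])
  also have "\<dots> = PiM {1..n} (\<lambda>_. distr M (data F) (\<lambda>w. (W w, ks (Y w))))"
    by (intro PiM_cong refl law_reduce[OF F W]) auto
  finally show ?thesis .
qed

text \<open>Independence of training and test data makes the joint law a product, so that the mean
  error at a test point is the error at a fixed point, integrated over the law of the
  inputs.\<close>

lemma law_sample_test:
  assumes F: "F \<subseteq> S" and W: "\<And>w. w \<in> space M \<Longrightarrow> W w = restrict (X w) F" and n: "0 < n" and i: "1 \<le> i"
  shows "distr M (PiM {1..n} (\<lambda>_. data F) \<Otimes>\<^sub>M input_space F) (\<lambda>w. (sample_of F n w, restrict (X' i w) F)) =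
    PiM {1..n} (\<lambda>_. distr M (data F) (\<lambda>w. (W w, ks (Y w)))) \<Otimes>\<^sub>M distr M (input_space F) W"
proof -
  let ?A = "PiM {1..} (\<lambda>_ :: nat. input_space S \<Otimes>\<^sub>M (borel :: (real ^ 'd) measure))"
  let ?B = "PiM {1..} (\<lambda>_ :: nat. input_space S)"
  let ?a = "\<lambda>w. \<lambda>i\<in>{1..}. (Xs i w, Ys i w)" and ?b = "\<lambda>w. \<lambda>i\<in>{1..}. X' i w"
  let ?ha = "\<lambda>\<zeta>. \<lambda>i\<in>{1..n}. reduce F (\<zeta> i)" and ?hb = "\<lambda>\<xi>. restrict (\<xi> i) F"
  have a: "?a \<in> measurable M ?A" by (intro measurable_restrict pair_measurable) auto
  have b: "?b \<in> measurable M ?B" by (intro measurable_restrict test_measurable) auto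
  have ha: "?ha \<in> measurable ?A (PiM {1..n} (\<lambda>_. data F))"
  proof (rule measurable_restrict)
    fix i :: nat assume "i \<in> {1..n}"
    then have "(\<lambda>\<zeta>. \<zeta> i) \<in> measurable ?A (input_space S \<Otimes>\<^sub>M borel)"
      by (intro measurable_component_singleton) auto
    from measurable_compose[OF this reduce_measurable[OF F]]
    show "(\<lambda>\<zeta>. reduce F (\<zeta> i)) \<in> measurable ?A (data F)" .
  qed
  have hb: "?hb \<in> measurable ?B (input_space F)"
  proof -
    have "(\<lambda>\<xi>. \<xi> i) \<in> measurable ?B (input_space S)"
      using i by (intro measurable_component_singleton) auto
    from measurable_compose[OF this measurable_restrict_subset[OF F]] show ?thesis .
  qed
  have eqa: "sample_of F n w = ?ha (?a w)" and eqb: "restrict (X' i w) F = ?hb (?b w)" for w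
    using i by (auto simp: sample_of_def fun_eq_iff)
  have "distr M (PiM {1..n} (\<lambda>_. data F) \<Otimes>\<^sub>M input_space F) (\<lambda>w. (sample_of F n w, restrict (X' i w) F)) =
      distr M (PiM {1..n} (\<lambda>_. data F)) (sample_of F n) \<Otimes>\<^sub>M distr M (input_space F) (\<lambda>w. restrict (X' i w) F)"
  proof (rule distr_pair_of_indep_set[OF test_data_indep sample_of_measurable[OF F] test_restrict_measurable[OF i F]])
    show "sample_of F n -` A \<inter> space M \<in> sets (sigma_of M ?a ?A)" if "A \<in> sets (PiM {1..n} (\<lambda>_. data F))" for A
    proof -
      have "sample_of F n -` A \<inter> space M = ?a -` (?ha -` A \<inter> space ?A) \<inter> space M"
        using measurable_space[OF a] unfolding eqa by auto
      then show ?thesis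
        unfolding sigma_of_def using in_vimage_algebra[OF measurable_sets[OF ha that], of ?a "space M"] by (simp only:)
    qed
    show "(\<lambda>w. restrict (X' i w) F) -` A \<inter> space M \<in> sets (sigma_of M ?b ?B)" if "A \<in> sets (input_space F)" for A
    proof -
      have "(\<lambda>w. restrict (X' i w) F) -` A \<inter> space M = ?b -` (?hb -` A \<inter> space ?B) \<inter> space M"
        using measurable_space[OF b] unfolding eqb by auto
      then show ?thesis
        unfolding sigma_of_def using in_vimage_algebra[OF measurable_sets[OF hb that], of ?b "space M"] by (simp only:)
    qed
  qed
  then show ?thesis by (simp only: law_sample[OF F W n] law_test[OF F W i])
qed

lemma estimate_measurable:
  assumes wf: "well_formed_procedure F (subsample_size \<beta> n) (C F n)" and F: "F \<subseteq> S" and i: "1 \<le> i"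
  shows "(\<lambda>w. forest_estimate C \<beta> F n (\<lambda>i. (Xs i w, ks (Ys i w))) (X' i w)) \<in> borel_measurable M"
  unfolding forest_estimate_eq
  using measurable_compose[OF measurable_Pair[OF sample_of_measurable[OF F] test_restrict_measurable[OF i F]]
      measurable_infinite_forest[OF wf]] by simp

lemma norm_estimate_le:
  assumes wf: "well_formed_procedure F (subsample_size \<beta> n) (C F n)" and b0: "\<And>y. norm (ks y) \<le> b0"
  shows "norm (forest_estimate C \<beta> F n (\<lambda>i. (Xs i w, ks (Ys i w))) x) \<le> b0"
  unfolding forest_estimate_eq
proof (rule norm_infinite_forest_le[OF well_formed_prob_space[OF wf]])
  show "norm (snd (sample_of F n w i)) \<le> b0" if "i \<in> {1..n}" for i
    using that b0 by (simp add: sample_of_def reduce_def)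
  show "0 \<le> b0" using b0 norm_ge_zero order_trans by blast
qed

text \<open>All test points have the same law, so one threshold for \<open>n\<close> serves for
  every index \<open>i\<close>; this uniformity is required when averaging over \<open>n\<close>
  test points.\<close>

lemma estimate_consistent:
  assumes F: "F \<subseteq> S" and W: "\<And>w. w \<in> space M \<Longrightarrow> W w = restrict (X w) F"
    and Wm: "W \<in> measurable M (input_space F)"
    and fp: "forest_properties \<pi> \<alpha> \<kappa> \<beta> F C"
    and law: "forest_law F (distr M (data F) (\<lambda>w. (W w, ks (Y w)))) m b L c Cb"
    and b0: "\<And>y. norm (ks y) \<le> b0" "b0 \<le> b" and \<epsilon>: "0 < \<epsilon>"
  shows "\<forall>\<^sub>F n in sequentially. \<forall>i\<ge>1. expectation (\<lambda>w.
      (norm (forest_estimate C \<beta> F n (\<lambda>i. (Xs i w, ks (Ys i w))) (X' i w) - m (restrict (X' i w) F)))\<^sup>2) \<le> \<epsilon>"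
proof -
  let ?Q = "distr M (data F) (\<lambda>w. (W w, ks (Y w)))" and ?PX = "distr M (input_space F) W"
  interpret law: forest_law F ?Q m b L c Cb by (rule law)
  interpret PX: prob_space ?PX by (rule prob_space_distr[OF Wm])
  have WVm: "(\<lambda>w. (W w, ks (Y w))) \<in> measurable M (data F)"
    using Wm measurable_compose[OF Y_measurable ks_measurable] by (rule measurable_Pair)
  have cubeW: "AE w in M. W w \<in> cube F"
    using AE_distrD[OF WVm law.inputs_in_cube] by simp
  have cube_sets: "cube F \<in> sets (input_space F)" by simp
  have cubeP: "AE x in ?PX. x \<in> cube F"
    using cubeW Wm cube_sets by (subst AE_distr_iff) auto
  show ?thesis
    using law.forest_consistent[OF fp \<epsilon>] eventually_gt_at_top[of 0]
  proof eventually_elim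
    case (elim n)
    let ?PD = "PiM {1..n} (\<lambda>_. ?Q)"
    let ?f = "\<lambda>q. (norm (infinite_forest (C F n) (subsample_size \<beta> n) n (fst q) (snd q) - m (snd q)))\<^sup>2"
    interpret PD: prob_space ?PD using law.prob_Q by (intro prob_space_PiM) auto
    interpret P: pair_prob_space ?PD ?PX ..
    have wf: "well_formed_procedure F (subsample_size \<beta> n) (C F n)"
      using fp unfolding forest_properties_def by blast
    have fm: "?f \<in> borel_measurable (PiM {1..n} (\<lambda>_. data F) \<Otimes>\<^sub>M input_space F)"
    proof -
      note [measurable] = measurable_infinite_forest[OF wf, of n]
      have [measurable]: "(\<lambda>q. m (snd q)) \<in> borel_measurable (PiM {1..n} (\<lambda>_. data F) \<Otimes>\<^sub>M input_space F)"
        using measurable_compose[OF measurable_snd law.m_measurable] .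
      show ?thesis by measurable
    qed
    show ?case
    proof (intro allI impI)
      fix i :: nat assume i: "1 \<le> i"
      have jl: "distr M (PiM {1..n} (\<lambda>_. data F) \<Otimes>\<^sub>M input_space F) (\<lambda>w. (sample_of F n w, restrict (X' i w) F)) =
          ?PD \<Otimes>\<^sub>M ?PX"
        by (rule law_sample_test[OF F W elim(2) i])
      let ?pair = "\<lambda>w. (sample_of F n w, restrict (X' i w) F)"
      have pm: "?pair \<in> measurable M (PiM {1..n} (\<lambda>_. data F) \<Otimes>\<^sub>M input_space F)"
        by (rule measurable_Pair[OF sample_of_measurable[OF F] test_restrict_measurable[OF i F]])
      have cubeX': "AE w in M. restrict (X' i w) F \<in> cube F"
        by (rule AE_distrD[OF test_restrict_measurable[OF i F]]) (subst law_test[OF F W i], assumption, rule cubeP)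
      have "AE w in M. norm (?f (?pair w)) \<le> (2 * b)\<^sup>2"
        using cubeX'
      proof eventually_elim
        case (elim w)
        have "norm (infinite_forest (C F n) (subsample_size \<beta> n) n (sample_of F n w) (restrict (X' i w) F)) \<le> b"
          using norm_estimate_le[OF wf b0(1), of w "X' i w"] b0(2) unfolding forest_estimate_eq by linarith
        then have "norm (infinite_forest (C F n) (subsample_size \<beta> n) n (sample_of F n w) (restrict (X' i w) F)
            - m (restrict (X' i w) F)) \<le> 2 * b"
          using law.m_bounded[OF elim] norm_triangle_ineq4[of
              "infinite_forest (C F n) (subsample_size \<beta> n) n (sample_of F n w) (restrict (X' i w) F)"
              "m (restrict (X' i w) F)"] by linarith
        then have "?f (?pair w) \<le> (2 * b)\<^sup>2" unfolding fst_conv snd_conv by (rule power_mono) simp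
        then show ?case by simp
      qed
      then have intM: "integrable M (\<lambda>w. ?f (?pair w))"
        using measurable_compose[OF pm fm] by (rule integrable_const_bound)
      have intP: "integrable (?PD \<Otimes>\<^sub>M ?PX) ?f"
        unfolding jl[symmetric] using intM by (subst integrable_distr_eq[OF pm fm])
      have "expectation (\<lambda>w. ?f (?pair w)) = (\<integral>q. ?f q \<partial>(?PD \<Otimes>\<^sub>M ?PX))"
        unfolding jl[symmetric] by (rule integral_distr[OF pm fm, symmetric])
      \<comment> \<open>The data are integrated out first, at a fixed point of the cube, where the
        uniform bound on the forest applies.\<close>
      also have "\<dots> = (\<integral>x. (\<integral>D. ?f (D, x) \<partial>?PD) \<partial>?PX)"
        using P.integral_snd[of "\<lambda>D x. ?f (D, x)"] intP by (simp add: case_prod_unfold)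
      also have "\<dots> \<le> (\<integral>x. \<epsilon> \<partial>?PX)"
      proof (rule integral_mono_AE)
        show "integrable ?PX (\<lambda>x. \<integral>D. ?f (D, x) \<partial>?PD)"
          using P.integrable_snd[of "\<lambda>D x. ?f (D, x)"] intP by (simp add: case_prod_unfold)
        show "AE x in ?PX. (\<integral>D. ?f (D, x) \<partial>?PD) \<le> \<epsilon>"
          using cubeP by eventually_elim (use elim(1) in simp)
      qed simp
      also have "\<dots> = \<epsilon>" by (simp only: lebesgue_integral_const PX.prob_space scaleR_one)
      finally show "expectation (\<lambda>w. (norm (forest_estimate C \<beta> F n (\<lambda>i. (Xs i w, ks (Ys i w))) (X' i w)
          - m (restrict (X' i w) F)))\<^sup>2) \<le> \<epsilon>"
        by (simp only: forest_estimate_eq fst_conv snd_conv)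
    qed
  qed
qed

end

section \<open>The theoretical index in terms of expectations\<close>

lemma (in prob_space) hvariance_eq:
  fixes \<xi> :: "'a \<Rightarrow> 'h::{real_inner, banach, second_countable_topology}"
  assumes int: "integrable M \<xi>" "integrable M (\<lambda>w. (norm (\<xi> w))\<^sup>2)"
  shows "hvariance M \<xi> = expectation (\<lambda>w. (norm (\<xi> w))\<^sup>2) - (norm (expectation \<xi>))\<^sup>2"
proof -
  let ?e = "expectation \<xi>"
  have i: "integrable M (\<lambda>w. inner (\<xi> w) ?e)" by (rule integrable_inner_left) (rule int(1))
  have "hvariance M \<xi> = expectation (\<lambda>w. (norm (\<xi> w))\<^sup>2 - 2 * inner (\<xi> w) ?e + (norm ?e)\<^sup>2)"
    unfolding hvariance_def
    by (intro Bochner_Integration.integral_cong refl)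
      (simp add: power2_norm_eq_inner inner_diff_left inner_diff_right inner_commute)
  also have "\<dots> = expectation (\<lambda>w. (norm (\<xi> w))\<^sup>2) - 2 * expectation (\<lambda>w. inner (\<xi> w) ?e) + (norm ?e)\<^sup>2"
    using int(2) i by (simp add: prob_space)
  also have "expectation (\<lambda>w. inner (\<xi> w) ?e) = (norm ?e)\<^sup>2"
    unfolding power2_norm_eq_inner by (rule integral_inner_left) (rule int(1))
  finally show ?thesis by simp
qed

text \<open>A conditional expectation has the same integral as the function itself, and the version
  chosen inside \<open>cond_hvariance\<close> agrees almost surely with \<open>g\<close>.\<close>

lemma (in prob_space) integral_cond_hvariance:
  fixes \<xi> g f :: "'a \<Rightarrow> 'h::{real_inner, banach, second_countable_topology}"
  assumes g: "has_cond_exp M G \<xi> g" and sq: "integrable M (\<lambda>w. (norm (\<xi> w - g w))\<^sup>2)"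
  shows "(\<integral>w. cond_hvariance M G \<xi> w \<partial>M) = expectation (\<lambda>w. (norm (\<xi> w - g w))\<^sup>2)"
proof -
  have sub: "subalgebra M G" and \<xi>: "integrable M \<xi>" using g unfolding has_cond_exp_def by auto
  interpret finite_measure_subalgebra M G using sub by unfold_locales
  have ce: "has_cond_exp M G \<xi> (cond_expectation M G \<xi>)"
    unfolding cond_expectation_def using g someI[of "has_cond_exp M G \<xi>" g] by auto
  then have cm: "integrable M (cond_expectation M G \<xi>)" unfolding has_cond_exp_def by blast
  have ae: "AE w in M. (norm (\<xi> w - cond_expectation M G \<xi> w))\<^sup>2 = (norm (\<xi> w - g w))\<^sup>2"
    using has_cond_exp_unique[OF ce g] by eventually_elim simp
  have m: "(\<lambda>w. (norm (\<xi> w - cond_expectation M G \<xi> w))\<^sup>2) \<in> borel_measurable M"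
    "(\<lambda>w. (norm (\<xi> w - g w))\<^sup>2) \<in> borel_measurable M"
    using borel_measurable_integrable[OF \<xi>] borel_measurable_integrable[OF cm] borel_measurable_integrable[OF sq] by measurable
  have int: "integrable M (\<lambda>w. (norm (\<xi> w - cond_expectation M G \<xi> w))\<^sup>2)"
    using sq integrable_cong_AE[OF m ae] by simp
  have "(\<integral>w. cond_hvariance M G \<xi> w \<partial>M) = expectation (\<lambda>w. (norm (\<xi> w - cond_expectation M G \<xi> w))\<^sup>2)"
    unfolding cond_hvariance_def by (rule real_cond_exp_int(2)[OF int])
  also have "\<dots> = expectation (\<lambda>w. (norm (\<xi> w - g w))\<^sup>2)"
    by (rule integral_cong_AE[OF m ae])
  finally show ?thesis .
qed

context importance_setting
begin

lemma index_estimator_converges: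
  assumes forest: "forest_properties \<pi> \<alpha> \<kappa> \<beta> S C" "forest_properties \<pi> \<alpha> \<kappa> \<beta> (S - {j}) C"
    and mu: "regression_function M (input_space S) X (\<lambda>w. ks (Y w)) \<mu>"
    and mu_lipschitz: "lipschitz_on_cube S \<mu>"
    and mu_j: "regression_function M (input_space (S - {j})) (\<lambda>w. restrict (X w) (S - {j})) (\<lambda>w. ks (Y w)) \<mu>\<^sub>j"
    and mu_j_lipschitz: "lipschitz_on_cube (S - {j}) \<mu>\<^sub>j"
    and variance_pos: "hvariance M (\<lambda>w. \<mu> (X w)) > 0"
  shows "converges_in_probability M
    (\<lambda>n w. index_estimator C \<beta> p j n (\<lambda>i. (Xs i w, ks (Ys i w))) (\<lambda>i. X' i w))
    (theoretical_index M p j X \<mu>)"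
proof -
  let ?F = "S - {j}"
  let ?W = "\<lambda>w. restrict (X w) ?F"
  have FS: "?F \<subseteq> S" "S \<subseteq> S" by auto
  \<comment> \<open>Inputs are extensional, so \<open>X\<close> is its own restriction to all
    features and the full forest is an instance with \<open>W = X\<close>.\<close>
  have XS: "X w = restrict (X w) S" if "w \<in> space M" for w
    using measurable_space[OF X_measurable that] by (auto simp: space_PiM PiE_iff extensional_restrict)
  have X'S: "X' i w = restrict (X' i w) S" if "w \<in> space M" "1 \<le> i" for i w
    using measurable_space[OF test_measurable[OF that(2)] that(1)] by (auto simp: space_PiM PiE_iff extensional_restrict)
  have Vm: "(\<lambda>w. ks (Y w)) \<in> borel_measurable M" using measurable_compose[OF Y_measurable ks_measurable] .
  obtain b0 where b0: "\<And>y. norm (ks y) \<le> b0" using kernel_section_bounded[OF kernel kernel_bounded] by blast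
  obtain b1 L1 c1 C1 where l1: "b0 \<le> b1" "forest_law S (distr M (data S) (\<lambda>w. (X w, ks (Y w)))) \<mu> b1 L1 c1 C1"
    by (rule forest_law_of_data[OF prob finite_atLeastAtMost FS(2) density XS Vm b0 mu mu_lipschitz])
  obtain b2 L2 c2 C2 where l2: "b0 \<le> b2" "forest_law ?F (distr M (data ?F) (\<lambda>w. (?W w, ks (Y w)))) \<mu>\<^sub>j b2 L2 c2 C2"
    by (rule forest_law_of_data[OF prob finite_atLeastAtMost FS(1) density refl Vm b0 mu_j mu_j_lipschitz])
  interpret l1: forest_law S "distr M (data S) (\<lambda>w. (X w, ks (Y w)))" \<mu> b1 L1 c1 C1 by (rule l1(2))
  interpret l2: forest_law ?F "distr M (data ?F) (\<lambda>w. (?W w, ks (Y w)))" \<mu>\<^sub>j b2 L2 c2 C2 by (rule l2(2))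
  \<comment> \<open>A bound common to both regression functions and both forests.\<close>
  define b where "b = max b1 b2"
  define u where "u n i w = forest_estimate C \<beta> S n (\<lambda>i. (Xs i w, ks (Ys i w))) (X' i w)" for n i w
  define v where "v n i w = forest_estimate C \<beta> ?F n (\<lambda>i. (Xs i w, ks (Ys i w))) (X' i w)" for n i w
  define a where "a i w = \<mu> (X' i w)" for i w
  define a' where "a' i w = \<mu>\<^sub>j (restrict (X' i w) ?F)" for i w
  have wf: "well_formed_procedure S (subsample_size \<beta> n) (C S n)" "well_formed_procedure ?F (subsample_size \<beta> n) (C ?F n)" for n
    using forest unfolding forest_properties_def by blast+
  have um: "u n i \<in> borel_measurable M" and vm: "v n i \<in> borel_measurable M" if "1 \<le> i" for n i
    unfolding u_def[abs_def] v_def[abs_def]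
    using estimate_measurable[OF wf(1) FS(2) that] estimate_measurable[OF wf(2) FS(1) that] by auto
  have rm: "(\<lambda>x. restrict x ?F) \<in> measurable (input_space S) (input_space ?F)"
    using FS(1) by (rule measurable_restrict_subset)
  have \<mu>jm: "(\<lambda>x. \<mu>\<^sub>j (restrict x ?F)) \<in> borel_measurable (input_space S)"
    using measurable_compose[OF rm l2.m_measurable] .
  have am: "a i \<in> borel_measurable M" and a'm: "a' i \<in> borel_measurable M" if "1 \<le> i" for i
    unfolding a_def[abs_def] a'_def[abs_def]
    using measurable_compose[OF test_measurable[OF that] l1.m_measurable] measurable_compose[OF test_measurable[OF that] \<mu>jm] by auto
  have cubeX: "AE w in M. X w \<in> cube S" 
    using AE_distrD[OF measurable_Pair[OF X_measurable Vm] l1.inputs_in_cube] by simp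
  have bdX: "AE w in M. norm (\<mu> (X w)) \<le> b \<and> norm (\<mu>\<^sub>j (?W w)) \<le> b"
    using cubeX
  proof eventually_elim
    case (elim w)
    then have "?W w \<in> cube ?F" by (auto simp: hbox_iff)
    then show ?case using l1.m_bounded[OF elim] l2.m_bounded[of "?W w"] by (auto simp: b_def)
  qed
  have cube_sets: "cube S \<in> sets (input_space S)" by (rule hbox_sets) simp
  have cubeX': "AE w in M. \<forall>i\<ge>1. X' i w \<in> cube S"
  proof -
    have "AE w in M. 1 \<le> i \<longrightarrow> X' i w \<in> cube S" for i
    proof (cases "1 \<le> i")
      case True
      have "AE x in distr M (input_space S) X. x \<in> cube S"
        using cubeX X_measurable cube_sets by (subst AE_distr_iff) auto
      then have "AE x in distr M (input_space S) (X' i). x \<in> cube S" by (simp only: test_law[OF True])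
      then show ?thesis using AE_distrD[OF test_measurable[OF True]] by auto
    qed simp
    then show ?thesis by (simp add: AE_all_countable)
  qed
  have bd: "AE w in M. \<forall>i\<ge>1. norm (a i w) \<le> b \<and> norm (a' i w) \<le> b \<and> (\<forall>n. norm (u n i w) \<le> b \<and> norm (v n i w) \<le> b)"
    using cubeX'
  proof eventually_elim
    case (elim w)
    show ?case
    proof (intro allI impI conjI)
      fix i :: nat assume i: "1 \<le> i"
      have X': "X' i w \<in> cube S" using elim i by blast
      then have "restrict (X' i w) ?F \<in> cube ?F" by (auto simp: hbox_iff)
      then show "norm (a i w) \<le> b" "norm (a' i w) \<le> b"
        using l1.m_bounded[OF X'] l2.m_bounded by (auto simp: a_def a'_def b_def le_max_iff_disj)
      show "norm (u n i w) \<le> b" "norm (v n i w) \<le> b" for n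
        using norm_estimate_le[OF wf(1) b0, of n w "X' i w"] norm_estimate_le[OF wf(2) b0, of n w "X' i w"] l1(1) l2(1)
        unfolding u_def v_def b_def by linarith+
    qed
  qed
  have eu: "\<forall>\<^sub>F n in sequentially. \<forall>i\<ge>1. expectation (\<lambda>w. (norm (u n i w - a i w))\<^sup>2) \<le> \<epsilon>" if \<epsilon>: "0 < \<epsilon>" for \<epsilon>
  proof -
    have "\<forall>\<^sub>F n in sequentially. \<forall>i\<ge>1. expectation (\<lambda>w. (norm (u n i w - \<mu> (restrict (X' i w) S)))\<^sup>2) \<le> \<epsilon>"
      unfolding u_def
      by (rule estimate_consistent[where W = X, OF FS(2) _ X_measurable forest(1) l1(2) b0 l1(1) \<epsilon>]) (rule XS)
    then show ?thesis
    proof eventually_elim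
      case (elim n)
      show ?case
      proof (intro allI impI)
        fix i :: nat assume i: "1 \<le> i"
        have "expectation (\<lambda>w. (norm (u n i w - a i w))\<^sup>2) =
            expectation (\<lambda>w. (norm (u n i w - \<mu> (restrict (X' i w) S)))\<^sup>2)"
          using X'S[OF _ i] by (intro Bochner_Integration.integral_cong) (auto simp: a_def)
        then show "expectation (\<lambda>w. (norm (u n i w - a i w))\<^sup>2) \<le> \<epsilon>"
          using elim i by simp
      qed
    qed
  qed
  have ev: "\<forall>\<^sub>F n in sequentially. \<forall>i\<ge>1. expectation (\<lambda>w. (norm (v n i w - a' i w))\<^sup>2) \<le> \<epsilon>" if \<epsilon>: "0 < \<epsilon>" for \<epsilon>
    unfolding v_def a'_def
    by (rule estimate_consistent[where W = ?W, OF FS(1) _ measurable_compose[OF X_measurable rm] forest(2) l2(2) b0 l2(1) \<epsilon>])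
      (rule refl)
  define \<phi> where "\<phi> x = (norm (\<mu> x - \<mu>\<^sub>j (restrict x ?F)))\<^sup>2" for x
  have \<phi>m: "\<phi> \<in> borel_measurable (input_space S)"
    unfolding \<phi>_def[abs_def] using l1.m_measurable \<mu>jm by measurable
  have indX: "indep_var borel (\<lambda>w. g (X' i w)) borel (\<lambda>w. g (X' i' w))"
    if "1 \<le> i" "1 \<le> i'" "i \<noteq> i'" and g: "g \<in> borel_measurable (input_space S)" for i i' and g :: "input \<Rightarrow> 'v::topological_space"
  proof -
    have c: "(\<lambda>f. f l) \<in> measurable (PiM {l} (\<lambda>_. input_space S)) (input_space S)" for l :: nat
      by (intro measurable_component_singleton) auto
    have "indep_var borel ((\<lambda>f. g (f i)) \<circ> (\<lambda>w. restrict (\<lambda>l. X' l w) {i})) borel ((\<lambda>f. g (f i')) \<circ> (\<lambda>w. restrict (\<lambda>l. X' l w) {i'}))"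
      by (rule indep_var_compose[OF indep_var_restrict[OF test_indep] measurable_compose[OF c g] measurable_compose[OF c g]])
        (use that in auto)
    then show ?thesis by (simp add: o_def)
  qed
  have meanX: "expectation (\<lambda>w. g (X' i w)) = expectation (\<lambda>w. g (X w))"
    if i: "1 \<le> i" and g: "g \<in> borel_measurable (input_space S)" for i and g :: "input \<Rightarrow> 'v::{banach, second_countable_topology}"
    using integral_distr[OF test_measurable[OF i] g] integral_distr[OF X_measurable g] test_law[OF i] by simp
  have n\<mu>m: "(\<lambda>x. (norm (\<mu> x))\<^sup>2) \<in> borel_measurable (input_space S)"
    using l1.m_measurable by measurable
  let ?num = "expectation (\<lambda>w. \<phi> (X w))" and ?den = "hvariance M (\<lambda>w. \<mu> (X w))"
  have \<mu>X: "(\<lambda>w. \<mu> (X w)) \<in> borel_measurable M" using measurable_compose[OF X_measurable l1.m_measurable] .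
  have int\<mu>: "integrable M (\<lambda>w. \<mu> (X w))"
    using bdX by (intro integrable_const_bound[OF _ \<mu>X, where B = b]) auto
  have int\<mu>2: "integrable M (\<lambda>w. (norm (\<mu> (X w)))\<^sup>2)"
  proof (rule integrable_const_bound[where B = "b\<^sup>2"])
    show "AE w in M. norm ((norm (\<mu> (X w)))\<^sup>2) \<le> b\<^sup>2"
      using bdX by eventually_elim (auto intro!: power_mono)
  qed (use \<mu>X in measurable)
  have int\<phi>: "integrable M (\<lambda>w. \<phi> (X w))"
  proof (rule integrable_const_bound[where B = "(2 * b)\<^sup>2"])
    show "AE w in M. norm (\<phi> (X w)) \<le> (2 * b)\<^sup>2"
      using bdX
    proof eventually_elim
      case (elim w)
      then have "norm (\<mu> (X w) - \<mu>\<^sub>j (?W w)) \<le> 2 * b"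
        using norm_triangle_ineq4[of "\<mu> (X w)" "\<mu>\<^sub>j (?W w)"] by linarith
      then have "\<phi> (X w) \<le> (2 * b)\<^sup>2" unfolding \<phi>_def by (rule power_mono) simp
      moreover have "0 \<le> \<phi> (X w)" by (simp add: \<phi>_def)
      ultimately show ?case by simp
    qed
  qed (use measurable_compose[OF X_measurable \<phi>m] in simp)
  \<comment> \<open>By the tower property \<open>\<mu>\<^sub>j\<close> gives the conditional mean of
    \<open>\<mu> (X w)\<close> given the remaining inputs, so the numerator of the index is the mean
    squared distance of the two regression functions.\<close>
  have index: "theoretical_index M p j X \<mu> = ?num / ?den"
  proof -
    have r: "has_cond_exp M (sigma_of M ?W (input_space ?F)) (\<lambda>w. \<mu> (X w)) (\<lambda>w. \<mu>\<^sub>j (?W w))"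
    proof (rule has_cond_exp_tower[OF X_measurable l1.m_measurable rm refl])
      show "has_cond_exp M (sigma_of M X (input_space S)) (\<lambda>w. ks (Y w)) (\<lambda>w. \<mu> (X w))"
        using mu unfolding regression_function_def by blast
      show "has_cond_exp M (sigma_of M ?W (input_space ?F)) (\<lambda>w. ks (Y w)) (\<lambda>w. \<mu>\<^sub>j (?W w))"
        using mu_j unfolding regression_function_def by blast
    qed
    show ?thesis
      unfolding theoretical_index_def
      using integral_cond_hvariance[OF r] int\<phi> unfolding \<phi>_def by simp
  qed
  \<comment> \<open>The subtracted ratio has numerator 0, whatever its denominator.\<close>
  have est: "index_estimator C \<beta> p j n (\<lambda>i. (Xs i w, ks (Ys i w))) (\<lambda>i. X' i w) =
      importance_ratio n (\<lambda>i. u n i w) (\<lambda>i. v n i w)" for n w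
  proof -
    have "importance_ratio n g g = 0" for g :: "nat \<Rightarrow> 'h" by (simp add: importance_ratio_def)
    then show ?thesis by (simp add: index_estimator_def u_def v_def)
  qed
  show ?thesis
    unfolding converges_in_probability_def est index
  proof (intro conjI allI impI)
    fix n
    have sm: "(\<lambda>w. \<Sum>i=1..n. g i w) \<in> borel_measurable M" if "\<And>i. 1 \<le> i \<Longrightarrow> g i \<in> borel_measurable M"
      for g :: "nat \<Rightarrow> 'w \<Rightarrow> 'v::{second_countable_topology, topological_comm_monoid_add}"
      using that by (intro borel_measurable_sum) auto
    have norm_m: "(\<lambda>w. norm (g w)) \<in> borel_measurable M" if "g \<in> borel_measurable M" for g :: "'w \<Rightarrow> 'h"
      using that by measurable
    have avg: "(\<lambda>w. (1 / real n) *\<^sub>R (\<Sum>i=1..n. u n i w)) \<in> borel_measurable M"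
      by (intro borel_measurable_scaleR sm um) auto
    show "(\<lambda>w. importance_ratio n (\<lambda>i. u n i w) (\<lambda>i. v n i w)) \<in> borel_measurable M"
      unfolding importance_ratio_def
      by (intro borel_measurable_divide sm borel_measurable_power norm_m borel_measurable_diff um vm avg)
  next
    fix \<delta> :: real assume \<delta>: "0 < \<delta>"
    show "(\<lambda>n. \<P>(w in M. \<bar>importance_ratio n (\<lambda>i. u n i w) (\<lambda>i. v n i w) - ?num / ?den\<bar> > \<delta>)) \<longlonglongrightarrow> 0"
    proof (rule importance_ratio_converges[OF um vm am a'm bd eu ev])
      show "indep_var borel (\<lambda>w. (norm (a i w - a' i w))\<^sup>2) borel (\<lambda>w. (norm (a i' w - a' i' w))\<^sup>2)"
        if "1 \<le> i" "1 \<le> i'" "i \<noteq> i'" for i i'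
        using indX[OF that \<phi>m] by (simp add: \<phi>_def a_def a'_def)
      show "indep_var borel (a i) borel (a i')" if "1 \<le> i" "1 \<le> i'" "i \<noteq> i'" for i i'
        using indX[OF that l1.m_measurable] by (simp add: a_def[abs_def])
      show "expectation (\<lambda>w. (norm (a i w - a' i w))\<^sup>2) = ?num" if "1 \<le> i" for i
        using meanX[OF that \<phi>m] by (simp add: \<phi>_def a_def a'_def)
      show "expectation (\<lambda>w. (norm (a i w))\<^sup>2) = expectation (\<lambda>w. (norm (\<mu> (X w)))\<^sup>2)" if "1 \<le> i" for i
        using meanX[OF that n\<mu>m] by (simp add: a_def)
      show "expectation (a i) = expectation (\<lambda>w. \<mu> (X w))" if "1 \<le> i" for i
        using meanX[OF that l1.m_measurable] by (simp add: a_def[abs_def])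
      show "?den = expectation (\<lambda>w. (norm (\<mu> (X w)))\<^sup>2) - (norm (expectation (\<lambda>w. \<mu> (X w))))\<^sup>2"
        by (rule hvariance_eq[OF int\<mu> int\<mu>2])
      show "?den \<noteq> 0" using variance_pos by simp
      show "0 < \<delta>" by (rule \<delta>)
    qed
  qed
qed

end

text \<open>The variance is the denominator of the index; \<open>variance_pos\<close> keeps the
  index from being the quotient of 0 by 0. The case \<open>p = 1\<close> is included: the reduced
  forest then has no feature, and each of its trees averages over its whole leaf half.\<close>

theorem theorem1:
  fixes M :: "'w measure"
    and p j :: nat
    and k :: "real ^ 'd \<Rightarrow> real ^ 'd \<Rightarrow> real"
    and val :: "'h::{real_inner, banach, second_countable_topology} \<Rightarrow> real ^ 'd \<Rightarrow> real"
    and X :: "'w \<Rightarrow> input" and Y :: "'w \<Rightarrow> real ^ 'd"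
    and Xs :: "nat \<Rightarrow> 'w \<Rightarrow> input" and Ys :: "nat \<Rightarrow> 'w \<Rightarrow> real ^ 'd"
    and X' :: "nat \<Rightarrow> 'w \<Rightarrow> input"
    and C :: "('e, 'h) forest_construction"
    and \<pi> \<alpha> \<beta> :: real and \<kappa> :: nat
    and \<mu> \<mu>\<^sub>j :: "input \<Rightarrow> 'h"
  assumes prob: "prob_space M"
    and j: "1 \<le> p" "j \<in> {1..p}"
    and kernel: "positive_definite_kernel k" "rkhs_of k val"
    and kernel_bounded: "bounded (range (\<lambda>(y, y'). k y y'))"
    and kernel_continuous: "continuous_on UNIV (\<lambda>(y, y'). k y y')"
    and X_measurable: "X \<in> measurable M (input_space {1..p})"
    and Y_measurable: "Y \<in> borel_measurable M"
    and data_indep: "prob_space.indep_vars M (\<lambda>_. input_space {1..p} \<Otimes>\<^sub>M borel)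
                       (\<lambda>i w. (Xs i w, Ys i w)) {1..}"
    and data_law: "\<And>i. 1 \<le> i \<Longrightarrow>
                     distr M (input_space {1..p} \<Otimes>\<^sub>M borel) (\<lambda>w. (Xs i w, Ys i w)) =
                     distr M (input_space {1..p} \<Otimes>\<^sub>M borel) (\<lambda>w. (X w, Y w))"
    and test_indep: "prob_space.indep_vars M (\<lambda>_. input_space {1..p}) X' {1..}"
    and test_law: "\<And>i. 1 \<le> i \<Longrightarrow> distr M (input_space {1..p}) (X' i) = distr M (input_space {1..p}) X"
    and test_data_indep: "prob_space.indep_set M
          (sets (sigma_of M (\<lambda>w. \<lambda>i\<in>{1..}. (Xs i w, Ys i w))
                            (PiM {1..} (\<lambda>_. input_space {1..p} \<Otimes>\<^sub>M borel))))
          (sets (sigma_of M (\<lambda>w. \<lambda>i\<in>{1..}. X' i w) (PiM {1..} (\<lambda>_. input_space {1..p}))))"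
    and forest: "forest_properties \<pi> \<alpha> \<kappa> \<beta> {1..p} C"
                "forest_properties \<pi> \<alpha> \<kappa> \<beta> ({1..p} - {j}) C"
    and density: "has_bounded_cube_density M {1..p} X"
    and mu: "regression_function M (input_space {1..p}) X (\<lambda>w. kernel_section k val (Y w)) \<mu>"
    and mu_lipschitz: "lipschitz_on_cube {1..p} \<mu>"
    and mu_j: "regression_function M (input_space ({1..p} - {j})) (\<lambda>w. restrict (X w) ({1..p} - {j}))
                 (\<lambda>w. kernel_section k val (Y w)) \<mu>\<^sub>j"
    and mu_j_lipschitz: "lipschitz_on_cube ({1..p} - {j}) \<mu>\<^sub>j"
    and variance_pos: "hvariance M (\<lambda>w. \<mu> (X w)) > 0"
  shows "converges_in_probability M
           (\<lambda>n w. index_estimator C \<beta> p j n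
                    (\<lambda>i. (Xs i w, kernel_section k val (Ys i w))) (\<lambda>i. X' i w))
           (theoretical_index M p j X \<mu>)"
proof -
  interpret importance_setting M p k val X Y Xs Ys X' C \<beta>
    using prob kernel(2) kernel_bounded kernel_continuous X_measurable Y_measurable data_indep data_law
      test_indep test_law test_data_indep density by (rule importance_setting.intro)
  show ?thesis
    by (rule index_estimator_converges[OF forest mu mu_lipschitz mu_j mu_j_lipschitz variance_pos])
qed

end
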